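(* Variable fixing for packing orbitopes $\mathrm{O}^{\le}_{p,q}$ can be done in time $O(pq)$, by reduction to orbitopal fixing for the partitioning orbitope $\mathrm{O}^{=}_{p+1,q+1}$. That is, there is an algorithm which, given integers $p\ge q\ge 2$ and disjoint subsets $I_0,I_1\subseteq\mathcal{I}_{p,q}$, runs in time $O(pq)$ and either determines that $\mathrm{Fix}_F(\mathrm{O}^{\le}_{p,q})=\varnothing$ or computes the pair $(I_0^\star,I_1^\star)$ defining the cube face $\mathrm{Fix}_F(\mathrm{O}^{\le}_{p,q})$, where $F$ is the face of $[0,1]^{\mathcal{I}_{p,q}}$ defined by $(I_0,I_1)$; and this can be achieved by a reduction to the orbitopal fixing problem for $\mathrm{O}^{=}_{p+1,q+1}$.
   Context: Notation: $[n]=\{1,\dots,n\}$. For integers $p\ge q\ge 2$ let $\mathcal{I}_{p,q}=\{(i,j)\in[p]\times[q] : i\ge j\}$, $q(i)=\min\{i,q\}$ and $\mathrm{row}_i=\{(i,j): j\in[q(i)]\}$. Orbitopes: the partitioning orbitope $\mathrm{O}^{=}_{p,q}$ (resp. packing orbitope $\mathrm{O}^{\le}_{p,q}$) is the convex hull of all 0/1-matrices $x\in\{0,1\}^{[p]\times[q]}$ with exactly one (resp. at most one) 1-entry per row whose columns are in non-increasing lexicographical order, i.e. $\sum_{i=1}^p 2^{p-i}x_{ij}\ge\sum_{i=1}^p 2^{p-i}x_{i,j+1}$ for all $j\in[q-1]$. All such matrices have $x_{ij}=0$ for $i<j$; these components are dropped and both polytopes are regarded as subsets of $\mathbb{R}^{\mathcal{I}_{p,q}}$.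 (With these conventions $\mathrm{O}^{\le}_{p,q}$ is the image of $\mathrm{O}^{=}_{p+1,q+1}$ under orthogonal projection onto the coordinates $(i,j)\in\mathcal{I}_{p+1,q+1}$ with $i,j>1$, after renaming $(i,j)$ to $(i-1,j-1)$.) Cube faces and fixing: for disjoint $I_0,I_1\subseteq\mathcal{I}_{p,q}$, the face of the cube $[0,1]^{\mathcal{I}_{p,q}}$ defined by $(I_0,I_1)$ is $\{x\in[0,1]^{\mathcal{I}_{p,q}} : x_{ij}=0 \text{ for } (i,j)\in I_0,\ x_{ij}=1\text{ for }(i,j)\in I_1\}$. For a polytope $P\subseteq[0,1]^{\mathcal{I}_{p,q}}$ and a face $F$ of the cube, $\mathrm{Fix}_F(P)$ is the smallest face of the cube containing all 0/1-points of $P\cap F$ (the empty face if there are none). If nonempty, it is defined by the pair $(I_0^\star,I_1^\star)$, where $I_0^\star$ (resp. $I_1^\star$) is the set of all indices $(i,j)$ with $x_{ij}=0$ (resp. $x_{ij}=1$) for all 0/1-points $x\in P\cap F$. Orbitopal fixing for $\mathrm{O}^{=}_{p,q}$ is the problem, given $I_0,I_1\subseteq\mathcal{I}_{p,q}$ with $|I_0\cap\mathrm{row}_i|\le q(i)-1$ for all $i\in[p]$ and such that $(i,j)\in I_1$ implies $(i,\ell)\in I_0$ for all $\ell\in[q(i)]\setminus\{j\}$, to compute the pair $(I_0^\star,I_1^\star)$ defining $\mathrm{Fix}_F(\mathrm{O}^{=}_{p,q})$ (with $F$ the cube face defined by $(I_0,I_1)$) or to determine that $\mathrm{Fix}_F(\mathrm{O}^{=}_{p,q})=\varnothing$.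 *)

theory Defs
  imports "HOL-Analysis.Finite_Function_Topology" "HOL-Analysis.Polytope"
begin

section \<open>Orbitopes\<close>

text \<open>
  The dimensions \<open>p\<close> and \<open>q\<close> vary within the statement, so points of \<open>\<real>\<^bsup>[p] \<times> [q]\<^esup>\<close> are modelled
  as finitely supported real functions on pairs of numbers that vanish outside the index set in
  question. The library makes these a real vector space, so that \<^term>\<open>(hull)\<close> and
  \<^term>\<open>(face_of)\<close> apply to them.
\<close>

type_synonym point = "(nat \<times> nat) \<Rightarrow>\<^sub>0 real"

abbreviation entry :: "point \<Rightarrow> nat \<Rightarrow> nat \<Rightarrow> real" where
  "entry x i j \<equiv> Poly_Mapping.lookup x (i, j)"

definition idx :: "nat \<Rightarrow> nat \<Rightarrow> (nat \<times> nat) set" where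
  "idx p q = {(i, j). i \<in> {1..p} \<and> j \<in> {1..q} \<and> i \<ge> j}"

definition row_idx :: "nat \<Rightarrow> nat \<Rightarrow> (nat \<times> nat) set" where
  "row_idx q i = {(i, j) | j. j \<in> {1..min i q}}"

definition zero_one_matrices :: "nat \<Rightarrow> nat \<Rightarrow> point set" where
  "zero_one_matrices p q =
     {x. Poly_Mapping.keys x \<subseteq> {1..p} \<times> {1..q} \<and>
         (\<forall>i\<in>{1..p}. \<forall>j\<in>{1..q}. entry x i j \<in> {0, 1})}"

definition lex_sorted_columns :: "nat \<Rightarrow> nat \<Rightarrow> point \<Rightarrow> bool" where
  "lex_sorted_columns p q x \<longleftrightarrow>
     (\<forall>j\<in>{1..q - 1}.
        (\<Sum>i = 1..p. 2 ^ (p - i) * entry x i j) \<ge> (\<Sum>i = 1..p. 2 ^ (p - i) * entry x i (j + 1)))"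

definition partitioning_matrices :: "nat \<Rightarrow> nat \<Rightarrow> point set" where
  "partitioning_matrices p q =
     {x \<in> zero_one_matrices p q.
        (\<forall>i\<in>{1..p}. card {j \<in> {1..q}. entry x i j = 1} = 1) \<and> lex_sorted_columns p q x}"

definition packing_matrices :: "nat \<Rightarrow> nat \<Rightarrow> point set" where
  "packing_matrices p q =
     {x \<in> zero_one_matrices p q.
        (\<forall>i\<in>{1..p}. card {j \<in> {1..q}. entry x i j = 1} \<le> 1) \<and> lex_sorted_columns p q x}"

text \<open>
  Dropping the components with \<open>i < j\<close>, which vanish on all these matrices (see
  \<open>packing_matrices_keys\<close> below), does not change a finitely supported function: both orbitopes
  are already subsets of \<open>\<real>\<^bsup>\<I>\<^esup>\<close> for \<open>\<I> = idx p q\<close>.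
\<close>

definition partitioning_orbitope :: "nat \<Rightarrow> nat \<Rightarrow> point set" where
  "partitioning_orbitope p q = convex hull (partitioning_matrices p q)"

definition packing_orbitope :: "nat \<Rightarrow> nat \<Rightarrow> point set" where
  "packing_orbitope p q = convex hull (packing_matrices p q)"

lemma partitioning_matrices_subset: "partitioning_matrices p q \<subseteq> packing_matrices p q"
  by (auto simp: partitioning_matrices_def packing_matrices_def)

lemma packing_matrices_left_neighbour:
  assumes x: "x \<in> packing_matrices p q" and i: "i \<in> {1..p}" and j: "j \<in> {1..<q}"
    and one: "entry x i (Suc j) = 1"
  shows "\<exists>k\<in>{1..<i}. entry x k j = 1"
proof (rule ccontr)
  assume "\<not> ?thesis"
  then have no: "\<And>k. k \<in> {1..<i} \<Longrightarrow> entry x k j \<noteq> 1" by blast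
  have zo: "\<And>k l. k \<in> {1..p} \<Longrightarrow> l \<in> {1..q} \<Longrightarrow> entry x k l = 0 \<or> entry x k l = 1"
    using x by (auto simp: packing_matrices_def zero_one_matrices_def)
  have "entry x i j \<noteq> 1"
  proof
    assume "entry x i j = 1"
    then have "{j, Suc j} \<subseteq> {l \<in> {1..q}. entry x i l = 1}" using one j by auto
    then have "card {j, Suc j} \<le> card {l \<in> {1..q}. entry x i l = 1}"
      by (intro card_mono) auto
    moreover have "card {l \<in> {1..q}. entry x i l = 1} \<le> 1"
      using x i by (auto simp: packing_matrices_def)
    ultimately show False by simp
  qed
  then have z: "entry x k j = 0" if "k \<in> {1..i}" for k
    using zo[of k j] no[of k] that i j by (cases "k = i") auto
  have pow: "(\<Sum>k = Suc i..p. (2::real) ^ (p - k)) < 2 ^ (p - i)"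
  proof -
    have "(\<Sum>k = Suc i..p. (2::real) ^ (p - k)) = (\<Sum>m < p - i. 2 ^ m)"
      by (rule sum.reindex_bij_witness[of _ "\<lambda>m. p - m" "\<lambda>k. p - k"]) auto
    then show ?thesis by (simp add: sum_gp_strict)
  qed
  have "(\<Sum>k = 1..p. 2 ^ (p - k) * entry x k j) = (\<Sum>k = Suc i..p. 2 ^ (p - k) * entry x k j)"
    by (rule sum.mono_neutral_right) (use i z in auto)
  also have "\<dots> \<le> (\<Sum>k = Suc i..p. 2 ^ (p - k))"
  proof (rule sum_mono)
    fix k assume "k \<in> {Suc i..p}"
    then show "2 ^ (p - k) * entry x k j \<le> 2 ^ (p - k)" using zo[of k j] i j by auto
  qed
  also have "\<dots> < 2 ^ (p - i) * entry x i (Suc j)" using pow one by simp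
  also have "\<dots> \<le> (\<Sum>k = 1..p. 2 ^ (p - k) * entry x k (Suc j))"
  proof (rule member_le_sum[OF i])
    fix k assume "k \<in> {1..p} - {i}"
    then show "0 \<le> 2 ^ (p - k) * entry x k (Suc j)" using zo[of k "Suc j"] j by auto
  qed simp
  finally have "(\<Sum>k = 1..p. 2 ^ (p - k) * entry x k j) < (\<Sum>k = 1..p. 2 ^ (p - k) * entry x k (Suc j))" .
  moreover have "(\<Sum>k = 1..p. 2 ^ (p - k) * entry x k (j + 1)) \<le> (\<Sum>k = 1..p. 2 ^ (p - k) * entry x k j)"
    using x j unfolding packing_matrices_def lex_sorted_columns_def by auto
  ultimately show False by simp
qed

lemma packing_matrices_keys:
  assumes x: "x \<in> packing_matrices p q"
  shows "Poly_Mapping.keys x \<subseteq> idx p q"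
proof -
  have tri: "j \<le> i" if "i \<in> {1..p}" "j \<in> {1..q}" "entry x i j = 1" for i j
    using that
  proof (induction j arbitrary: i)
    case (Suc j)
    show ?case
    proof (cases "j = 0")
      case False
      then have "j \<in> {1..<q}" using Suc.prems(2) by simp
      from packing_matrices_left_neighbour[OF x Suc.prems(1) this Suc.prems(3)]
      obtain k where k: "k \<in> {1..<i}" "entry x k j = 1" by blast
      then have "j \<le> k" using Suc.IH[of k] Suc.prems(1,2) False by simp
      then show ?thesis using k by simp
    qed (use Suc.prems(1) in simp)
  qed simp
  show ?thesis
  proof
    fix ij assume k: "ij \<in> Poly_Mapping.keys x"
    obtain i j where ij: "ij = (i, j)" by (cases ij)
    from x k have "i \<in> {1..p}" "j \<in> {1..q}" and "entry x i j \<in> {0, 1}"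
      by (auto simp: packing_matrices_def zero_one_matrices_def ij)
    moreover from this k have "entry x i j = 1" by (simp add: ij in_keys_iff)
    ultimately show "ij \<in> idx p q" using tri[of i j] by (simp add: idx_def ij)
  qed
qed


section \<open>Cube faces and fixing\<close>

definition cube :: "nat \<Rightarrow> nat \<Rightarrow> point set" where
  "cube p q = {x. Poly_Mapping.keys x \<subseteq> idx p q \<and> (\<forall>(i, j)\<in>idx p q. 0 \<le> entry x i j \<and> entry x i j \<le> 1)}"

definition cube_face :: "nat \<Rightarrow> nat \<Rightarrow> (nat \<times> nat) set \<Rightarrow> (nat \<times> nat) set \<Rightarrow> point set" where
  "cube_face p q I0 I1 =
     {x \<in> cube p q. (\<forall>(i, j)\<in>I0. entry x i j = 0) \<and> (\<forall>(i, j)\<in>I1. entry x i j = 1)}"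

definition zero_one_points :: "nat \<Rightarrow> nat \<Rightarrow> point set \<Rightarrow> point set" where
  "zero_one_points p q S = {x \<in> S. \<forall>(i, j)\<in>idx p q. entry x i j \<in> {0, 1}}"

text \<open>The empty set is a face in the sense of \<^term>\<open>(face_of)\<close>.\<close>

definition Fix :: "nat \<Rightarrow> nat \<Rightarrow> point set \<Rightarrow> point set \<Rightarrow> point set" where
  "Fix p q F P = \<Inter>{G. G face_of cube p q \<and> zero_one_points p q (P \<inter> F) \<subseteq> G}"

definition fixed_at :: "nat \<Rightarrow> nat \<Rightarrow> real \<Rightarrow> point set \<Rightarrow> point set \<Rightarrow> (nat \<times> nat) set" where
  "fixed_at p q v F P = {(i, j) \<in> idx p q. \<forall>x \<in> zero_one_points p q (P \<inter> F). entry x i j = v}"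

lemma convex_cube: "convex (cube p q)"
proof (rule convexI)
  fix x y :: point and u v :: real
  assume x: "x \<in> cube p q" and y: "y \<in> cube p q" and uv: "0 \<le> u" "0 \<le> v" "u + v = 1"
  have scale: "Poly_Mapping.lookup (r *\<^sub>R z) k = r * Poly_Mapping.lookup z k" for r k and z :: point
  proof -
    have "finite {k. r *\<^sub>R Poly_Mapping.lookup z k \<noteq> 0}"
      by (rule finite_subset[OF _ finite_lookup[of z]]) auto
    then show ?thesis by (simp add: scaleR_poly_mapping_def lookup_Abs_poly_mapping)
  qed
  have e: "entry (u *\<^sub>R x + v *\<^sub>R y) i j = u * entry x i j + v * entry y i j" for i j
    by (simp add: lookup_add scale)
  have "Poly_Mapping.keys (u *\<^sub>R x + v *\<^sub>R y) \<subseteq> Poly_Mapping.keys x \<union> Poly_Mapping.keys y"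
    by (auto simp: in_keys_iff lookup_add scale)
  then have "Poly_Mapping.keys (u *\<^sub>R x + v *\<^sub>R y) \<subseteq> idx p q"
    using x y by (auto simp: cube_def)
  moreover have "0 \<le> entry (u *\<^sub>R x + v *\<^sub>R y) i j \<and> entry (u *\<^sub>R x + v *\<^sub>R y) i j \<le> 1"
    if "(i, j) \<in> idx p q" for i j
  proof -
    have "0 \<le> entry x i j" "entry x i j \<le> 1" "0 \<le> entry y i j" "entry y i j \<le> 1"
      using x y that by (auto simp: cube_def)
    then show ?thesis using uv by (simp add: e convex_bound_le)
  qed
  ultimately show "u *\<^sub>R x + v *\<^sub>R y \<in> cube p q" by (auto simp: cube_def)
qed

lemma Fix_least_face:
  assumes "F \<subseteq> cube p q"
  shows "Fix p q F P face_of cube p q" "zero_one_points p q (P \<inter> F) \<subseteq> Fix p q F P"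
    and "\<And>G. G face_of cube p q \<Longrightarrow> zero_one_points p q (P \<inter> F) \<subseteq> G \<Longrightarrow> Fix p q F P \<subseteq> G"
proof -
  have "cube p q \<in> {G. G face_of cube p q \<and> zero_one_points p q (P \<inter> F) \<subseteq> G}"
    using assms by (auto simp: face_of_refl convex_cube zero_one_points_def)
  then show "Fix p q F P face_of cube p q"
    unfolding Fix_def by (intro face_of_Inter) auto
qed (auto simp: Fix_def)

definition packing_instance ::
    "nat \<Rightarrow> nat \<Rightarrow> (nat \<times> nat) set \<Rightarrow> (nat \<times> nat) set \<Rightarrow> bool" where
  "packing_instance p q I0 I1 \<longleftrightarrow>
     2 \<le> q \<and> q \<le> p \<and> I0 \<subseteq> idx p q \<and> I1 \<subseteq> idx p q \<and> I0 \<inter> I1 = {}"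

definition partitioning_instance ::
    "nat \<Rightarrow> nat \<Rightarrow> (nat \<times> nat) set \<Rightarrow> (nat \<times> nat) set \<Rightarrow> bool" where
  "partitioning_instance p q I0 I1 \<longleftrightarrow>
     2 \<le> q \<and> q \<le> p \<and> I0 \<subseteq> idx p q \<and> I1 \<subseteq> idx p q \<and>
     (\<forall>i\<in>{1..p}. card (I0 \<inter> row_idx q i) \<le> min i q - 1) \<and>
     (\<forall>(i, j)\<in>I1. \<forall>l\<in>{1..min i q} - {j}. (i, l) \<in> I0)"


section \<open>Programs and their running time\<close>

text \<open>
  A random access machine with structured control. Registers and the cells of the two-dimensional
  arrays hold natural numbers; every instruction and every test takes one unit of time. The only
  arithmetic operations are increment and decrement (truncated at 0). So a number, in particular
  an array index, exceeds the numbers in the input and the program text by at most the number of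
  steps made: the unit cost measure cannot be exploited by computing with long numbers, and a
  linear time algorithm only needs words of logarithmic length.
\<close>

type_synonym name = string

record store =
  reg :: "name \<Rightarrow> nat"
  arr :: "name \<Rightarrow> nat \<Rightarrow> nat \<Rightarrow> nat"

datatype test = Eq name name | Less name name

datatype com =
    Skip
  | Const name nat
  | Copy name name
  | Incr name
  | Decr name
  | Read name name name name     \<comment> \<open>\<open>Read x a i j\<close>: \<open>x := a[i, j]\<close>\<close>
  | Write name name name name    \<comment> \<open>\<open>Write a i j x\<close>: \<open>a[i, j] := x\<close>\<close>
  | Seq com com
  | Cond test com com
  | While test com

fun holds :: "test \<Rightarrow> store \<Rightarrow> bool" where
  "holds (Eq x y) s \<longleftrightarrow> reg s x = reg s y"
| "holds (Less x y) s \<longleftrightarrow> reg s x < reg s y"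

definition set_reg :: "name \<Rightarrow> nat \<Rightarrow> store \<Rightarrow> store" where
  "set_reg x n s = s\<lparr>reg := (reg s)(x := n)\<rparr>"

definition set_arr :: "name \<Rightarrow> nat \<Rightarrow> nat \<Rightarrow> nat \<Rightarrow> store \<Rightarrow> store" where
  "set_arr a i j n s = s\<lparr>arr := (arr s)(a := (arr s a)(i := (arr s a i)(j := n)))\<rparr>"

text \<open>\<open>exec c s n t\<close>: started in store \<open>s\<close>, program \<open>c\<close> halts after exactly \<open>n\<close> steps in store \<open>t\<close>.\<close>

inductive exec :: "com \<Rightarrow> store \<Rightarrow> nat \<Rightarrow> store \<Rightarrow> bool" where
  Skip: "exec Skip s 1 s"
| Const: "exec (Const x k) s 1 (set_reg x k s)"
| Copy: "exec (Copy x y) s 1 (set_reg x (reg s y) s)"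
| Incr: "exec (Incr x) s 1 (set_reg x (reg s x + 1) s)"
| Decr: "exec (Decr x) s 1 (set_reg x (reg s x - 1) s)"
| Read: "exec (Read x a i j) s 1 (set_reg x (arr s a (reg s i) (reg s j)) s)"
| Write: "exec (Write a i j x) s 1 (set_arr a (reg s i) (reg s j) (reg s x) s)"
| Seq: "exec c1 s m u \<Longrightarrow> exec c2 u n t \<Longrightarrow> exec (Seq c1 c2) s (m + n) t"
| Cond_True: "holds b s \<Longrightarrow> exec c1 s n t \<Longrightarrow> exec (Cond b c1 c2) s (1 + n) t"
| Cond_False: "\<not> holds b s \<Longrightarrow> exec c2 s n t \<Longrightarrow> exec (Cond b c1 c2) s (1 + n) t"
| While_True: "holds b s \<Longrightarrow> exec c s m u \<Longrightarrow> exec (While b c) u n t \<Longrightarrow>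
    exec (While b c) s (1 + m + n) t"
| While_False: "\<not> holds b s \<Longrightarrow> exec (While b c) s 1 s"

lemma exec_deterministic: "exec c s n t \<Longrightarrow> exec c s n' t' \<Longrightarrow> n' = n \<and> t' = t"
proof (induction arbitrary: n' t' rule: exec.induct)
  case (Seq c1 s m u c2 n t)
  from Seq.prems obtain m' u' k' where "exec c1 s m' u'" "exec c2 u' k' t'" "n' = m' + k'"
    by cases auto
  with Seq.IH(1)[of m' u'] Seq.IH(2)[of k' t'] show ?case by simp
next
  case (Cond_True b s c1 n t c2)
  from Cond_True.prems Cond_True.hyps(1) obtain k' where "exec c1 s k' t'" "n' = 1 + k'"
    by cases auto
  with Cond_True.IH[of k' t'] show ?case by simp
next
  case (Cond_False b s c2 n t c1)
  from Cond_False.prems Cond_False.hyps(1) obtain k' where "exec c2 s k' t'" "n' = 1 + k'"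
    by cases auto
  with Cond_False.IH[of k' t'] show ?case by simp
next
  case (While_True b s c m u n t)
  from While_True.prems While_True.hyps(1) obtain m' u' k'
    where "exec c s m' u'" "exec (While b c) u' k' t'" "n' = 1 + m' + k'"
    by cases auto
  with While_True.IH(1)[of m' u'] While_True.IH(2)[of k' t'] show ?case by simp
next
  case (While_False b s c)
  from While_False.prems While_False.hyps(1) show ?case by cases auto
next
  case (Skip s)
  from Skip.prems show ?case by cases simp_all
next
  case (Const x k s)
  from Const.prems show ?case by cases simp_all
next
  case (Copy x y s)
  from Copy.prems show ?case by cases simp_all
next
  case (Incr x s)
  from Incr.prems show ?case by cases simp_all
next
  case (Decr x s)
  from Decr.prems show ?case by cases simp_all
next
  case (Read x a i j s)
  from Read.prems show ?case by cases simp_all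
next
  case (Write a i j x s)
  from Write.prems show ?case by cases simp_all
qed

definition halts_within :: "com \<Rightarrow> store \<Rightarrow> nat \<Rightarrow> (store \<Rightarrow> bool) \<Rightarrow> bool" where
  "halts_within c s N Q \<longleftrightarrow> (\<exists>n t. exec c s n t \<and> n \<le> N \<and> Q t)"


section \<open>Fixing algorithms\<close>

text \<open>
  An index set pair is passed in the arrays \<open>I0\<close> and \<open>I1\<close> as characteristic functions on
  \<^term>\<open>idx p q\<close>. Nothing is assumed about any other part of the memory.
\<close>

definition stores_pair ::
    "nat \<Rightarrow> nat \<Rightarrow> (nat \<times> nat) set \<Rightarrow> (nat \<times> nat) set \<Rightarrow> store \<Rightarrow> bool" where
  "stores_pair p q I0 I1 s \<longleftrightarrow>
     reg s ''p'' = p \<and> reg s ''q'' = q \<and>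
     (\<forall>(i, j)\<in>idx p q. arr s ''I0'' i j = of_bool ((i, j) \<in> I0) \<and>
                       arr s ''I1'' i j = of_bool ((i, j) \<in> I1))"

text \<open>
  The result of fixing: register \<open>empty\<close> tells whether \<^term>\<open>Fix p q F P\<close> is empty; if it is
  not, the stored pair is the defining pair of this cube face.
\<close>

definition stores_fixing :: "nat \<Rightarrow> nat \<Rightarrow> point set \<Rightarrow> point set \<Rightarrow> store \<Rightarrow> bool" where
  "stores_fixing p q F P s \<longleftrightarrow>
     (if Fix p q F P = {} then reg s ''empty'' = 1
      else reg s ''empty'' = 0 \<and>
           stores_pair p q (fixed_at p q 0 F P) (fixed_at p q 1 F P) s \<and>
           cube_face p q (fixed_at p q 0 F P) (fixed_at p q 1 F P) = Fix p q F P)"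

definition solves_packing_fixing :: "com \<Rightarrow> (nat \<Rightarrow> nat \<Rightarrow> nat) \<Rightarrow> bool" where
  "solves_packing_fixing c T \<longleftrightarrow>
     (\<forall>p q I0 I1 s. packing_instance p q I0 I1 \<longrightarrow> stores_pair p q I0 I1 s \<longrightarrow>
        halts_within c s (T p q)
          (stores_fixing p q (cube_face p q I0 I1) (packing_orbitope p q)))"

definition solves_orbitopal_fixing :: "com \<Rightarrow> (nat \<Rightarrow> nat \<Rightarrow> nat) \<Rightarrow> bool" where
  "solves_orbitopal_fixing c T \<longleftrightarrow>
     (\<forall>p q I0 I1 s. partitioning_instance p q I0 I1 \<longrightarrow> stores_pair p q I0 I1 s \<longrightarrow>
        halts_within c s (T p q)
          (stores_fixing p q (cube_face p q I0 I1) (partitioning_orbitope p q)))"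

text \<open>
  A reduction of fixing for the packing orbitope with parameters \<open>(p, q)\<close> to orbitopal fixing
  for the partitioning orbitope with parameters \<open>(p + 1, q + 1)\<close>: \<open>pre\<close> builds an instance of the
  latter, and \<open>post\<close> turns the solution of that instance, found in a store that is arbitrary
  otherwise, into the solution of the given instance.
\<close>

definition reduces_packing_to_partitioning :: "com \<Rightarrow> com \<Rightarrow> (nat \<Rightarrow> nat \<Rightarrow> nat) \<Rightarrow> bool" where
  "reduces_packing_to_partitioning pre post T \<longleftrightarrow>
     (\<forall>p q I0 I1 s. packing_instance p q I0 I1 \<longrightarrow> stores_pair p q I0 I1 s \<longrightarrow>
        (\<exists>J0 J1. partitioning_instance (p + 1) (q + 1) J0 J1 \<and>
           halts_within pre s (T p q) (stores_pair (p + 1) (q + 1) J0 J1) \<and>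
           (\<forall>t. stores_fixing (p + 1) (q + 1) (cube_face (p + 1) (q + 1) J0 J1)
                  (partitioning_orbitope (p + 1) (q + 1)) t \<longrightarrow>
                halts_within post t (T p q)
                  (stores_fixing p q (cube_face p q I0 I1) (packing_orbitope p q)))))"

lemma reduction_composes:
  assumes red: "reduces_packing_to_partitioning pre post T" and sol: "solves_orbitopal_fixing c S"
  shows "solves_packing_fixing (Seq pre (Seq c post)) (\<lambda>p q. S (p + 1) (q + 1) + 2 * T p q)"
  unfolding solves_packing_fixing_def
proof (intro allI impI)
  fix p q I0 I1 s
  assume "packing_instance p q I0 I1" "stores_pair p q I0 I1 s"
  with red obtain J0 J1 where inst: "partitioning_instance (p + 1) (q + 1) J0 J1"
    and pre: "halts_within pre s (T p q) (stores_pair (p + 1) (q + 1) J0 J1)"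
    and post: "\<And>t. stores_fixing (p + 1) (q + 1) (cube_face (p + 1) (q + 1) J0 J1)
        (partitioning_orbitope (p + 1) (q + 1)) t \<Longrightarrow>
      halts_within post t (T p q) (stores_fixing p q (cube_face p q I0 I1) (packing_orbitope p q))"
    unfolding reduces_packing_to_partitioning_def by blast
  from pre obtain n1 u where 1: "exec pre s n1 u" "n1 \<le> T p q" "stores_pair (p + 1) (q + 1) J0 J1 u"
    by (auto simp: halts_within_def)
  with sol inst obtain n2 v where 2: "exec c u n2 v" "n2 \<le> S (p + 1) (q + 1)"
    "stores_fixing (p + 1) (q + 1) (cube_face (p + 1) (q + 1) J0 J1)
       (partitioning_orbitope (p + 1) (q + 1)) v"
    unfolding solves_orbitopal_fixing_def halts_within_def by blast
  from post[OF 2(3)] obtain n3 w where 3: "exec post v n3 w" "n3 \<le> T p q"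
    "stores_fixing p q (cube_face p q I0 I1) (packing_orbitope p q) w"
    by (auto simp: halts_within_def)
  have "exec (Seq pre (Seq c post)) s (n1 + (n2 + n3)) w"
    using 1 2 3 by (intro exec.Seq)
  then show "halts_within (Seq pre (Seq c post)) s (S (p + 1) (q + 1) + 2 * T p q)
      (stores_fixing p q (cube_face p q I0 I1) (packing_orbitope p q))"
    unfolding halts_within_def using 1 2 3 by (intro exI conjI) auto
qed

end

theory Submission
  imports Defs
begin

text \<open>
  The vertices of the orbitopes are restricted growth strings: the value \<open>c i\<close> of row \<open>i\<close> is the
  column of its 1-entry, and a new value must be the successor of an old one. So fixing asks
  which values a growth string with \<open>c i\<close> in a prescribed set \<open>D i\<close> can take. The only relevant
  information about a prefix is its maximum, and a completion for some maximum is one for every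
  larger maximum. Hence a least completable maximum \<open>b i\<close>, computed backwards, and a largest
  reachable maximum \<open>m i\<close>, computed forwards, decide everything: \<open>j \<in> D i\<close> is attained iff
  \<open>j \<le> m (i - 1) + 1\<close> and \<open>b i \<le> max (m (i - 1)) j\<close>. For the packing orbitope, the new first
  column of the larger partitioning orbitope records the zero rows.
\<close>

section \<open>Faces of the cube\<close>

text \<open>An instance of orbitopal fixing must leave a free cell in every row, so a contradictory
  packing row (two entries fixed to 1) cannot be handed over as an empty row. Such instances are
  mapped to one infeasible pattern instead, which fits because \<open>p\<close> and \<open>q\<close>
  are at least 2. Otherwise an entry fixed to 1 is conveyed by forbidding the rest of its row, slack
  cell included, and the second index set of the larger instance is empty. The additional row is as
  essential as the additional column: its value is always 1, which gives every later value 2 (an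
  original 1) its predecessor. Geometry enters only at the start: a convex hull of 0/1-points has no
  further 0/1-points, and the equation between \<open>Fix\<close> and its defining cube face holds
  for arbitrary point sets, so everything else can be phrased by sets of codes. The reduction
  programs shift the arrays in place, which dictates the direction of their row loops. The constants
  in the time bounds are rounded up generously.\<close>

lemma lookup_scaleR [simp]:
  fixes z :: point
  shows "Poly_Mapping.lookup (r *\<^sub>R z) k = r * Poly_Mapping.lookup z k"
proof -
  have "finite {k. r *\<^sub>R Poly_Mapping.lookup z k \<noteq> 0}"
    by (rule finite_subset[OF _ finite_lookup[of z]]) auto
  then show ?thesis by (simp add: scaleR_poly_mapping_def lookup_Abs_poly_mapping)
qed

lemma finite_idx [simp]: "finite (idx p q)"
  by (rule finite_subset[of _ "{1..p} \<times> {1..q}"]) (auto simp: idx_def)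

lemma cube_face_subset: "cube_face p q I0 I1 \<subseteq> cube p q"
  by (auto simp: cube_face_def)

lemma convex_cube_face: "convex (cube_face p q I0 I1)"
proof (rule convexI)
  fix x y :: point and u v :: real
  assume x: "x \<in> cube_face p q I0 I1" and y: "y \<in> cube_face p q I0 I1"
    and uv: "0 \<le> u" "0 \<le> v" "u + v = 1"
  then have "u *\<^sub>R x + v *\<^sub>R y \<in> cube p q"
    using convexD[OF convex_cube] cube_face_subset by blast
  then show "u *\<^sub>R x + v *\<^sub>R y \<in> cube_face p q I0 I1"
    using x y uv by (auto simp: cube_face_def lookup_add)
qed

lemma convex_comb_eq_0:
  fixes a b u :: real
  assumes "(1 - u) * a + u * b = 0" "0 < u" "u < 1" "0 \<le> a" "0 \<le> b"
  shows "a = 0 \<and> b = 0"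
proof -
  have "0 \<le> (1 - u) * a" "0 \<le> u * b" using assms by auto
  then have "(1 - u) * a = 0" "u * b = 0" using assms(1) by linarith+
  then show ?thesis using assms by auto
qed

text \<open>0 and 1 are the ends of the range of a coordinate, so a proper convex combination
  attains one of them only if both endpoints do; for the value 1 the argument is applied to
  \<open>1 - entry\<close>.\<close>

lemma cube_face_face_of:
  assumes "I0 \<subseteq> idx p q" "I1 \<subseteq> idx p q"
  shows "cube_face p q I0 I1 face_of cube p q"
  unfolding face_of_def
proof (intro conjI ballI impI cube_face_subset convex_cube_face)
  fix a b x
  assume ab: "a \<in> cube p q" "b \<in> cube p q" and x: "x \<in> cube_face p q I0 I1" "x \<in> open_segment a b"
  from x(2) obtain u where u: "0 < u" "u < 1" and xe: "x = (1 - u) *\<^sub>R a + u *\<^sub>R b"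
    by (auto simp: in_segment)
  have bd: "0 \<le> entry a i j" "entry a i j \<le> 1" "0 \<le> entry b i j" "entry b i j \<le> 1"
    if "(i, j) \<in> idx p q" for i j
    using ab that by (auto simp: cube_def)
  have e: "entry x i j = (1 - u) * entry a i j + u * entry b i j" for i j
    by (simp add: xe lookup_add)
  have 0: "entry a i j = 0 \<and> entry b i j = 0" if "(i, j) \<in> I0" for i j
  proof -
    have "(i, j) \<in> idx p q" "entry x i j = 0" using that assms x(1) by (auto simp: cube_face_def)
    then show ?thesis using convex_comb_eq_0[of u "entry a i j" "entry b i j"] bd[of i j] e[of i j] u
      by simp
  qed
  have 1: "entry a i j = 1 \<and> entry b i j = 1" if "(i, j) \<in> I1" for i j
  proof -
    have "(i, j) \<in> idx p q" "entry x i j = 1" using that assms x(1) by (auto simp: cube_face_def)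
    moreover have "(1 - u) * (1 - entry a i j) + u * (1 - entry b i j) = 1 - entry x i j"
      by (simp add: e algebra_simps)
    ultimately show ?thesis
      using convex_comb_eq_0[of u "1 - entry a i j" "1 - entry b i j"] bd[of i j] u by simp
  qed
  show "a \<in> cube_face p q I0 I1" "b \<in> cube_face p q I0 I1"
    using ab 0 1 by (auto simp: cube_face_def)
qed

section \<open>The smallest cube face containing given 0/1-points\<close>

lemma finite_zero_one_points:
  assumes "S \<subseteq> cube p q"
  shows "finite (zero_one_points p q S)"
proof (rule finite_imageD)
  \<comment> \<open>A 0/1-point of the cube is determined by the set of its 1-entries.\<close>
  let ?f = "\<lambda>x::point. {k \<in> idx p q. Poly_Mapping.lookup x k = 1}"
  show "finite (?f ` zero_one_points p q S)"
    by (rule finite_subset[of _ "Pow (idx p q)"]) auto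
  show "inj_on ?f (zero_one_points p q S)"
  proof (intro inj_onI poly_mapping_eqI)
    fix x y k assume x: "x \<in> zero_one_points p q S" and y: "y \<in> zero_one_points p q S"
      and eq: "?f x = ?f y"
    show "Poly_Mapping.lookup x k = Poly_Mapping.lookup y k"
    proof (cases "k \<in> idx p q")
      case True
      then have "Poly_Mapping.lookup x k \<in> {0, 1}" "Poly_Mapping.lookup y k \<in> {0, 1}"
        using x y by (auto simp: zero_one_points_def)
      moreover have "Poly_Mapping.lookup x k = 1 \<longleftrightarrow> Poly_Mapping.lookup y k = 1"
        using eq True by blast
      ultimately show ?thesis by auto
    next
      case False
      then have "k \<notin> Poly_Mapping.keys x" "k \<notin> Poly_Mapping.keys y"
        using x y assms by (auto simp: zero_one_points_def cube_def)
      then show ?thesis by (simp add: in_keys_iff)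
    qed
  qed
qed

text \<open>
  The average of the 0/1-points lies in the relative interior of the face cut out by the fixed
  coordinates, so every face of the cube containing it contains that whole face.
\<close>

lemma Fix_eq_cube_face:
  assumes F: "F \<subseteq> cube p q" and ne: "zero_one_points p q (P \<inter> F) \<noteq> {}"
  shows "Fix p q F P = cube_face p q (fixed_at p q 0 F P) (fixed_at p q 1 F P)" (is "_ = ?K")
proof
  let ?S = "zero_one_points p q (P \<inter> F)"
  have sub: "fixed_at p q v F P \<subseteq> idx p q" for v by (auto simp: fixed_at_def)
  have SK: "?S \<subseteq> ?K"
    using F by (auto simp: cube_face_def fixed_at_def zero_one_points_def)
  show "Fix p q F P \<subseteq> ?K"
    by (rule Fix_least_face(3)[OF F cube_face_face_of[OF sub sub] SK])
  have fin: "finite ?S" using F by (intro finite_zero_one_points) auto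
  have card: "0 < card ?S" using fin ne by (simp add: card_gt_0_iff)
  define y where "y = (\<Sum>x\<in>?S. (1 / real (card ?S)) *\<^sub>R x)"
  have yin: "y \<in> C" if "convex C" "?S \<subseteq> C" for C
    unfolding y_def by (rule convex_sum[OF fin that(1)]) (use that card in auto)
  have yK: "y \<in> ?K" using yin[OF convex_cube_face SK] .
  have ye: "Poly_Mapping.lookup y k = (\<Sum>x\<in>?S. Poly_Mapping.lookup x k) / real (card ?S)" for k
    by (simp add: y_def lookup_sum sum_divide_distrib)
  have S01: "Poly_Mapping.lookup x k = 0 \<or> Poly_Mapping.lookup x k = 1"
    if "x \<in> ?S" "k \<in> idx p q" for x k
    using that by (cases k) (auto simp: zero_one_points_def)
  have inner: "0 < Poly_Mapping.lookup y k \<and> Poly_Mapping.lookup y k < 1"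
    if k: "k \<in> idx p q - (fixed_at p q 0 F P \<union> fixed_at p q 1 F P)" for k
  proof -
    \<comment> \<open>At a free coordinate some 0/1-point is not 0 and some is not 1, so the average
      lies strictly between.\<close>
    from k obtain x x' where x: "x \<in> ?S" "Poly_Mapping.lookup x k \<noteq> 0"
      and x': "x' \<in> ?S" "Poly_Mapping.lookup x' k \<noteq> 1"
      by (cases k) (auto simp: fixed_at_def)
    have "0 < (\<Sum>x\<in>?S. Poly_Mapping.lookup x k)"
      by (rule sum_pos2[OF fin x(1)]) (use x S01[of _ k] k in force)+
    moreover have "(\<Sum>x\<in>?S. Poly_Mapping.lookup x k) < (\<Sum>x\<in>?S. 1)"
      by (rule sum_strict_mono_ex1[OF fin]) (use x' S01[of _ k] k in force)+
    ultimately show ?thesis using card by (simp add: ye)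
  qed
  show "?K \<subseteq> Fix p q F P"
  proof
    fix z assume z: "z \<in> ?K"
    let ?N = "idx p q - (fixed_at p q 0 F P \<union> fixed_at p q 1 F P)"
    let ?y = "Poly_Mapping.lookup y" and ?z = "Poly_Mapping.lookup z"
    \<comment> \<open>A margin: every free coordinate of \<open>y\<close> keeps distance
      \<open>e\<close> from 0 and 1. The inserted 1 keeps the minimum defined when all coordinates
      are fixed.\<close>
    define e where "e = Min (insert 1 ((\<lambda>k. min (?y k) (1 - ?y k)) ` ?N))"
    have e0: "0 < e" unfolding e_def by (subst Min_gr_iff) (use inner in auto)
    have e1: "e \<le> ?y k" "e \<le> 1 - ?y k" if "k \<in> ?N" for k
    proof -
      have "e \<le> min (?y k) (1 - ?y k)" unfolding e_def by (rule Min_le) (use that in auto)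
      then show "e \<le> ?y k" "e \<le> 1 - ?y k" by auto
    qed
    \<comment> \<open>\<open>w\<close> prolongs the segment from \<open>z\<close> beyond
      \<open>y\<close>. The coordinates of \<open>y - z\<close> lie between -1 and 1, so the margin
      keeps \<open>w\<close> in the cube, and a face through \<open>y\<close> must contain
      \<open>z\<close>.\<close>
    define w where "w = y + e *\<^sub>R (y - z)"
    have we: "Poly_Mapping.lookup w k = ?y k + e * (?y k - ?z k)" for k
      by (simp add: w_def lookup_add lookup_minus)
    have zc: "z \<in> cube p q" and yc: "y \<in> cube p q" using z yK by (auto simp: cube_face_def)
    have "w \<in> cube p q"
      unfolding cube_def
    proof (intro CollectI conjI)
      show "Poly_Mapping.keys w \<subseteq> idx p q"
      proof
        fix k assume "k \<in> Poly_Mapping.keys w"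
        then have "k \<in> Poly_Mapping.keys y \<or> k \<in> Poly_Mapping.keys z"
          by (auto simp: in_keys_iff we)
        then show "k \<in> idx p q" using zc yc by (auto simp: cube_def)
      qed
      show "\<forall>(i, j)\<in>idx p q. 0 \<le> entry w i j \<and> entry w i j \<le> 1"
      proof (intro ballI, clarify)
        fix i j assume ij: "(i, j) \<in> idx p q"
        let ?k = "(i, j)"
        consider "?k \<in> fixed_at p q 0 F P" | "?k \<in> fixed_at p q 1 F P" | "?k \<in> ?N" using ij by blast
        then show "0 \<le> entry w i j \<and> entry w i j \<le> 1"
        proof cases
          case 3
          have b: "0 \<le> ?z ?k" "?z ?k \<le> 1" "0 \<le> ?y ?k" "?y ?k \<le> 1"
            using zc yc ij by (auto simp: cube_def)
          then have "e * (?y ?k - ?z ?k) \<le> e * 1" "e * (- 1) \<le> e * (?y ?k - ?z ?k)"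
            using e0 by (intro mult_left_mono; simp)+
          then show ?thesis using e1[OF 3] by (simp add: we)
        qed (use z yK in \<open>auto simp: we cube_face_def\<close>)
      qed
    qed
    have "z \<in> G" if G: "G face_of cube p q" "?S \<subseteq> G" for G
    proof -
      have yG: "y \<in> G" using G by (intro yin) (auto simp: face_of_def)
      show ?thesis
      proof (cases "z = w")
        \<comment> \<open>The open segment is then empty, but \<open>z\<close> coincides with
          \<open>y\<close>.\<close>
        case True
        have "z = y"
        proof (rule poly_mapping_eqI)
          fix k
          have "(1 + e) * (?y k - ?z k) = 0" using we[of k] True by (simp add: algebra_simps)
          then show "?z k = ?y k" using e0 by simp
        qed
        then show ?thesis using yG by simp
      next
        case False
        \<comment> \<open>Solving \<open>w = y + e * (y - z)\<close> for \<open>y\<close> gives this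
          weight of \<open>w\<close>.\<close>
        define u where "u = 1 / (1 + e)"
        have u: "0 < u" "u < 1" "u * (1 + e) = 1" using e0 by (auto simp: u_def field_simps)
        have "y = (1 - u) *\<^sub>R z + u *\<^sub>R w"
        proof (rule poly_mapping_eqI)
          fix k
          have "(1 - u) * ?z k + u * Poly_Mapping.lookup w k
              = u * (1 + e) * ?y k + (1 - u * (1 + e)) * ?z k"
            by (simp add: we algebra_simps)
          then show "?y k = Poly_Mapping.lookup ((1 - u) *\<^sub>R z + u *\<^sub>R w) k"
            by (simp add: lookup_add u(3))
        qed
        then have "y \<in> open_segment z w" using False u by (auto simp: in_segment)
        then show ?thesis using G(1) yG zc \<open>w \<in> cube p q\<close> by (auto simp: face_of_def)
      qed
    qed
    then show "z \<in> Fix p q F P" by (auto simp: Fix_def)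
  qed
qed

text \<open>The empty set counts as a face, so without 0/1-points it is among the intersected sets;
  conversely any 0/1-point survives the intersection.\<close>

lemma Fix_eq_empty_iff: "Fix p q F P = {} \<longleftrightarrow> zero_one_points p q (P \<inter> F) = {}"
  by (auto simp: Fix_def)

section \<open>Matrices as restricted growth strings\<close>

text \<open>The value \<open>c i = 0\<close> encodes a zero row; \<open>c i = j > 0\<close> puts the 1-entry of row \<open>i\<close> into column \<open>j\<close>.\<close>

definition code_matrix :: "nat \<Rightarrow> (nat \<Rightarrow> nat) \<Rightarrow> point" where
  "code_matrix p c = Abs_poly_mapping (\<lambda>(i, j). of_bool (i \<in> {1..p} \<and> 1 \<le> j \<and> c i = j))"

lemma entry_code_matrix [simp]:
  "entry (code_matrix p c) i j = of_bool (i \<in> {1..p} \<and> 1 \<le> j \<and> c i = j)"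
proof -
  have "finite {k. (case k of (i, j) \<Rightarrow> of_bool (i \<in> {1..p} \<and> 1 \<le> j \<and> c i = j)) \<noteq> (0::real)}"
    by (rule finite_subset[of _ "(\<lambda>i. (i, c i)) ` {1..p}"]) auto
  then show ?thesis by (simp add: code_matrix_def lookup_Abs_poly_mapping)
qed

text \<open>The values 0 and 1 are free in every row, so one set serves both orbitopes. Rows outside
  \<open>{1..p}\<close> are unconstrained: many codes describe the same matrix.\<close>

definition growth :: "nat \<Rightarrow> nat \<Rightarrow> (nat \<Rightarrow> nat) set" where
  "growth p q = {c. \<forall>i\<in>{1..p}. c i \<le> q \<and> (c i \<le> 1 \<or> (\<exists>k\<in>{1..<i}. Suc (c k) = c i))}"

text \<open>The weights are binary: a row \<open>k\<close> with value \<open>j\<close> before the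
  first occurrence of \<open>Suc j\<close> weighs \<open>2 ^ (p - k)\<close>, more than all rows
  after \<open>k\<close> together.\<close>

lemma lex_weights_le:
  fixes p :: nat
  assumes "\<And>i. i \<in> {1..p} \<Longrightarrow> c i = Suc j \<Longrightarrow> \<exists>k\<in>{1..<i}. c k = j"
  shows "(\<Sum>i = 1..p. 2 ^ (p - i) * of_bool (c i = Suc j)) \<le> (\<Sum>i = 1..p. 2 ^ (p - i) * (of_bool (c i = j) :: real))"
proof (cases "\<exists>i. i \<in> {1..p} \<and> c i = Suc j")
  case True
  define i where "i = (LEAST i. i \<in> {1..p} \<and> c i = Suc j)"
  have i: "i \<in> {1..p}" "c i = Suc j" using LeastI_ex[OF True] by (auto simp: i_def)
  have least: "i \<le> i'" if "i' \<in> {1..p}" "c i' = Suc j" for i'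
    unfolding i_def by (rule Least_le) (use that in auto)
  obtain k where k: "k \<in> {1..<i}" "c k = j" using assms[OF i] by blast
  have "(\<Sum>i = 1..p. 2 ^ (p - i) * (of_bool (c i = Suc j) :: real))
      = (\<Sum>i = Suc k..p. 2 ^ (p - i) * of_bool (c i = Suc j))"
    by (rule sum.mono_neutral_right) (use k least in fastforce)+
  also have "\<dots> \<le> (\<Sum>i = Suc k..p. 2 ^ (p - i))" by (rule sum_mono) auto
  also have "\<dots> = (\<Sum>m < p - k. 2 ^ m)"
    by (rule sum.reindex_bij_witness[of _ "\<lambda>m. p - m" "\<lambda>i. p - i"]) auto
  also have "\<dots> \<le> 2 ^ (p - k) * of_bool (c k = j)" using k by (simp add: sum_gp_strict)
  also have "\<dots> \<le> (\<Sum>i = 1..p. 2 ^ (p - i) * of_bool (c i = j))"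
    by (rule member_le_sum) (use k i in auto)
  finally show ?thesis .
next
  case False
  then have "(\<Sum>i = 1..p. 2 ^ (p - i) * (of_bool (c i = Suc j) :: real)) = 0"
    by (intro sum.neutral) auto
  then show ?thesis by (simp add: sum_nonneg)
qed

text \<open>\<open>packing_matrices_left_neighbour\<close> extracts from the order of the columns
  the predecessor that \<open>growth\<close> demands, and \<open>lex_weights_le\<close> turns
  predecessors back into the order.\<close>

lemma packing_matrices_eq_growth: "packing_matrices p q = code_matrix p ` growth p q"
proof (intro equalityI subsetI)
  fix x assume x: "x \<in> packing_matrices p q"
  \<comment> \<open>The default 0 stands for a zero row; in the other rows the choice is unique by
    the bound on the number of 1-entries.\<close>
  define c where "c i = (if \<exists>j\<in>{1..q}. entry x i j = 1 then SOME j. j \<in> {1..q} \<and> entry x i j = 1 else 0)" for i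
  have c1: "c i \<in> {1..q} \<and> entry x i (c i) = 1" if "j \<in> {1..q}" "entry x i j = 1" for i j
  proof -
    have "\<exists>j. j \<in> {1..q} \<and> entry x i j = 1" using that by blast
    from someI_ex[OF this] that show ?thesis by (auto simp: c_def)
  qed
  have c0: "c i \<in> {1..q} \<and> entry x i (c i) = 1" if "c i \<noteq> 0" for i
  proof -
    have "\<exists>j\<in>{1..q}. entry x i j = 1" using that by (auto simp: c_def split: if_splits)
    then show ?thesis using c1 by blast
  qed
  have uniq: "c i = j" if "i \<in> {1..p}" "j \<in> {1..q}" "entry x i j = 1" for i j
  proof -
    have "card {j \<in> {1..q}. entry x i j = 1} \<le> 1" using x that by (auto simp: packing_matrices_def)
    then show ?thesis using c1[OF that(2,3)] that by (force simp: card_le_Suc0_iff_eq)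
  qed
  have "x = code_matrix p c"
  proof (rule poly_mapping_eqI)
    fix k :: "nat \<times> nat"
    obtain i j where k: "k = (i, j)" by (cases k)
    show "Poly_Mapping.lookup x k = Poly_Mapping.lookup (code_matrix p c) k"
    proof (cases "i \<in> {1..p} \<and> j \<in> {1..q}")
      case True
      then have "entry x i j \<in> {0, 1}" using x by (auto simp: packing_matrices_def zero_one_matrices_def)
      then show ?thesis using True uniq[of i j] c0[of i] by (auto simp: k)
    next
      case False
      then have "(i, j) \<notin> Poly_Mapping.keys x" using x by (auto simp: packing_matrices_def zero_one_matrices_def)
      then show ?thesis using False c0[of i] by (auto simp: k in_keys_iff)
    qed
  qed
  moreover have "c \<in> growth p q"
    unfolding growth_def
  proof (intro CollectI ballI conjI)
    fix i assume i: "i \<in> {1..p}"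
    show "c i \<le> q" using c0[of i] by (cases "c i = 0") auto
    show "c i \<le> 1 \<or> (\<exists>k\<in>{1..<i}. Suc (c k) = c i)"
    proof (cases "c i \<le> 1")
      case False
      then obtain j where j: "c i = Suc j" "1 \<le> j" by (cases "c i") auto
      then have "j \<in> {1..<q}" "entry x i (Suc j) = 1" using c0[of i] by auto
      from packing_matrices_left_neighbour[OF x i this] obtain k where k: "k \<in> {1..<i}" "entry x k j = 1" by blast
      then have "c k = j" using uniq[of k j] i \<open>j \<in> {1..<q}\<close> by auto
      then show ?thesis using k j by auto
    qed simp
  qed
  ultimately show "x \<in> code_matrix p ` growth p q" by blast
next
  fix x assume "x \<in> code_matrix p ` growth p q"
  then obtain c where c: "c \<in> growth p q" and x: "x = code_matrix p c" by blast
  have "(\<Sum>i = 1..p. 2 ^ (p - i) * entry x i (j + 1)) \<le> (\<Sum>i = 1..p. 2 ^ (p - i) * entry x i j)"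
    if "j \<in> {1..q - 1}" for j
  proof -
    have "(\<Sum>i = 1..p. 2 ^ (p - i) * entry x i (j + 1)) = (\<Sum>i = 1..p. 2 ^ (p - i) * of_bool (c i = Suc j))"
      by (rule sum.cong) (use x in auto)
    also have "\<dots> \<le> (\<Sum>i = 1..p. 2 ^ (p - i) * of_bool (c i = j))"
    proof (rule lex_weights_le)
      fix i assume i: "i \<in> {1..p}" "c i = Suc j"
      then have "c i \<le> 1 \<or> (\<exists>k\<in>{1..<i}. Suc (c k) = c i)" using c unfolding growth_def by blast
      moreover have "\<not> c i \<le> 1" using i that by simp
      ultimately show "\<exists>k\<in>{1..<i}. c k = j" using i by auto
    qed
    also have "\<dots> = (\<Sum>i = 1..p. 2 ^ (p - i) * entry x i j)"
      by (rule sum.cong) (use x that in auto)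
    finally show ?thesis .
  qed
  moreover have "card {j \<in> {1..q}. entry x i j = 1} \<le> 1" for i
    by (subst One_nat_def, subst card_le_Suc0_iff_eq) (auto simp: x)
  moreover have "Poly_Mapping.keys x \<subseteq> {1..p} \<times> {1..q}"
    using c by (auto simp: x in_keys_iff growth_def)
  moreover have "entry x i j \<in> {0, 1}" for i j
    by (simp add: x)
  ultimately show "x \<in> packing_matrices p q"
    unfolding packing_matrices_def zero_one_matrices_def lex_sorted_columns_def by blast
qed

lemma partitioning_matrices_eq_growth:
  "partitioning_matrices p q = code_matrix p ` {c \<in> growth p q. \<forall>i\<in>{1..p}. 1 \<le> c i}"
proof -
  have "card {j \<in> {1..q}. entry (code_matrix p c) i j = 1} = 1 \<longleftrightarrow> 1 \<le> c i"
    if "c \<in> growth p q" "i \<in> {1..p}" for c i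
  proof -
    have "{j \<in> {1..q}. entry (code_matrix p c) i j = 1} = (if 1 \<le> c i then {c i} else {})"
      using that by (auto simp: growth_def)
    then show ?thesis by simp
  qed
  moreover have "partitioning_matrices p q
      = {x \<in> packing_matrices p q. \<forall>i\<in>{1..p}. card {j \<in> {1..q}. entry x i j = 1} = 1}"
    by (auto simp: packing_matrices_def partitioning_matrices_def)
  ultimately show ?thesis unfolding packing_matrices_eq_growth by (auto intro!: imageI)
qed

lemma code_matrix_in_cube:
  assumes "c \<in> growth p q"
  shows "code_matrix p c \<in> cube p q"
  using packing_matrices_keys[of "code_matrix p c" p q] assms
  by (auto simp: packing_matrices_eq_growth cube_def)

section \<open>Fixing expressed by codes\<close>

definition matching :: "(nat \<times> nat) set \<Rightarrow> (nat \<times> nat) set \<Rightarrow> (nat \<Rightarrow> nat) \<Rightarrow> bool" where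
  "matching I0 I1 c \<longleftrightarrow> (\<forall>(i, j)\<in>I0. c i \<noteq> j) \<and> (\<forall>(i, j)\<in>I1. c i = j)"

text \<open>Passing to the convex hull creates no new 0/1-points, since 0/1-points are extreme in
  the cube. This removes the geometry from everything that follows.\<close>

lemma zero_one_points_hull:
  assumes C: "C \<subseteq> growth p q" and I: "I0 \<subseteq> idx p q" "I1 \<subseteq> idx p q"
  shows "zero_one_points p q (convex hull (code_matrix p ` C) \<inter> cube_face p q I0 I1)
    = code_matrix p ` {c \<in> C. matching I0 I1 c}"
proof -
  have face: "code_matrix p c \<in> cube_face p q I0 I1 \<longleftrightarrow> matching I0 I1 c" if "c \<in> C" for c
  proof -
    have "\<forall>(i, j) \<in> I0 \<union> I1. i \<in> {1..p} \<and> 1 \<le> j" using I by (auto simp: idx_def)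
    then show ?thesis
      using code_matrix_in_cube[of c p q] that C by (fastforce simp: cube_face_def matching_def)
  qed
  have vertex: "x \<in> code_matrix p ` C"
    if x: "x \<in> convex hull (code_matrix p ` C)" "\<forall>(i, j)\<in>idx p q. entry x i j \<in> {0, 1}" "x \<in> cube p q" for x
  proof (rule ccontr)
    assume not: "x \<notin> code_matrix p ` C"
    txt \<open>The affine function \<open>f\<close> counts the disagreements of a 0/1-point with \<open>x\<close>.\<close>
    define f where "f y = (\<Sum>k\<in>idx p q. if Poly_Mapping.lookup x k = 1
      then 1 - Poly_Mapping.lookup y k else Poly_Mapping.lookup y k)" for y :: point
    have conv: "convex {y. 1 \<le> f y}"
    proof (rule convexI, clarify)
      fix y z :: point and u v :: real
      assume yz: "1 \<le> f y" "1 \<le> f z" and uv: "0 \<le> u" "0 \<le> v" "u + v = 1"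
      have "f (u *\<^sub>R y + v *\<^sub>R z) = u * f y + v * f z"
      proof -
        \<comment> \<open>The complemented summands have a constant term, so \<open>f\<close> is
          only affine and the weights must sum to 1.\<close>
        have v: "v = 1 - u" using uv by simp
        have "Poly_Mapping.lookup (u *\<^sub>R y + v *\<^sub>R z) k
            = u * Poly_Mapping.lookup y k + v * Poly_Mapping.lookup z k" for k
          by (simp add: lookup_add)
        then show ?thesis unfolding f_def sum_distrib_left sum.distrib[symmetric]
          by (intro sum.cong) (auto simp: v right_diff_distrib left_diff_distrib)
      qed
      moreover have "u * 1 + v * 1 \<le> u * f y + v * f z"
        using yz uv by (intro add_mono mult_left_mono) auto
      ultimately show "1 \<le> f (u *\<^sub>R y + v *\<^sub>R z)" using uv by simp
    qed
    have "code_matrix p ` C \<subseteq> {y. 1 \<le> f y}"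
    proof clarify
      fix c assume c: "c \<in> C"
      let ?y = "code_matrix p c"
      have yc: "?y \<in> cube p q" using code_matrix_in_cube c C by blast
      have "x \<noteq> ?y" using not c by blast
      then have "Poly_Mapping.lookup x \<noteq> Poly_Mapping.lookup ?y"
        by (simp only: lookup_inject not_False_eq_True)
      then obtain k where k: "Poly_Mapping.lookup x k \<noteq> Poly_Mapping.lookup ?y k"
        unfolding fun_eq_iff by blast
      then have "k \<in> Poly_Mapping.keys x \<or> k \<in> Poly_Mapping.keys ?y"
        unfolding in_keys_iff by metis
      then have kk: "k \<in> idx p q" using x(3) yc unfolding cube_def by blast
      let ?g = "\<lambda>k. if Poly_Mapping.lookup x k = 1
        then 1 - Poly_Mapping.lookup ?y k else Poly_Mapping.lookup ?y k"
      \<comment> \<open>A coordinate of disagreement contributes 1, and no summand is negative at a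
        0/1-point.\<close>
      have "1 \<le> ?g k" using k kk x(2) by (cases k) auto
      also have "\<dots> \<le> f ?y" unfolding f_def
        by (rule member_le_sum[OF kk]) (auto simp: split_paired_all)
      finally show "1 \<le> f ?y" .
    qed
    then have "1 \<le> f x" using hull_minimal[of _ "{y. 1 \<le> f y}" convex] conv x(1) by blast
    moreover have "f x = 0" unfolding f_def by (rule sum.neutral) (use x(2) in auto)
    ultimately show False by simp
  qed
  show ?thesis
  proof (intro equalityI subsetI)
    fix x assume x: "x \<in> zero_one_points p q (convex hull (code_matrix p ` C) \<inter> cube_face p q I0 I1)"
    then have "x \<in> code_matrix p ` C" using cube_face_subset[of p q I0 I1]
      by (intro vertex) (auto simp: zero_one_points_def)
    then show "x \<in> code_matrix p ` {c \<in> C. matching I0 I1 c}"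
      using x face by (auto simp: zero_one_points_def)
  next
    fix x assume "x \<in> code_matrix p ` {c \<in> C. matching I0 I1 c}"
    then obtain c where c: "c \<in> C" "matching I0 I1 c" "x = code_matrix p c" by blast
    then have "x \<in> convex hull (code_matrix p ` C)" by (auto intro: hull_inc)
    then show "x \<in> zero_one_points p q (convex hull (code_matrix p ` C) \<inter> cube_face p q I0 I1)"
      using c face by (auto simp: zero_one_points_def)
  qed
qed

text \<open>The comprehensions may range over all pairs because \<open>stores_pair\<close> inspects
  only the cells of \<open>idx p q\<close>.\<close>

definition stores_result :: "nat \<Rightarrow> nat \<Rightarrow> (nat \<Rightarrow> nat) set \<Rightarrow> store \<Rightarrow> bool" where
  "stores_result p q C s \<longleftrightarrow>
     (if C = {} then reg s ''empty'' = 1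
      else reg s ''empty'' = 0 \<and>
        stores_pair p q {(i, j). \<forall>c\<in>C. c i \<noteq> j} {(i, j). \<forall>c\<in>C. c i = j} s)"

text \<open>By \<open>Fix_eq_cube_face\<close> the demanded equality of cube faces is automatic, so
  correctness of a program becomes a statement on the stored cells. Columns start at 1, hence a zero
  entry at \<open>(i, j)\<close> means \<open>c i \<noteq> j\<close>, for zero rows as well.\<close>

lemma stores_fixing_iff:
  assumes C: "C \<subseteq> growth p q" and I: "I0 \<subseteq> idx p q" "I1 \<subseteq> idx p q"
  shows "stores_fixing p q (cube_face p q I0 I1) (convex hull (code_matrix p ` C)) s
    \<longleftrightarrow> stores_result p q {c \<in> C. matching I0 I1 c} s"
proof -
  let ?F = "cube_face p q I0 I1" and ?P = "convex hull (code_matrix p ` C)"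
  let ?C = "{c \<in> C. matching I0 I1 c}"
  note S = zero_one_points_hull[OF assms]
  have "fixed_at p q 0 ?F ?P = {(i, j) \<in> idx p q. \<forall>c\<in>?C. c i \<noteq> j}"
    "fixed_at p q 1 ?F ?P = {(i, j) \<in> idx p q. \<forall>c\<in>?C. c i = j}"
    unfolding fixed_at_def S by (auto simp: idx_def)
  then have pair: "stores_pair p q (fixed_at p q 0 ?F ?P) (fixed_at p q 1 ?F ?P) s
      \<longleftrightarrow> stores_pair p q {(i, j). \<forall>c\<in>?C. c i \<noteq> j} {(i, j). \<forall>c\<in>?C. c i = j} s"
    by (auto simp: stores_pair_def)
  have empty: "Fix p q ?F ?P = {} \<longleftrightarrow> ?C = {}"
    unfolding Fix_eq_empty_iff S by simp
  show ?thesis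
  proof (cases "?C = {}")
    case True
    show ?thesis
      unfolding stores_fixing_def stores_result_def if_P[OF True] if_P[OF empty[THEN iffD2, OF True]]
      by (rule refl)
  next
    case False
    then have ne: "Fix p q ?F ?P \<noteq> {}" using empty by blast
    have "Fix p q ?F ?P = cube_face p q (fixed_at p q 0 ?F ?P) (fixed_at p q 1 ?F ?P)"
      by (rule Fix_eq_cube_face[OF cube_face_subset]) (use False in \<open>simp add: S\<close>)
    then have eq: "(cube_face p q (fixed_at p q 0 ?F ?P) (fixed_at p q 1 ?F ?P) = Fix p q ?F ?P) = True"
      by (intro eqTrueI) (rule sym)
    show ?thesis
      unfolding stores_fixing_def stores_result_def if_not_P[OF False] if_not_P[OF ne] pair eq
      by (simp only: simp_thms)
  qed
qed

definition packing_codes :: "nat \<Rightarrow> nat \<Rightarrow> (nat \<times> nat) set \<Rightarrow> (nat \<times> nat) set \<Rightarrow> (nat \<Rightarrow> nat) set" where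
  "packing_codes p q I0 I1 = {c \<in> growth p q. matching I0 I1 c}"

definition partitioning_codes :: "nat \<Rightarrow> nat \<Rightarrow> (nat \<times> nat) set \<Rightarrow> (nat \<times> nat) set \<Rightarrow> (nat \<Rightarrow> nat) set" where
  "partitioning_codes p q I0 I1 = {c \<in> packing_codes p q I0 I1. \<forall>i\<in>{1..p}. 1 \<le> c i}"

lemma stores_fixing_packing:
  assumes "I0 \<subseteq> idx p q" "I1 \<subseteq> idx p q"
  shows "stores_fixing p q (cube_face p q I0 I1) (packing_orbitope p q) s
    \<longleftrightarrow> stores_result p q (packing_codes p q I0 I1) s"
  unfolding packing_orbitope_def packing_matrices_eq_growth packing_codes_def
  by (rule stores_fixing_iff[OF subset_refl assms])

lemma stores_fixing_partitioning:
  assumes "I0 \<subseteq> idx p q" "I1 \<subseteq> idx p q"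
  shows "stores_fixing p q (cube_face p q I0 I1) (partitioning_orbitope p q) s
    \<longleftrightarrow> stores_result p q (partitioning_codes p q I0 I1) s"
proof -
  let ?C = "{c \<in> growth p q. \<forall>i\<in>{1..p}. 1 \<le> c i}"
  have eq: "partitioning_codes p q I0 I1 = {c \<in> ?C. matching I0 I1 c}"
    by (auto simp: partitioning_codes_def packing_codes_def)
  have "?C \<subseteq> growth p q" by blast
  then show ?thesis
    unfolding partitioning_orbitope_def partitioning_matrices_eq_growth eq
    by (rule stores_fixing_iff[OF _ assms])
qed

section \<open>Feasible codes by dynamic programming\<close>

primrec prefix_max :: "(nat \<Rightarrow> nat) \<Rightarrow> nat \<Rightarrow> nat" where
  "prefix_max c 0 = 0"
| "prefix_max c (Suc i) = max (prefix_max c i) (c (Suc i))"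

lemma prefix_max_ge: "k \<in> {1..i} \<Longrightarrow> c k \<le> prefix_max c i"
  by (induction i) (auto simp: le_Suc_eq max_def)

lemma prefix_max_cong: "(\<And>k. k \<in> {1..i} \<Longrightarrow> c k = c' k) \<Longrightarrow> prefix_max c i = prefix_max c' i"
  by (induction i) auto

text \<open>The condition of \<open>growth\<close> with the occurrence of a predecessor replaced by
  a bound against the prefix maximum, a single number that dynamic programming can carry
  along.\<close>

definition bounded_growth :: "(nat \<Rightarrow> nat set) \<Rightarrow> nat \<Rightarrow> (nat \<Rightarrow> nat) \<Rightarrow> bool" where
  "bounded_growth D n c \<longleftrightarrow> (\<forall>i<n. c (Suc i) \<in> D (Suc i) \<and> c (Suc i) \<le> Suc (prefix_max c i))"

lemma bounded_growth_0 [simp]: "bounded_growth D 0 c"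
  by (simp add: bounded_growth_def)

lemma bounded_growth_Suc:
  "bounded_growth D (Suc n) c \<longleftrightarrow>
     bounded_growth D n c \<and> c (Suc n) \<in> D (Suc n) \<and> c (Suc n) \<le> Suc (prefix_max c n)"
  by (auto simp: bounded_growth_def less_Suc_eq)

lemma bounded_growth_mono: "bounded_growth D n c \<Longrightarrow> m \<le> n \<Longrightarrow> bounded_growth D m c"
  by (auto simp: bounded_growth_def)

lemma bounded_growth_cong:
  assumes "\<And>k. k \<in> {1..n} \<Longrightarrow> c k = c' k"
  shows "bounded_growth D n c \<longleftrightarrow> bounded_growth D n c'"
proof -
  have "prefix_max c i = prefix_max c' i" if "i < n" for i
    by (rule prefix_max_cong) (use assms that in auto)
  then show ?thesis using assms by (auto simp: bounded_growth_def)
qed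

lemma prefix_max_upd: "prefix_max (c(Suc i := j)) i = prefix_max c i"
  by (rule prefix_max_cong) auto

lemma bounded_growth_upd: "bounded_growth D n (c(Suc n := j)) \<longleftrightarrow> bounded_growth D n c"
  by (rule bounded_growth_cong) auto

text \<open>The prefix maximum rises by at most one per row, so it skips no value. This recovers the
  predecessor demanded by \<open>growth\<close> from the bound.\<close>

lemma growth_values_below_prefix_max:
  assumes "\<And>i. i < n \<Longrightarrow> c (Suc i) \<le> Suc (prefix_max c i)" "v \<in> {1..prefix_max c n}"
  shows "\<exists>k\<in>{1..n}. c k = v"
  using assms
proof (induction n)
  case (Suc n)
  show ?case
  proof (cases "v \<le> prefix_max c n")
    case True
    then have "\<exists>k\<in>{1..n}. c k = v" using Suc.IH Suc.prems by auto
    then show ?thesis by auto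
  next
    case False
    then have "c (Suc n) = v" using Suc.prems(1)[of n] Suc.prems(2) by (auto simp: max_def split: if_splits)
    then show ?thesis by (intro bexI[of _ "Suc n"]) auto
  qed
qed simp

section \<open>Instances as families of admissible row values\<close>

definition domain :: "nat \<Rightarrow> (nat \<times> nat) set \<Rightarrow> nat \<Rightarrow> nat set" where
  "domain q I0 i = {j \<in> {1..min i q}. (i, j) \<notin> I0}"

lemma domain_nonempty:
  assumes "partitioning_instance p q I0 I1" "i \<in> {1..p}"
  shows "domain q I0 i \<noteq> {}"
proof
  assume "domain q I0 i = {}"
  then have "I0 \<inter> row_idx q i = (\<lambda>j. (i, j)) ` {1..min i q}"
    by (auto simp: domain_def row_idx_def)
  then have "card (I0 \<inter> row_idx q i) = min i q" by (simp add: card_image inj_on_def)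
  moreover have "card (I0 \<inter> row_idx q i) \<le> min i q - 1" "2 \<le> q"
    using assms by (auto simp: partitioning_instance_def)
  moreover have "1 \<le> i" using assms by simp
  ultimately show False by (auto simp: min_def split: if_splits)
qed

text \<open>Passing from a value to its predecessor also passes to a strictly earlier row.\<close>

lemma growth_le_index:
  assumes "c \<in> growth p q" "i \<in> {1..p}"
  shows "c i \<le> i"
  using assms(2)
proof (induction i rule: less_induct)
  case (less i)
  then have "c i \<le> 1 \<or> (\<exists>k\<in>{1..<i}. Suc (c k) = c i)" using assms by (auto simp: growth_def)
  then show ?case
  proof
    assume "\<exists>k\<in>{1..<i}. Suc (c k) = c i"
    then obtain k where k: "k \<in> {1..<i}" "Suc (c k) = c i" by blast
    then have "c k \<le> k" using less by auto
    then show ?thesis using k by auto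
  qed (use less.prems in auto)
qed

text \<open>The hypotheses on \<open>I1\<close> and on the rows make \<open>I1\<close> redundant.\<close>

lemma partitioning_codes_eq:
  assumes inst: "partitioning_instance p q I0 I1"
  shows "partitioning_codes p q I0 I1 = {c. bounded_growth (domain q I0) p c}"
proof (intro equalityI subsetI CollectI)
  fix c assume c: "c \<in> partitioning_codes p q I0 I1"
  then have g: "c \<in> growth p q" and pos: "\<And>i. i \<in> {1..p} \<Longrightarrow> 1 \<le> c i" and I0: "\<And>i j. (i, j) \<in> I0 \<Longrightarrow> c i \<noteq> j"
    by (auto simp: partitioning_codes_def packing_codes_def matching_def)
  show "bounded_growth (domain q I0) p c"
    unfolding bounded_growth_def
  proof (intro allI impI conjI)
    fix i assume i: "i < p"
    then have S: "Suc i \<in> {1..p}" by simp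
    show "c (Suc i) \<in> domain q I0 (Suc i)"
      using growth_le_index[OF g S] pos[OF S] I0 g S by (auto simp: domain_def growth_def)
    have "c (Suc i) \<le> 1 \<or> (\<exists>k\<in>{1..<Suc i}. Suc (c k) = c (Suc i))" using g S by (auto simp: growth_def)
    then show "c (Suc i) \<le> Suc (prefix_max c i)"
    proof
      assume "\<exists>k\<in>{1..<Suc i}. Suc (c k) = c (Suc i)"
      then obtain k where k: "k \<in> {1..<Suc i}" "Suc (c k) = c (Suc i)" by blast
      then show ?thesis using prefix_max_ge[of k i c] by auto
    qed simp
  qed
next
  fix c assume "c \<in> {c. bounded_growth (domain q I0) p c}"
  then have c: "bounded_growth (domain q I0) p c" by simp
  have dom: "c i \<in> domain q I0 i \<and> c i \<le> Suc (prefix_max c (i - 1))" if "i \<in> {1..p}" for i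
    using c[unfolded bounded_growth_def, rule_format, of "i - 1"] that by auto
  have "c i \<le> 1 \<or> (\<exists>k\<in>{1..<i}. Suc (c k) = c i)" if i: "i \<in> {1..p}" for i
  proof (cases "c i \<le> 1")
    case False
    then have "c i - 1 \<in> {1..prefix_max c (i - 1)}" using dom[OF i] by auto
    moreover have "c (Suc k) \<le> Suc (prefix_max c k)" if "k < i - 1" for k
      using c that i by (auto simp: bounded_growth_def)
    ultimately obtain k where "k \<in> {1..i - 1}" "c k = c i - 1"
      using growth_values_below_prefix_max[of "i - 1" c] by blast
    then show ?thesis using False by (intro disjI2 bexI[of _ k]) auto
  qed simp
  then have "c \<in> growth p q" using dom by (auto simp: growth_def domain_def)
  moreover have "c i \<noteq> j" if "(i, j) \<in> I0" for i j
  proof -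
    have "i \<in> {1..p}" using that inst by (auto simp: partitioning_instance_def idx_def)
    then show ?thesis using dom that by (auto simp: domain_def)
  qed
  moreover have "c i = j" if ij: "(i, j) \<in> I1" for i j
  proof (rule ccontr)
    assume "c i \<noteq> j"
    have i: "i \<in> {1..p}" using ij inst by (auto simp: partitioning_instance_def idx_def)
    then have "c i \<in> {1..min i q} - {j}" "(i, c i) \<notin> I0" using dom \<open>c i \<noteq> j\<close> by (auto simp: domain_def)
    then show False using ij inst by (auto simp: partitioning_instance_def)
  qed
  ultimately show "c \<in> partitioning_codes p q I0 I1"
    using dom by (auto simp: partitioning_codes_def packing_codes_def matching_def domain_def)
qed

text \<open>
  \<open>lower D q p i\<close> is the least prefix maximum after row \<open>i\<close> from which the rows \<open>i + 1, \<dots>, p\<close> can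
  be completed: completing with value \<open>j\<close> in the next row needs a prefix maximum of at least
  \<open>step_bound b j\<close>, where \<open>b\<close> is the bound after that row. Feasibility is monotone in the prefix
  maximum, so a single number per row suffices.
\<close>

definition step_bound :: "nat \<Rightarrow> nat \<Rightarrow> nat" where
  "step_bound b j = (if j < b then b else j - 1)"

text \<open>The recursion counts the rows still to be filled, so \<open>D (p - n)\<close> is the row
  that follows the prefix of length \<open>p - Suc n\<close>. The inserted \<open>q\<close> keeps
  the minimum defined and is the start value of the running minimum in the program.\<close>

primrec lower_from_end :: "(nat \<Rightarrow> nat set) \<Rightarrow> nat \<Rightarrow> nat \<Rightarrow> nat \<Rightarrow> nat" where
  "lower_from_end D q p 0 = 0"
| "lower_from_end D q p (Suc n) = Min (insert q (step_bound (lower_from_end D q p n) ` D (p - n)))"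

definition lower :: "(nat \<Rightarrow> nat set) \<Rightarrow> nat \<Rightarrow> nat \<Rightarrow> nat \<Rightarrow> nat" where
  "lower D q p i = lower_from_end D q p (p - i)"

lemma lower_end [simp]: "lower D q p p = 0"
  by (simp add: lower_def)

lemma lower_step:
  assumes "i < p"
  shows "lower D q p i = Min (insert q (step_bound (lower D q p (Suc i)) ` D (Suc i)))"
proof -
  have "p - i = Suc (p - Suc i)" "p - (p - Suc i) = Suc i" using assms by auto
  then show ?thesis by (simp add: lower_def)
qed

section \<open>Largest reachable prefix maxima\<close>

primrec upper :: "(nat \<Rightarrow> nat set) \<Rightarrow> nat \<Rightarrow> nat" where
  "upper D 0 = 0"
| "upper D (Suc i) = (if Suc (upper D i) \<in> D (Suc i) then Suc (upper D i) else upper D i)"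

lemma prefix_max_le_upper: "bounded_growth D n c \<Longrightarrow> prefix_max c n \<le> upper D n"
proof (induction n)
  case (Suc n)
  then have IH: "prefix_max c n \<le> upper D n" and c: "c (Suc n) \<in> D (Suc n)" "c (Suc n) \<le> Suc (prefix_max c n)"
    by (auto simp: bounded_growth_Suc)
  then show ?case by (cases "c (Suc n) = Suc (upper D n)") auto
qed simp

section \<open>Attainable and forced values\<close>

locale row_domains =
  fixes D :: "nat \<Rightarrow> nat set" and p q :: nat
  assumes nonempty: "i \<in> {1..p} \<Longrightarrow> D i \<noteq> {}" and bounds: "D i \<subseteq> {1..q}"
begin

lemma finite_domain [simp]: "finite (D i)"
  using bounds finite_subset by blast

lemma lower_le: "i \<le> p \<Longrightarrow> lower D q p i \<le> q"
  by (cases "i = p") (auto simp: lower_step intro!: Min_le)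

text \<open>If the minimum is the inserted \<open>q\<close>, any value of the nonempty row serves,
  because its step bound is at most \<open>q\<close>.\<close>

lemma lower_attained:
  assumes "i < p"
  obtains j where "j \<in> D (Suc i)" "step_bound (lower D q p (Suc i)) j \<le> lower D q p i"
proof -
  let ?A = "step_bound (lower D q p (Suc i)) ` D (Suc i)"
  have "lower D q p i \<in> insert q ?A" using assms by (simp only: lower_step, intro Min_in) auto
  then consider "lower D q p i = q" | "lower D q p i \<in> ?A" by blast
  then show ?thesis
  proof cases
    case 1
    obtain j where j: "j \<in> D (Suc i)" using nonempty[of "Suc i"] assms by auto
    then have "j \<le> q" using bounds[of "Suc i"] by auto
    then have "step_bound (lower D q p (Suc i)) j \<le> q"
      using lower_le[of "Suc i"] assms by (auto simp: step_bound_def)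
    then show ?thesis using j 1 that by simp
  next
    case 2
    then show ?thesis using that by auto
  qed
qed

text \<open>Sufficiency of the bound, by induction backwards from row \<open>p\<close>: choosing a
  value with minimal step bound establishes the hypothesis for the next prefix.\<close>

lemma extend_to_end:
  assumes "i \<le> p" "bounded_growth D i c" "lower D q p i \<le> prefix_max c i"
  shows "\<exists>c'. bounded_growth D p c' \<and> (\<forall>k\<le>i. c' k = c k)"
  using assms
proof (induction i arbitrary: c rule: inc_induct)
  case (step i)
  obtain j where j: "j \<in> D (Suc i)" "step_bound (lower D q p (Suc i)) j \<le> lower D q p i"
    using lower_attained step.hyps by blast
  \<comment> \<open>Let \<open>b\<close> be the bound after row \<open>Suc i\<close>. A value
    \<open>j < b\<close> cannot lift the maximum to \<open>b\<close>, so the prefix must already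
    reach it; for \<open>j \<ge> b\<close> only the growth bound on \<open>j\<close>
    remains.\<close>
  have sb: "j \<le> Suc (prefix_max c i)" "lower D q p (Suc i) \<le> max (prefix_max c i) j"
    using j(2) step.prems by (auto simp: step_bound_def split: if_splits)
  let ?c = "c(Suc i := j)"
  have "bounded_growth D (Suc i) ?c"
    using step.prems j sb by (simp add: bounded_growth_Suc bounded_growth_upd prefix_max_upd)
  moreover have "lower D q p (Suc i) \<le> prefix_max ?c (Suc i)"
    using sb by (simp add: prefix_max_upd)
  ultimately obtain c' where "bounded_growth D p c'" "\<forall>k\<le>Suc i. c' k = ?c k"
    using step.IH by blast
  then show ?case by (intro exI[of _ c']) auto
qed auto

lemma lower_le_prefix_max:
  assumes "i \<le> p" "bounded_growth D p c"
  shows "lower D q p i \<le> prefix_max c i"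
  using assms
proof (induction i rule: inc_induct)
  case (step i)
  then have IH: "lower D q p (Suc i) \<le> max (prefix_max c i) (c (Suc i))"
    and c: "c (Suc i) \<in> D (Suc i)" "c (Suc i) \<le> Suc (prefix_max c i)"
    by (auto simp: bounded_growth_def)
  have "lower D q p i \<le> step_bound (lower D q p (Suc i)) (c (Suc i))"
    using c step.hyps by (simp only: lower_step, intro Min_le) auto
  also have "\<dots> \<le> prefix_max c i" using IH c by (auto simp: step_bound_def max_def split: if_splits)
  finally show ?case .
qed simp

text \<open>The empty prefix has maximum 0.\<close>

lemma feasible_iff: "(\<exists>c. bounded_growth D p c) \<longleftrightarrow> lower D q p 0 = 0"
  using lower_le_prefix_max[of 0] extend_to_end[of 0] by auto

text \<open>When the maximum cannot be raised, the row still needs some admissible value. The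
  feasible \<open>c0\<close> supplies it: its own prefix maximum is at most
  \<open>upper D i\<close>, so its next value respects the growth bound here too.\<close>

lemma upper_attained:
  assumes "bounded_growth D p c0" "i \<le> p"
  shows "\<exists>c. bounded_growth D i c \<and> prefix_max c i = upper D i"
  using assms(2)
proof (induction i)
  case (Suc i)
  then obtain c where c: "bounded_growth D i c" "prefix_max c i = upper D i" by auto
  have c0: "c0 (Suc i) \<in> D (Suc i)" "c0 (Suc i) \<le> Suc (prefix_max c0 i)"
    using assms(1) Suc.prems by (auto simp: bounded_growth_def)
  have "prefix_max c0 i \<le> upper D i"
    using bounded_growth_mono[OF assms(1)] Suc.prems by (intro prefix_max_le_upper) auto
  then have c0u: "c0 (Suc i) \<le> Suc (upper D i)" using c0 by simp
  define j where "j = (if Suc (upper D i) \<in> D (Suc i) then Suc (upper D i) else c0 (Suc i))"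
  have "j \<in> D (Suc i)" "j \<le> Suc (upper D i)" "max (upper D i) j = upper D (Suc i)"
    using c0 c0u by (auto simp: j_def max_def le_Suc_eq)
  moreover from this have "bounded_growth D (Suc i) (c(Suc i := j))"
    using c by (simp add: bounded_growth_Suc bounded_growth_upd prefix_max_upd)
  ultimately show ?case
    using c(2) by (intro exI[of _ "c(Suc i := j)"]) (simp only: prefix_max.simps prefix_max_upd fun_upd_same)
qed simp

definition supported :: "nat \<Rightarrow> nat \<Rightarrow> bool" where
  "supported i j \<longleftrightarrow> j \<in> D i \<and> j \<le> Suc (upper D (i - 1)) \<and> lower D q p i \<le> max (upper D (i - 1)) j"

text \<open>Exchange argument: replacing the rows before \<open>i\<close> by a prefix that attains
  \<open>upper D (i - 1)\<close> can only loosen the growth bound in row \<open>i\<close> and raise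
  the maximum from which the remaining rows are completed.\<close>

lemma supported_iff:
  assumes feas: "bounded_growth D p c0" and i: "i \<in> {1..p}"
  shows "(\<exists>c. bounded_growth D p c \<and> c i = j) \<longleftrightarrow> supported i j"
proof -
  obtain i' where i': "i = Suc i'" "i' < p" using i by (cases i) auto
  show ?thesis
  proof
    assume "\<exists>c. bounded_growth D p c \<and> c i = j"
    then obtain c where c: "bounded_growth D p c" "c (Suc i') = j" using i' by blast
    then have "j \<in> D i" "j \<le> Suc (prefix_max c i')" using i' by (auto simp: bounded_growth_def)
    moreover have "prefix_max c i' \<le> upper D i'"
      using bounded_growth_mono[OF c(1)] i' by (intro prefix_max_le_upper) auto
    moreover have "lower D q p i \<le> max (prefix_max c i') j"
      using lower_le_prefix_max[OF _ c(1), of i] i' c(2) by auto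
    ultimately show "supported i j" by (auto simp: supported_def i')
  next
    assume s: "supported i j"
    obtain c where c: "bounded_growth D i' c" "prefix_max c i' = upper D i'"
      using upper_attained[OF feas, of i'] i' by auto
    let ?c = "c(Suc i' := j)"
    have "bounded_growth D i ?c" "lower D q p i \<le> prefix_max ?c i"
      using s c by (auto simp: supported_def i' bounded_growth_Suc bounded_growth_upd prefix_max_upd)
    then obtain c' where "bounded_growth D p c'" "\<forall>k\<le>i. c' k = ?c k"
      using extend_to_end[of i ?c] i' by auto
    then show "\<exists>c. bounded_growth D p c \<and> c i = j" using i' by auto
  qed
qed

text \<open>Phrased by a cardinality so that one counter per row decides which entries are fixed to
  1.\<close>

lemma forced_iff:
  assumes feas: "bounded_growth D p c0" and i: "i \<in> {1..p}"
  shows "(\<forall>c. bounded_growth D p c \<longrightarrow> c i = j) \<longleftrightarrow> supported i j \<and> card {j. supported i j} = 1"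
proof -
  have "(\<forall>c. bounded_growth D p c \<longrightarrow> c i = j) \<longleftrightarrow> {j. supported i j} = {j}"
    using feas by (auto simp: supported_iff[OF assms, symmetric])
  also have "\<dots> \<longleftrightarrow> supported i j \<and> card {j. supported i j} = 1"
    by (auto simp: card_1_singleton_iff set_eq_iff)
  finally show ?thesis .
qed

end

section \<open>Reasoning about programs\<close>

abbreviation seq (infixr ";;" 60) where "c1 ;; c2 \<equiv> Seq c1 c2"

section \<open>Loop-free programs\<close>

lemma reg_set_reg [simp]: "reg (set_reg x n s) = (reg s)(x := n)"
  and arr_set_reg [simp]: "arr (set_reg x n s) = arr s"
  and reg_set_arr [simp]: "reg (set_arr a i j n s) = reg s"
  and arr_set_arr [simp]: "arr (set_arr a i j n s) = (arr s)(a := (arr s a)(i := (arr s a i)(j := n)))"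
  by (simp_all add: set_reg_def set_arr_def)

text \<open>Weakest preconditions for loop-free code. A loop gets \<open>False\<close>, which makes
  its value under \<open>cost\<close> harmless; loops are treated by
  \<open>halts_While\<close>.\<close>

fun wp :: "com \<Rightarrow> (store \<Rightarrow> bool) \<Rightarrow> store \<Rightarrow> bool" where
  "wp Skip Q s \<longleftrightarrow> Q s"
| "wp (Const x k) Q s \<longleftrightarrow> Q (set_reg x k s)"
| "wp (Copy x y) Q s \<longleftrightarrow> Q (set_reg x (reg s y) s)"
| "wp (Incr x) Q s \<longleftrightarrow> Q (set_reg x (reg s x + 1) s)"
| "wp (Decr x) Q s \<longleftrightarrow> Q (set_reg x (reg s x - 1) s)"
| "wp (Read x a i j) Q s \<longleftrightarrow> Q (set_reg x (arr s a (reg s i) (reg s j)) s)"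
| "wp (Write a i j x) Q s \<longleftrightarrow> Q (set_arr a (reg s i) (reg s j) (reg s x) s)"
| "wp (Seq c1 c2) Q s \<longleftrightarrow> wp c1 (wp c2 Q) s"
| "wp (Cond b c1 c2) Q s \<longleftrightarrow> (holds b s \<longrightarrow> wp c1 Q s) \<and> (\<not> holds b s \<longrightarrow> wp c2 Q s)"
| "wp (While b c) Q s \<longleftrightarrow> False"

fun cost :: "com \<Rightarrow> nat" where
  "cost (Seq c1 c2) = cost c1 + cost c2"
| "cost (Cond b c1 c2) = 1 + max (cost c1) (cost c2)"
| "cost _ = 1"

lemma wp_exec: "wp c Q s \<Longrightarrow> \<exists>n t. exec c s n t \<and> n \<le> cost c \<and> Q t"
proof (induction c arbitrary: Q s)
  case (Seq c1 c2)
  then obtain n u where 1: "exec c1 s n u" "n \<le> cost c1" "wp c2 Q u" by fastforce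
  then obtain m t where "exec c2 u m t" "m \<le> cost c2" "Q t" using Seq.IH(2) by blast
  with 1 show ?case by (intro exI[of _ "n + m"] exI[of _ t]) (auto intro: exec.Seq)
next
  case (Cond b c1 c2)
  show ?case
  proof (cases "holds b s")
    case True
    then obtain n t where "exec c1 s n t" "n \<le> cost c1" "Q t" using Cond.IH(1) Cond.prems by fastforce
    then show ?thesis
      using True by (intro exI[of _ "1 + n"] exI[of _ t]) (auto intro: exec.Cond_True[simplified])
  next
    case False
    then obtain n t where "exec c2 s n t" "n \<le> cost c2" "Q t" using Cond.IH(2) Cond.prems by fastforce
    then show ?thesis
      using False by (intro exI[of _ "1 + n"] exI[of _ t]) (auto intro: exec.Cond_False[simplified])
  qed
qed (fastforce intro: exec.intros exec.Incr[simplified] exec.Decr[simplified])+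

section \<open>Composition rules with time bounds\<close>

lemma halts_withinI: "exec c s n t \<Longrightarrow> n \<le> N \<Longrightarrow> Q t \<Longrightarrow> halts_within c s N Q"
  by (auto simp: halts_within_def)

lemma halts_wp: "wp c Q s \<Longrightarrow> cost c \<le> N \<Longrightarrow> halts_within c s N Q"
  unfolding halts_within_def using wp_exec by (meson order_trans)

lemma halts_mono:
  "halts_within c s M R \<Longrightarrow> M \<le> N \<Longrightarrow> (\<And>t. R t \<Longrightarrow> Q t) \<Longrightarrow> halts_within c s N Q"
  unfolding halts_within_def by (meson order_trans)

lemma halts_Seq:
  assumes "halts_within c1 s m R" "\<And>u. R u \<Longrightarrow> halts_within c2 u n Q" "m + n \<le> N"
  shows "halts_within (c1 ;; c2) s N Q"
proof -
  from assms(1) obtain k u where 1: "exec c1 s k u" "k \<le> m" "R u" by (auto simp: halts_within_def)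
  from assms(2)[OF 1(3)] obtain l t where 2: "exec c2 u l t" "l \<le> n" "Q t" by (auto simp: halts_within_def)
  have "exec (c1 ;; c2) s (k + l) t" using 1 2 by (intro exec.Seq)
  then show ?thesis by (rule halts_withinI) (use 1 2 assms(3) in auto)
qed

lemma halts_Cond:
  assumes "holds b s \<Longrightarrow> halts_within c1 s n Q" "\<not> holds b s \<Longrightarrow> halts_within c2 s n Q" "1 + n \<le> N"
  shows "halts_within (Cond b c1 c2) s N Q"
proof (cases "holds b s")
  case True
  with assms(1) obtain k t where e: "exec c1 s k t" "k \<le> n" "Q t" by (auto simp: halts_within_def)
  show ?thesis by (rule halts_withinI[OF exec.Cond_True[OF True e(1)]]) (use e assms(3) in auto)
next
  case False
  with assms(2) obtain k t where e: "exec c2 s k t" "k \<le> n" "Q t" by (auto simp: halts_within_def)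
  show ?thesis by (rule halts_withinI[OF exec.Cond_False[OF False e(1)]]) (use e assms(3) in auto)
qed

text \<open>\<open>P\<close> is indexed by the number of iterations left, so invariant and
  termination measure are one. Each iteration costs a test and the body, and one failing test closes
  the loop.\<close>

lemma halts_While:
  assumes step: "\<And>k u. k < n \<Longrightarrow> P (Suc k) u \<Longrightarrow> holds b u \<and> halts_within c u m (P k)"
    and stop: "\<And>u. P 0 u \<Longrightarrow> \<not> holds b u"
    and init: "P n s"
  shows "halts_within (While b c) s (1 + n * (m + 1)) (P 0)"
proof -
  have "k \<le> n \<Longrightarrow> P k u \<Longrightarrow> halts_within (While b c) u (1 + k * (m + 1)) (P 0)" for k u
  proof (induction k arbitrary: u)
    case 0
    show ?case by (rule halts_withinI[OF exec.While_False]) (use 0 stop in auto)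
  next
    case (Suc k)
    then have b: "holds b u" and "halts_within c u m (P k)" using step[of k u] by auto
    then obtain a v where 1: "exec c u a v" "a \<le> m" "P k v" by (auto simp: halts_within_def)
    then obtain d t where 2: "exec (While b c) v d t" "d \<le> 1 + k * (m + 1)" "P 0 t"
      using Suc.IH[of v] Suc.prems by (auto simp: halts_within_def)
    show ?case
      by (rule halts_withinI[OF exec.While_True[OF b 1(1) 2(1)]]) (use 1 2 in auto)
  qed
  then show ?thesis using init by blast
qed

section \<open>Counting loops\<close>

definition for_up :: "name \<Rightarrow> name \<Rightarrow> com \<Rightarrow> com" where
  "for_up x bnd body = Const x 0 ;; While (Less x bnd) (Incr x ;; body)"

text \<open>Tests compare registers only, so \<open>zero\<close> names a register that holds 0. The
  start value of \<open>x\<close> is left to the preceding code.\<close>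

definition for_down :: "name \<Rightarrow> name \<Rightarrow> com \<Rightarrow> com" where
  "for_down x zero body = While (Less zero x) (body ;; Decr x)"

text \<open>The increment precedes the body, which therefore sees the values from 1 to
  \<open>n\<close>, and \<open>P k\<close> describes the state after \<open>k\<close> iterations.
  Each of them costs a test, an increment and the body.\<close>

lemma halts_for_up:
  assumes init: "P 0 (set_reg x 0 s)"
    and regs: "\<And>k u. P k u \<Longrightarrow> reg u x = k \<and> reg u bnd = n"
    and step: "\<And>k u. k < n \<Longrightarrow> P k u \<Longrightarrow> halts_within body (set_reg x (Suc k) u) m (P (Suc k))"
    and N: "2 + n * (m + 2) \<le> N" and Q: "\<And>u. P n u \<Longrightarrow> Q u"
  shows "halts_within (for_up x bnd body) s N Q"
  unfolding for_up_def
proof (rule halts_Seq)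
  \<comment> \<open>\<open>halts_While\<close> counts the iterations left, \<open>P\<close> those
    done.\<close>
  let ?P = "\<lambda>k u. k \<le> n \<and> P (n - k) u"
  show "halts_within (Const x 0) s 1 (P 0)" using init by (intro halts_wp) auto
  fix u assume u: "P 0 u"
  have "halts_within (While (Less x bnd) (Incr x ;; body)) u (1 + n * ((1 + m) + 1)) (?P 0)"
  proof (rule halts_While[where P = ?P])
    fix k v assume k: "k < n" and v: "?P (Suc k) v"
    then have r: "reg v x = n - Suc k" "reg v bnd = n" using regs by auto
    have e: "Suc (n - Suc k) = n - k" using k by simp
    have "halts_within body (set_reg x (Suc (n - Suc k)) v) m (P (n - k))"
      using step[of "n - Suc k" v] v k e by simp
    then have "halts_within (Incr x ;; body) v (1 + m) (P (n - k))"
      by (intro halts_Seq[where R = "\<lambda>w. w = set_reg x (Suc (n - Suc k)) v" and m = 1 and n = m])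
        (auto simp: r intro: halts_wp)
    then show "holds (Less x bnd) v \<and> halts_within (Incr x ;; body) v (1 + m) (?P k)"
      using k r by (auto intro: halts_mono)
  next
    fix v assume "?P 0 v"
    then show "\<not> holds (Less x bnd) v" using regs[of n v] by auto
  qed (use u in auto)
  then show "halts_within (While (Less x bnd) (Incr x ;; body)) u (1 + n * (m + 2)) Q"
    by (rule halts_mono) (use Q in auto)
qed (use N in auto)

lemma halts_for_down:
  assumes init: "P n s"
    and regs: "\<And>k u. P k u \<Longrightarrow> reg u x = k \<and> reg u zero = 0"
    and step: "\<And>k u. k < n \<Longrightarrow> P (Suc k) u \<Longrightarrow>
      halts_within body u m (\<lambda>v. reg v x = Suc k \<and> P k (set_reg x k v))"
    and N: "1 + n * (m + 2) \<le> N" and Q: "\<And>u. P 0 u \<Longrightarrow> Q u"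
  shows "halts_within (for_down x zero body) s N Q"
proof -
  have "halts_within (While (Less zero x) (body ;; Decr x)) s (1 + n * ((m + 1) + 1)) (P 0)"
  proof (rule halts_While[where P = P])
    fix k u assume k: "k < n" and u: "P (Suc k) u"
    have "halts_within (body ;; Decr x) u (m + 1) (P k)"
      by (rule halts_Seq[OF step[OF k u]]) (auto intro: halts_wp)
    then show "holds (Less zero x) u \<and> halts_within (body ;; Decr x) u (m + 1) (P k)"
      using regs[OF u] by simp
  next
    fix u assume "P 0 u"
    then show "\<not> holds (Less zero x) u" using regs[of 0 u] by simp
  qed (rule init)
  then show ?thesis unfolding for_down_def by (rule halts_mono) (use N Q in auto)
qed

section \<open>A linear time program for orbitopal fixing\<close>

definition row_length :: com where
  "row_length = Copy ''l'' ''q'' ;; Cond (Less ''i'' ''q'') (Copy ''l'' ''i'') Skip"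

text \<open>\<open>f\<close> receives \<open>step_bound b j\<close>, and \<open>r\<close> is the
  running minimum, which starts at \<open>q\<close>.\<close>

definition lower_entry :: com where
  "lower_entry =
     Read ''v'' ''I0'' ''i'' ''j'' ;;
     Cond (Eq ''v'' ''z'')
       (Cond (Less ''j'' ''b'') (Copy ''f'' ''b'') (Copy ''f'' ''j'' ;; Decr ''f'') ;;
        Cond (Less ''f'' ''r'') (Copy ''r'' ''f'') Skip)
       Skip"

text \<open>\<open>B\<close> is used as a vector, stored in column 0. It is written before
  \<open>b\<close> changes, so cell \<open>i\<close> keeps the bound valid after row
  \<open>i\<close>, the one that \<open>supported\<close> refers to.\<close>

definition lower_row :: com where
  "lower_row =
     (Write ''B'' ''i'' ''z'' ''b'' ;; row_length ;; Copy ''r'' ''q'') ;;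
     for_up ''j'' ''l'' lower_entry ;;
     Copy ''b'' ''r''"

definition lower_phase :: com where
  "lower_phase =
     (Const ''z'' 0 ;; Const ''one'' 1 ;; Copy ''i'' ''p'' ;; Const ''b'' 0) ;;
     for_down ''i'' ''z'' lower_row"

text \<open>The input cell is saved in \<open>v\<close> before it is overwritten. \<open>mn\<close>
  follows \<open>upper\<close> and is updated ahead of the test against \<open>b\<close>, since
  \<open>upper\<close> does not ask whether a value can be completed.\<close>

definition upper_entry :: com where
  "upper_entry =
     Read ''v'' ''I0'' ''i'' ''j'' ;;
     Write ''I0'' ''i'' ''j'' ''one'' ;;
     Cond (Eq ''v'' ''z'')
       (Cond (Less ''m1'' ''j'') Skip
         (Cond (Eq ''j'' ''m1'') (Copy ''mn'' ''m1'') Skip ;;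
          Copy ''x'' ''m'' ;;
          Cond (Less ''m'' ''j'') (Copy ''x'' ''j'') Skip ;;
          Cond (Less ''x'' ''b'') Skip (Write ''I0'' ''i'' ''j'' ''z'' ;; Incr ''n'')))
       Skip"

text \<open>A second pass over the row, because the number \<open>n\<close> of supported values is
  complete only after the first.\<close>

definition forced_entry :: com where
  "forced_entry =
     Read ''v'' ''I0'' ''i'' ''j'' ;;
     Write ''I1'' ''i'' ''j'' ''z'' ;;
     Cond (Eq ''v'' ''z'') (Cond (Eq ''n'' ''one'') (Write ''I1'' ''i'' ''j'' ''one'') Skip) Skip"

definition upper_row :: com where
  "upper_row =
     (Read ''b'' ''B'' ''i'' ''z'' ;; Copy ''m1'' ''m'' ;; Incr ''m1'' ;; row_length ;;
      Const ''n'' 0 ;; Copy ''mn'' ''m'') ;;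
     for_up ''j'' ''l'' upper_entry ;;
     for_up ''j'' ''l'' forced_entry ;;
     Copy ''m'' ''mn''"

definition upper_phase :: com where
  "upper_phase = Const ''m'' 0 ;; for_up ''i'' ''p'' upper_row"

definition orbitopal_fixing :: com where
  "orbitopal_fixing =
     lower_phase ;;
     Cond (Eq ''b'' ''z'') (Const ''empty'' 0 ;; upper_phase) (Const ''empty'' 1)"

section \<open>Correctness of the backward pass\<close>

lemma lower_loop:
  assumes "reg s ''i'' = i" "reg s ''l'' = min i q" "reg s ''b'' = b" "reg s ''z'' = 0" "reg s ''r'' = q"
    and inp: "\<And>j. j \<in> {1..min i q} \<Longrightarrow> arr s ''I0'' i j = of_bool ((i, j) \<in> I0)"
  shows "halts_within (for_up ''j'' ''l'' lower_entry) s (2 + q * 12)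
    (\<lambda>t. reg t ''r'' = Min (insert q (step_bound b ` domain q I0 i)) \<and> arr t = arr s \<and>
      (\<forall>x. x \<notin> {''j'', ''v'', ''f'', ''r''} \<longrightarrow> reg t x = reg s x))"
proof -
  let ?D = "\<lambda>k. {j \<in> domain q I0 i. j \<le> k}"
  \<comment> \<open>The running minimum after \<open>k\<close> columns.\<close>
  define r where "r k = Min (insert q (step_bound b ` ?D k))" for k
  have "?D 0 = {}" by (auto simp: domain_def)
  then have r_0: "r 0 = q" by (simp only: r_def image_empty Min_singleton)
  have r_Suc: "r (Suc k) = (if (i, Suc k) \<in> I0 then r k else min (step_bound b (Suc k)) (r k))"
    if "k < min i q" for k
  proof -
    have fin: "finite (?D k)" by (auto simp: domain_def)
    have "?D (Suc k) = (if (i, Suc k) \<in> I0 then ?D k else insert (Suc k) (?D k))"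
      using that by (auto simp: domain_def le_Suc_eq)
    then show ?thesis unfolding r_def using fin by (simp add: insert_commute[of q])
  qed
  have "?D (min i q) = domain q I0 i" by (auto simp: domain_def)
  then have r_end: "r (min i q) = Min (insert q (step_bound b ` domain q I0 i))" by (simp only: r_def)
  let ?P = "\<lambda>k (u :: store). reg u ''j'' = k \<and> reg u ''r'' = r k \<and> arr u = arr s \<and>
      (\<forall>x. x \<notin> {''j'', ''v'', ''f'', ''r''} \<longrightarrow> reg u x = reg s x)"
  show ?thesis
    unfolding r_end[symmetric]
  proof (rule halts_for_up[where P = ?P and n = "min i q" and m = 10])
    show "?P 0 (set_reg ''j'' 0 s)" using r_0 assms by simp
  next
    fix k u assume k: "k < min i q" and u: "?P k u"
    have a: "arr s ''I0'' i (Suc k) = of_bool ((i, Suc k) \<in> I0)" using inp k by auto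
    show "halts_within lower_entry (set_reg ''j'' (Suc k) u) 10 (?P (Suc k))"
    proof (rule halts_wp)
      show "wp lower_entry (?P (Suc k)) (set_reg ''j'' (Suc k) u)"
        using u assms(1-5) a by (simp add: lower_entry_def r_Suc[OF k] step_bound_def min_def)
    qed (simp add: lower_entry_def)
  qed (use assms in auto)
qed

lemma lower_phase_correct:
  assumes inp: "stores_pair p q I0 I1 s"
  shows "halts_within lower_phase s (10 + p * (q * 12 + 20))
    (\<lambda>t. reg t ''p'' = p \<and> reg t ''q'' = q \<and> reg t ''z'' = 0 \<and> reg t ''one'' = 1 \<and>
      reg t ''b'' = lower (domain q I0) q p 0 \<and> arr t ''I0'' = arr s ''I0'' \<and>
      (\<forall>i\<in>{1..p}. arr t ''B'' i 0 = lower (domain q I0) q p i))"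
proof -
  let ?L = "lower (domain q I0) q p"
  \<comment> \<open>Rows beyond \<open>k\<close> have their bounds in \<open>B\<close>; the register
    \<open>b\<close> holds the bound for the prefix of length \<open>k\<close>.\<close>
  let ?P = "\<lambda>k (u :: store). k \<le> p \<and> reg u ''i'' = k \<and> reg u ''p'' = p \<and> reg u ''q'' = q \<and> reg u ''z'' = 0 \<and>
     reg u ''one'' = 1 \<and> reg u ''b'' = ?L k \<and> arr u ''I0'' = arr s ''I0'' \<and>
     (\<forall>i\<in>{Suc k..p}. arr u ''B'' i 0 = ?L i)"
  show ?thesis
    unfolding lower_phase_def
  proof (rule halts_Seq)
    show "halts_within (Const ''z'' 0 ;; Const ''one'' 1 ;; Copy ''i'' ''p'' ;; Const ''b'' 0) s 4 (?P p)"
      using inp by (intro halts_wp) (auto simp: stores_pair_def)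
  next
    fix u assume u: "?P p u"
    show "halts_within (for_down ''i'' ''z'' lower_row) u (1 + p * (q * 12 + 20))
      (\<lambda>t. reg t ''p'' = p \<and> reg t ''q'' = q \<and> reg t ''z'' = 0 \<and> reg t ''one'' = 1 \<and>
      reg t ''b'' = ?L 0 \<and> arr t ''I0'' = arr s ''I0'' \<and>
      (\<forall>i\<in>{1..p}. arr t ''B'' i 0 = ?L i))"
    proof (rule halts_for_down[where P = ?P and n = p and m = "18 + q * 12"])
      show "?P p u" by (rule u)
    next
      fix k u assume k: "k < p" and u: "?P (Suc k) u"
      show "halts_within lower_row u (18 + q * 12) (\<lambda>v. reg v ''i'' = Suc k \<and> ?P k (set_reg ''i'' k v))"
        unfolding lower_row_def
      proof (rule halts_Seq)
        let ?R = "\<lambda>v :: store. reg v ''i'' = Suc k \<and> reg v ''p'' = p \<and> reg v ''q'' = q \<and> reg v ''z'' = 0 \<and>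
          reg v ''one'' = 1 \<and> reg v ''b'' = ?L (Suc k) \<and> arr v ''I0'' = arr s ''I0'' \<and>
          (\<forall>i\<in>{Suc k..p}. arr v ''B'' i 0 = ?L i)"
        show "halts_within (Write ''B'' ''i'' ''z'' ''b'' ;; row_length ;; Copy ''r'' ''q'') u 10
           (\<lambda>v. ?R v \<and> reg v ''l'' = min (Suc k) q \<and> reg v ''r'' = q)"
          using u by (intro halts_wp) (auto simp: row_length_def min_def)
        fix v assume v: "?R v \<and> reg v ''l'' = min (Suc k) q \<and> reg v ''r'' = q"
        show "halts_within (for_up ''j'' ''l'' lower_entry ;; Copy ''b'' ''r'') v (8 + q * 12)
           (\<lambda>v. reg v ''i'' = Suc k \<and> ?P k (set_reg ''i'' k v))"
        proof (rule halts_Seq)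
          show "halts_within (for_up ''j'' ''l'' lower_entry) v (2 + q * 12)
            (\<lambda>t. reg t ''r'' = Min (insert q (step_bound (?L (Suc k)) ` domain q I0 (Suc k))) \<and> arr t = arr v \<and>
            (\<forall>x. x \<notin> {''j'', ''v'', ''f'', ''r''} \<longrightarrow> reg t x = reg v x))"
            by (rule lower_loop) (use v inp k in \<open>auto simp: stores_pair_def idx_def\<close>)
          fix w :: store assume "reg w ''r'' = Min (insert q (step_bound (?L (Suc k)) ` domain q I0 (Suc k))) \<and> arr w = arr v \<and>
            (\<forall>x. x \<notin> {''j'', ''v'', ''f'', ''r''} \<longrightarrow> reg w x = reg v x)"
          then show "halts_within (Copy ''b'' ''r'') w 1 (\<lambda>v. reg v ''i'' = Suc k \<and> ?P k (set_reg ''i'' k v))"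
            using v k by (intro halts_wp) (auto simp: lower_step)
        qed simp
      qed simp
    qed auto
  qed simp
qed

section \<open>Correctness of the forward pass\<close>

lemma card_le_Suc: "card {j. S j \<and> j \<le> Suc k} = card {j. S j \<and> j \<le> (k::nat)} + of_bool (S (Suc k))"
proof -
  have "{j. S j \<and> j \<le> Suc k} = (if S (Suc k) then insert (Suc k) {j. S j \<and> j \<le> k} else {j. S j \<and> j \<le> k})"
    by (auto simp: le_Suc_eq)
  then show ?thesis by simp
qed

lemma upper_loop:
  fixes n M B i :: nat and I0 :: "(nat \<times> nat) set"
  defines "S \<equiv> \<lambda>j. j \<in> {1..n} \<and> (i, j) \<notin> I0 \<and> j \<le> Suc M \<and> B \<le> max M j"
  assumes s: "reg s ''i'' = i" "reg s ''l'' = n" "reg s ''b'' = B" "reg s ''z'' = 0" "reg s ''one'' = 1"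
    "reg s ''m'' = M" "reg s ''m1'' = Suc M" "reg s ''mn'' = M" "reg s ''n'' = 0"
    and inp: "\<And>j. j \<in> {1..n} \<Longrightarrow> arr s ''I0'' i j = of_bool ((i, j) \<in> I0)"
  shows "halts_within (for_up ''j'' ''l'' upper_entry) s (2 + n * 17)
    (\<lambda>t. (\<forall>j\<in>{1..n}. arr t ''I0'' i j = of_bool (\<not> S j)) \<and> reg t ''n'' = card {j. S j} \<and>
      reg t ''mn'' = (if Suc M \<le> n \<and> (i, Suc M) \<notin> I0 then Suc M else M) \<and>
      (\<forall>x. x \<notin> {''j'', ''v'', ''x'', ''n'', ''mn''} \<longrightarrow> reg t x = reg s x) \<and>
      (\<forall>a. a \<noteq> ''I0'' \<longrightarrow> arr t a = arr s a) \<and> (\<forall>i'. i' \<noteq> i \<longrightarrow> arr t ''I0'' i' = arr s ''I0'' i'))"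
proof -
  define cnt where "cnt k = card {j. S j \<and> j \<le> k}" for k
  define mn where "mn k = (if Suc M \<le> k \<and> (i, Suc M) \<notin> I0 then Suc M else M)" for k
  have start: "cnt 0 = 0" "mn 0 = M" by (auto simp: cnt_def mn_def S_def)
  have cnt_Suc: "cnt (Suc k) = cnt k + of_bool (S (Suc k))" for k
    unfolding cnt_def by (rule card_le_Suc)
  have mn_Suc: "mn (Suc k) = (if k = M \<and> (i, Suc M) \<notin> I0 then Suc M else mn k)" for k
    by (auto simp: mn_def)
  have total: "card {j. S j} = cnt n"
    unfolding cnt_def by (rule arg_cong[of _ _ card]) (auto simp: S_def)
  \<comment> \<open>The row is overwritten in place: columns up to \<open>k\<close> hold results,
    later ones still hold input.\<close>
  let ?P = "\<lambda>k (u :: store). reg u ''j'' = k \<and> (\<forall>j\<in>{1..k}. arr u ''I0'' i j = of_bool (\<not> S j)) \<and>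
      (\<forall>j\<in>{Suc k..n}. arr u ''I0'' i j = of_bool ((i, j) \<in> I0)) \<and>
      reg u ''n'' = cnt k \<and> reg u ''mn'' = mn k \<and>
      (\<forall>x. x \<notin> {''j'', ''v'', ''x'', ''n'', ''mn''} \<longrightarrow> reg u x = reg s x) \<and>
      (\<forall>a. a \<noteq> ''I0'' \<longrightarrow> arr u a = arr s a) \<and> (\<forall>i'. i' \<noteq> i \<longrightarrow> arr u ''I0'' i' = arr s ''I0'' i')"
  show ?thesis
    unfolding total mn_def[symmetric]
  proof (rule halts_for_up[where P = ?P and n = n and m = 15])
    show "?P 0 (set_reg ''j'' 0 s)" using s inp start by simp
  next
    fix k u assume k: "k < n" and u: "?P k u"
    have a: "arr u ''I0'' i (Suc k) = of_bool ((i, Suc k) \<in> I0)" using u k by auto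
    have S: "S (Suc k) \<longleftrightarrow> (i, Suc k) \<notin> I0 \<and> k \<le> M \<and> (B \<le> M \<or> B \<le> Suc k)"
      using k by (auto simp: S_def)
    have vals: "reg u ''i'' = i" "reg u ''b'' = B" "reg u ''z'' = 0" "reg u ''one'' = 1"
      "reg u ''m'' = M" "reg u ''m1'' = Suc M" "reg u ''n'' = cnt k" "reg u ''mn'' = mn k"
      using u s by simp_all
    \<comment> \<open>The effect of one iteration relative to \<open>u\<close>. The symbolic
      execution then concerns a single cell, and the quantified invariant is restored
      afterwards.\<close>
    let ?U = "\<lambda>t :: store. reg t ''j'' = Suc k \<and> arr t ''I0'' i (Suc k) = of_bool (\<not> S (Suc k)) \<and>
      reg t ''n'' = cnt (Suc k) \<and> reg t ''mn'' = mn (Suc k) \<and>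
      (\<forall>x. x \<notin> {''j'', ''v'', ''x'', ''n'', ''mn''} \<longrightarrow> reg t x = reg u x) \<and>
      (\<forall>a. a \<noteq> ''I0'' \<longrightarrow> arr t a = arr u a) \<and> (\<forall>i'. i' \<noteq> i \<longrightarrow> arr t ''I0'' i' = arr u ''I0'' i') \<and>
      (\<forall>j. j \<noteq> Suc k \<longrightarrow> arr t ''I0'' i j = arr u ''I0'' i j)"
    show "halts_within upper_entry (set_reg ''j'' (Suc k) u) 15 (?P (Suc k))"
    proof (rule halts_mono[OF halts_wp order_refl])
      show "wp upper_entry ?U (set_reg ''j'' (Suc k) u)"
        unfolding upper_entry_def using a by (auto simp: vals cnt_Suc mn_Suc S max_def)
      fix t :: store assume t: "?U t"
      have "arr t ''I0'' i j = of_bool (\<not> S j)" if "j \<in> {1..Suc k}" for j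
        using t u that by (cases "j = Suc k") auto
      moreover have "arr t ''I0'' i j = of_bool ((i, j) \<in> I0)" if "j \<in> {Suc (Suc k)..n}" for j
        using t u that by auto
      moreover have "reg t x = reg s x" if "x \<notin> {''j'', ''v'', ''x'', ''n'', ''mn''}" for x
        using t u that by metis
      ultimately show "?P (Suc k) t" using t u by simp
    qed (simp add: upper_entry_def)
  qed (use s in auto)
qed

lemma forced_loop:
  assumes s: "reg s ''i'' = i" "reg s ''l'' = n" "reg s ''z'' = 0" "reg s ''one'' = 1"
  shows "halts_within (for_up ''j'' ''l'' forced_entry) s (2 + n * 8)
    (\<lambda>t. (\<forall>j\<in>{1..n}. arr t ''I1'' i j = of_bool (arr s ''I0'' i j = 0 \<and> reg s ''n'' = 1)) \<and>
      (\<forall>x. x \<notin> {''j'', ''v''} \<longrightarrow> reg t x = reg s x) \<and>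
      (\<forall>a. a \<noteq> ''I1'' \<longrightarrow> arr t a = arr s a) \<and> (\<forall>i'. i' \<noteq> i \<longrightarrow> arr t ''I1'' i' = arr s ''I1'' i'))"
proof -
  let ?P = "\<lambda>k (u :: store). reg u ''j'' = k \<and>
      (\<forall>j\<in>{1..k}. arr u ''I1'' i j = of_bool (arr s ''I0'' i j = 0 \<and> reg s ''n'' = 1)) \<and>
      (\<forall>x. x \<notin> {''j'', ''v''} \<longrightarrow> reg u x = reg s x) \<and>
      (\<forall>a. a \<noteq> ''I1'' \<longrightarrow> arr u a = arr s a) \<and> (\<forall>i'. i' \<noteq> i \<longrightarrow> arr u ''I1'' i' = arr s ''I1'' i')"
  show ?thesis
  proof (rule halts_for_up[where P = ?P and n = n and m = 6])
    fix k u assume k: "k < n" and u: "?P k u"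
    have vals: "reg u ''i'' = i" "reg u ''z'' = 0" "reg u ''one'' = 1" "reg u ''n'' = reg s ''n''"
      "arr u ''I0'' = arr s ''I0''"
      using u s by simp_all
    let ?U = "\<lambda>t :: store. reg t ''j'' = Suc k \<and>
      arr t ''I1'' i (Suc k) = of_bool (arr s ''I0'' i (Suc k) = 0 \<and> reg s ''n'' = 1) \<and>
      (\<forall>x. x \<notin> {''j'', ''v''} \<longrightarrow> reg t x = reg u x) \<and>
      (\<forall>a. a \<noteq> ''I1'' \<longrightarrow> arr t a = arr u a) \<and> (\<forall>i'. i' \<noteq> i \<longrightarrow> arr t ''I1'' i' = arr u ''I1'' i') \<and>
      (\<forall>j. j \<noteq> Suc k \<longrightarrow> arr t ''I1'' i j = arr u ''I1'' i j)"
    show "halts_within forced_entry (set_reg ''j'' (Suc k) u) 6 (?P (Suc k))"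
    proof (rule halts_mono[OF halts_wp order_refl])
      show "wp forced_entry ?U (set_reg ''j'' (Suc k) u)"
        unfolding forced_entry_def by (auto simp: vals)
      fix t :: store assume t: "?U t"
      have "arr t ''I1'' i j = of_bool (arr s ''I0'' i j = 0 \<and> reg s ''n'' = 1)" if "j \<in> {1..Suc k}" for j
        using t u that by (cases "j = Suc k") auto
      moreover have "reg t x = reg s x" if "x \<notin> {''j'', ''v''}" for x
        using t u that by metis
      ultimately show "?P (Suc k) t" using t u by simp
    qed (simp add: forced_entry_def)
  qed (use s in auto)
qed


lemma upper_phase_correct:
  assumes inst: "partitioning_instance p q I0 I1"
    and regs: "reg s ''p'' = p" "reg s ''q'' = q" "reg s ''z'' = 0" "reg s ''one'' = 1" "reg s ''empty'' = 0"
    and inp: "\<And>i j. (i, j) \<in> idx p q \<Longrightarrow> arr s ''I0'' i j = of_bool ((i, j) \<in> I0)"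
    and low: "\<And>i. i \<in> {1..p} \<Longrightarrow> arr s ''B'' i 0 = lower (domain q I0) q p i"
  shows "halts_within upper_phase s (4 + p * (q * 25 + 40))
    (\<lambda>t. reg t ''p'' = p \<and> reg t ''q'' = q \<and> reg t ''empty'' = 0 \<and>
      (\<forall>i\<in>{1..p}. \<forall>j\<in>{1..min i q}.
        arr t ''I0'' i j = of_bool (\<not> row_domains.supported (domain q I0) p q i j) \<and>
        arr t ''I1'' i j = of_bool (row_domains.supported (domain q I0) p q i j \<and>
          card {j. row_domains.supported (domain q I0) p q i j} = 1)))"
proof -
  let ?D = "domain q I0"
  interpret row_domains ?D p q
    using domain_nonempty[OF inst] by unfold_locales (auto simp: domain_def)
  let ?out = "\<lambda>(u :: store) i j. arr u ''I0'' i j = of_bool (\<not> supported i j) \<and>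
      arr u ''I1'' i j = of_bool (supported i j \<and> card {j. supported i j} = 1)"
  let ?F = "\<lambda>(u :: store). reg u ''p'' = p \<and> reg u ''q'' = q \<and> reg u ''z'' = 0 \<and> reg u ''one'' = 1 \<and>
      reg u ''empty'' = 0 \<and> arr u ''B'' = arr s ''B''"
  \<comment> \<open>A step reads only its own row and its bound in \<open>B\<close>, so finished
    rows may already hold output; \<open>upper ?D k\<close> is all that is passed on.\<close>
  let ?P = "\<lambda>k (u :: store). reg u ''i'' = k \<and> reg u ''m'' = upper ?D k \<and> ?F u \<and>
      (\<forall>i\<in>{Suc k..p}. arr u ''I0'' i = arr s ''I0'' i) \<and>
      (\<forall>i\<in>{1..k}. \<forall>j\<in>{1..min i q}. ?out u i j)"
  show ?thesis
    unfolding upper_phase_def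
  proof (rule halts_Seq)
    let ?Q = "\<lambda>u :: store. ?F u \<and> reg u ''m'' = 0 \<and> arr u = arr s"
    show "halts_within (Const ''m'' 0) s 1 ?Q" using regs by (intro halts_wp) auto
    fix u0 :: store assume u0: "?Q u0"
    show "halts_within (for_up ''i'' ''p'' upper_row) u0 (2 + p * (q * 25 + 40))
      (\<lambda>t. reg t ''p'' = p \<and> reg t ''q'' = q \<and> reg t ''empty'' = 0 \<and>
        (\<forall>i\<in>{1..p}. \<forall>j\<in>{1..min i q}. ?out t i j))"
    proof (rule halts_for_up[where P = ?P and n = p and m = "38 + q * 25"])
      show "?P 0 (set_reg ''i'' 0 u0)" using u0 by simp
    next
      fix k u assume k: "k < p" and u: "?P k u"
      define i where "i = Suc k"
      define n where "n = min i q"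
      define M where "M = upper ?D k"
      define B where "B = lower ?D q p i"
      define S where "S j \<longleftrightarrow> j \<in> {1..n} \<and> (i, j) \<notin> I0 \<and> j \<le> Suc M \<and> B \<le> max M j" for j
      have S: "S = supported i"
        by (rule ext) (auto simp: S_def supported_def domain_def n_def M_def B_def i_def)
      have nq: "n \<le> q" by (simp add: n_def)
      have bB: "arr u ''B'' i 0 = B" using low[of i] k u by (simp add: B_def i_def)
      have aI: "arr u ''I0'' i = arr s ''I0'' i" using u k by (auto simp: i_def)
      have row: "arr s ''I0'' i j = of_bool ((i, j) \<in> I0)" if "j \<in> {1..n}" for j
        using that inp[of i j] k by (simp add: idx_def n_def i_def)
      have M': "upper ?D i = (if Suc M \<le> n \<and> (i, Suc M) \<notin> I0 then Suc M else M)"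
        by (simp add: i_def M_def n_def domain_def)
      let ?R = "\<lambda>v :: store. ?F v \<and> reg v ''i'' = i \<and> reg v ''l'' = n \<and> reg v ''m'' = M \<and>
        (\<forall>i'. i' \<noteq> i \<longrightarrow> arr v ''I0'' i' = arr u ''I0'' i' \<and> arr v ''I1'' i' = arr u ''I1'' i')"
      let ?R1 = "\<lambda>v :: store. ?R v \<and> arr v ''I0'' i = arr s ''I0'' i \<and> reg v ''b'' = B \<and>
        reg v ''m1'' = Suc M \<and> reg v ''mn'' = M \<and> reg v ''n'' = 0"
      let ?R2 = "\<lambda>v :: store. ?R v \<and> reg v ''n'' = card {j. S j} \<and> reg v ''mn'' = upper ?D i \<and>
        (\<forall>j\<in>{1..n}. arr v ''I0'' i j = of_bool (\<not> S j))"
      let ?R3 = "\<lambda>v :: store. ?R v \<and> reg v ''mn'' = upper ?D i \<and> (\<forall>j\<in>{1..n}. ?out v i j)"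
      let ?w = "set_reg ''i'' (Suc k) u"
      show "halts_within upper_row ?w (38 + q * 25) (?P (Suc k))"
        unfolding upper_row_def
      proof (rule halts_Seq[where R = ?R1])
        show "halts_within (Read ''b'' ''B'' ''i'' ''z'' ;; Copy ''m1'' ''m'' ;; Incr ''m1'' ;; row_length ;;
            Const ''n'' 0 ;; Copy ''mn'' ''m'') ?w 20 ?R1"
        proof (rule halts_wp)
          show "wp (Read ''b'' ''B'' ''i'' ''z'' ;; Copy ''m1'' ''m'' ;; Incr ''m1'' ;; row_length ;;
              Const ''n'' 0 ;; Copy ''mn'' ''m'') ?R1 ?w"
            using u bB aI by (simp add: row_length_def i_def[symmetric] M_def[symmetric] n_def)
        qed (simp add: row_length_def)
        fix v :: store assume v: "?R1 v"
        show "halts_within (for_up ''j'' ''l'' upper_entry ;; for_up ''j'' ''l'' forced_entry ;; Copy ''m'' ''mn'')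
            v (10 + q * 25) (?P (Suc k))"
        proof (rule halts_Seq[where R = ?R2])
          have loop: "halts_within (for_up ''j'' ''l'' upper_entry) v (2 + n * 17)
            (\<lambda>t. (\<forall>j\<in>{1..n}. arr t ''I0'' i j = of_bool (\<not> S j)) \<and> reg t ''n'' = card {j. S j} \<and>
              reg t ''mn'' = (if Suc M \<le> n \<and> (i, Suc M) \<notin> I0 then Suc M else M) \<and>
              (\<forall>x. x \<notin> {''j'', ''v'', ''x'', ''n'', ''mn''} \<longrightarrow> reg t x = reg v x) \<and>
              (\<forall>a. a \<noteq> ''I0'' \<longrightarrow> arr t a = arr v a) \<and> (\<forall>i'. i' \<noteq> i \<longrightarrow> arr t ''I0'' i' = arr v ''I0'' i'))"
            unfolding S_def by (rule upper_loop) (use v row in simp_all)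
          show "halts_within (for_up ''j'' ''l'' upper_entry) v (2 + q * 17) ?R2"
            by (rule halts_mono[OF loop]) (use v nq in \<open>simp_all add: M'\<close>)
          fix t :: store assume t: "?R2 t"
          show "halts_within (for_up ''j'' ''l'' forced_entry ;; Copy ''m'' ''mn'') t (4 + q * 8) (?P (Suc k))"
          proof (rule halts_Seq[where R = ?R3])
            have loop: "halts_within (for_up ''j'' ''l'' forced_entry) t (2 + n * 8)
              (\<lambda>w. (\<forall>j\<in>{1..n}. arr w ''I1'' i j = of_bool (arr t ''I0'' i j = 0 \<and> reg t ''n'' = 1)) \<and>
                (\<forall>x. x \<notin> {''j'', ''v''} \<longrightarrow> reg w x = reg t x) \<and>
                (\<forall>a. a \<noteq> ''I1'' \<longrightarrow> arr w a = arr t a) \<and> (\<forall>i'. i' \<noteq> i \<longrightarrow> arr w ''I1'' i' = arr t ''I1'' i'))"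
              by (rule forced_loop) (use t in simp_all)
            show "halts_within (for_up ''j'' ''l'' forced_entry) t (2 + q * 8) ?R3"
              by (rule halts_mono[OF loop]) (use t nq in \<open>simp_all add: S\<close>)
            fix w :: store assume w: "?R3 w"
            have "?P (Suc k) (set_reg ''m'' (upper ?D i) w)"
            proof -
              have "?out w i' j" if "i' \<in> {1..Suc k}" "j \<in> {1..min i' q}" for i' j
              proof (cases "i' = i")
                case True
                then show ?thesis using w that by (simp add: n_def)
              next
                case False
                then have "i' \<in> {1..k}" using that by (auto simp: i_def)
                then have "?out u i' j" using u that by blast
                then show ?thesis using w False by simp
              qed
              moreover have "arr w ''I0'' i' = arr s ''I0'' i'" if "i' \<in> {Suc (Suc k)..p}" for i'
              proof -
                have "i' \<noteq> i" "i' \<in> {Suc k..p}" using that by (auto simp: i_def)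
                then show ?thesis using w u by simp
              qed
              ultimately show ?thesis using w by (simp add: i_def)
            qed
            then show "halts_within (Copy ''m'' ''mn'') w 1 (?P (Suc k))"
              using w by (intro halts_wp) simp_all
          qed simp
        qed simp
      qed simp
    qed (use u0 in auto)
  qed simp
qed

section \<open>Assembling the solver\<close>

lemma stores_pairI:
  assumes "reg s ''p'' = p" "reg s ''q'' = q"
    and "\<And>i j. (i, j) \<in> idx p q \<Longrightarrow> arr s ''I0'' i j = of_bool ((i, j) \<in> I0) \<and> arr s ''I1'' i j = of_bool ((i, j) \<in> I1)"
  shows "stores_pair p q I0 I1 s"
  unfolding stores_pair_def using assms by blast

lemma stores_resultI:
  assumes "C \<noteq> {}" "reg s ''empty'' = 0" "reg s ''p'' = p" "reg s ''q'' = q"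
    and "\<And>i j. (i, j) \<in> idx p q \<Longrightarrow>
      arr s ''I0'' i j = of_bool (\<forall>c\<in>C. c i \<noteq> j) \<and> arr s ''I1'' i j = of_bool (\<forall>c\<in>C. c i = j)"
  shows "stores_result p q C s"
  unfolding stores_result_def if_not_P[OF assms(1)]
  by (intro conjI stores_pairI) (use assms in simp_all)

lemma orbitopal_fixing_correct:
  "solves_orbitopal_fixing orbitopal_fixing (\<lambda>p q. 200 * (p * q))"
  unfolding solves_orbitopal_fixing_def
proof (intro allI impI)
  fix p q I0 I1 s
  assume inst: "partitioning_instance p q I0 I1" and inp: "stores_pair p q I0 I1 s"
  let ?D = "domain q I0"
  interpret row_domains ?D p q
    using domain_nonempty[OF inst] by unfold_locales (auto simp: domain_def)
  have pq: "2 \<le> q" "q \<le> p" and I: "I0 \<subseteq> idx p q" "I1 \<subseteq> idx p q"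
    using inst by (auto simp: partitioning_instance_def)
  define C where "C = {c. bounded_growth ?D p c}"
  have C_ne: "C \<noteq> {} \<longleftrightarrow> lower ?D q p 0 = 0" using feasible_iff by (auto simp: C_def)
  have res: "stores_fixing p q (cube_face p q I0 I1) (partitioning_orbitope p q) t \<longleftrightarrow> stores_result p q C t" for t
    unfolding C_def partitioning_codes_eq[OF inst, symmetric] by (rule stores_fixing_partitioning[OF I])
  let ?R = "\<lambda>t :: store. reg t ''p'' = p \<and> reg t ''q'' = q \<and> reg t ''z'' = 0 \<and> reg t ''one'' = 1 \<and>
      reg t ''b'' = lower ?D q p 0 \<and> arr t ''I0'' = arr s ''I0'' \<and>
      (\<forall>i\<in>{1..p}. arr t ''B'' i 0 = lower ?D q p i)"
  show "halts_within orbitopal_fixing s (200 * (p * q))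
      (stores_fixing p q (cube_face p q I0 I1) (partitioning_orbitope p q))"
    unfolding orbitopal_fixing_def res
  proof (rule halts_Seq[OF lower_phase_correct[OF inp]])
    fix u :: store assume u: "?R u"
    show "halts_within (Cond (Eq ''b'' ''z'') (Const ''empty'' 0 ;; upper_phase) (Const ''empty'' 1))
      u (6 + p * (q * 25 + 40)) (stores_result p q C)"
    proof (rule halts_Cond)
      assume "holds (Eq ''b'' ''z'') u"
      then have ne: "C \<noteq> {}" using u C_ne by simp
      then obtain c0 where c0: "bounded_growth ?D p c0" by (auto simp: C_def)
      show "halts_within (Const ''empty'' 0 ;; upper_phase) u (5 + p * (q * 25 + 40)) (stores_result p q C)"
      proof (rule halts_Seq)
        let ?R' = "\<lambda>t. ?R t \<and> reg t ''empty'' = 0"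
        show "halts_within (Const ''empty'' 0) u 1 ?R'" using u by (intro halts_wp) simp_all
        fix v :: store assume v: "?R' v"
        have up: "halts_within upper_phase v (4 + p * (q * 25 + 40))
          (\<lambda>t. reg t ''p'' = p \<and> reg t ''q'' = q \<and> reg t ''empty'' = 0 \<and>
            (\<forall>i\<in>{1..p}. \<forall>j\<in>{1..min i q}. arr t ''I0'' i j = of_bool (\<not> supported i j) \<and>
              arr t ''I1'' i j = of_bool (supported i j \<and> card {j. supported i j} = 1)))"
          by (rule upper_phase_correct[OF inst]) (use v inp in \<open>auto simp: stores_pair_def\<close>)
        show "halts_within upper_phase v (4 + p * (q * 25 + 40)) (stores_result p q C)"
        proof (rule halts_mono[OF up order_refl])
          fix t :: store
          assume t: "reg t ''p'' = p \<and> reg t ''q'' = q \<and> reg t ''empty'' = 0 \<and>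
            (\<forall>i\<in>{1..p}. \<forall>j\<in>{1..min i q}. arr t ''I0'' i j = of_bool (\<not> supported i j) \<and>
              arr t ''I1'' i j = of_bool (supported i j \<and> card {j. supported i j} = 1))"
          have out: "arr t ''I0'' i j = of_bool (\<forall>c\<in>C. c i \<noteq> j) \<and> arr t ''I1'' i j = of_bool (\<forall>c\<in>C. c i = j)"
            if "(i, j) \<in> idx p q" for i j
          proof -
            have i: "i \<in> {1..p}" and j: "j \<in> {1..min i q}" using that by (auto simp: idx_def)
            have "(\<forall>c\<in>C. c i \<noteq> j) \<longleftrightarrow> \<not> supported i j"
              unfolding C_def supported_iff[OF c0 i, symmetric] by blast
            moreover have "(\<forall>c\<in>C. c i = j) \<longleftrightarrow> supported i j \<and> card {j. supported i j} = 1"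
              unfolding C_def forced_iff[OF c0 i, symmetric] by blast
            ultimately show ?thesis using t i j by simp
          qed
          show "stores_result p q C t"
            by (rule stores_resultI) (use t ne out in auto)
        qed
      qed simp
    next
      assume "\<not> holds (Eq ''b'' ''z'') u"
      then have "C = {}" using u C_ne by auto
      then show "halts_within (Const ''empty'' 1) u (5 + p * (q * 25 + 40)) (stores_result p q C)"
        by (intro halts_wp) (simp_all add: stores_result_def)
    qed simp
  next
    \<comment> \<open>These two bounds absorb the lower order terms: the total is at most
      \<open>(16 + 60 + 37) * (p * q)\<close>.\<close>
    have "p \<le> p * q" "1 \<le> p * q" using pq by simp_all
    moreover have "10 + p * (q * 12 + 20) + (6 + p * (q * 25 + 40)) = 16 + 60 * p + 37 * (p * q)"
      by (simp add: algebra_simps)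
    ultimately show "10 + p * (q * 12 + 20) + (6 + p * (q * 25 + 40)) \<le> 200 * (p * q)"
      by linarith
  qed
qed

section \<open>From packing to partitioning\<close>

definition single :: "(nat \<times> nat) set \<Rightarrow> nat \<Rightarrow> bool" where
  "single I1 i \<longleftrightarrow> card {l. (i, l) \<in> I1} = 1"

text \<open>The only contradiction visible within a single row: \<open>I0\<close> and
  \<open>I1\<close> are disjoint, and a row without 1-entry is admissible.\<close>

definition conflict :: "nat \<Rightarrow> (nat \<times> nat) set \<Rightarrow> bool" where
  "conflict p I1 \<longleftrightarrow> (\<exists>i\<in>{1..p}. 1 < card {l. (i, l) \<in> I1})"

text \<open>Column 1 of the larger matrix is the slack column, and \<open>(i - 1, 0)\<close> is in neither set.\<close>

definition shifted_zero :: "(nat \<times> nat) set \<Rightarrow> (nat \<times> nat) set \<Rightarrow> nat \<Rightarrow> nat \<Rightarrow> bool" where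
  "shifted_zero I0 I1 i j \<longleftrightarrow> (if single I1 (i - 1) then (i - 1, j - 1) \<notin> I1 else (i - 1, j - 1) \<in> I0)"

text \<open>
  If some row contains two entries fixed to 1, rows 2 and 3 are forced to the values 1 and 3,
  which no restricted growth string allows.
\<close>

definition reduced_zeros :: "nat \<Rightarrow> nat \<Rightarrow> (nat \<times> nat) set \<Rightarrow> (nat \<times> nat) set \<Rightarrow> (nat \<times> nat) set" where
  "reduced_zeros p q I0 I1 = {(i, j) \<in> idx (p + 1) (q + 1).
     if conflict p I1 \<and> i = 2 then j = 2
     else if conflict p I1 \<and> i = 3 then j \<le> 2
     else shifted_zero I0 I1 i j}"

section \<open>Correctness of the reduction on codes\<close>

context
  fixes p q :: nat and I0 I1 :: "(nat \<times> nat) set"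
  assumes inst: "packing_instance p q I0 I1"
begin

lemma packing_instance_facts:
  "2 \<le> q" "q \<le> p" "I0 \<subseteq> idx p q" "I1 \<subseteq> idx p q" "I0 \<inter> I1 = {}"
  using inst by (auto simp: packing_instance_def)

lemma finite_row: "finite {l. (i, l) \<in> I1}"
  by (rule finite_subset[of _ "{1..q}"]) (use packing_instance_facts in \<open>auto simp: idx_def\<close>)

lemma single_obtain:
  assumes "single I1 i"
  obtains l where "l \<in> {1..min i q}" "i \<in> {1..p}" "\<And>l'. (i, l') \<in> I1 \<longleftrightarrow> l' = l"
proof -
  from assms obtain l where l: "{l. (i, l) \<in> I1} = {l}" by (auto simp: single_def card_1_singleton_iff)
  then have "\<And>l'. (i, l') \<in> I1 \<longleftrightarrow> l' = l" by blast
  moreover from this have "(i, l) \<in> idx p q" using packing_instance_facts by auto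
  ultimately show ?thesis using that by (auto simp: idx_def)
qed

lemma not_in_sets:
  assumes "i = 0 \<or> j = 0"
  shows "(i, j) \<notin> I0" "(i, j) \<notin> I1"
  using assms packing_instance_facts by (auto simp: idx_def)

lemma not_single_0: "\<not> single I1 0"
  using not_in_sets(2)[of 0] by (simp add: single_def)

lemma reduced_instance: "partitioning_instance (p + 1) (q + 1) (reduced_zeros p q I0 I1) {}"
proof -
  let ?J = "reduced_zeros p q I0 I1"
  \<comment> \<open>The free cell lies in column 1 or 3 of the two blocked rows, at the shifted
    1-entry of a row with a single one, and otherwise in the slack column.\<close>
  have free: "\<exists>l\<in>{1..min i (q + 1)}. (i, l) \<notin> ?J" if i: "i \<in> {1..p + 1}" for i
  proof (cases "conflict p I1 \<and> i \<in> {2, 3}")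
    case True
    then show ?thesis using packing_instance_facts(1)
      by (intro bexI[of _ "if i = 2 then 1 else 3"]) (auto simp: reduced_zeros_def)
  next
    case False
    show ?thesis
    proof (cases "single I1 (i - 1)")
      case True
      then obtain l where l: "l \<in> {1..min (i - 1) q}" "i - 1 \<in> {1..p}" "\<And>l'. (i - 1, l') \<in> I1 \<longleftrightarrow> l' = l"
        using single_obtain by blast
      then show ?thesis using False True
        by (intro bexI[of _ "Suc l"]) (auto simp: reduced_zeros_def shifted_zero_def)
    next
      case ns: False
      then show ?thesis using False i not_in_sets(1)[of "i - 1" 0]
        by (intro bexI[of _ 1]) (auto simp: reduced_zeros_def shifted_zero_def)
    qed
  qed
  have "card (?J \<inter> row_idx (q + 1) i) \<le> min i (q + 1) - 1" if i: "i \<in> {1..p + 1}" for i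
  proof -
    obtain l where l: "l \<in> {1..min i (q + 1)}" "(i, l) \<notin> ?J" using free[OF i] by blast
    have "?J \<inter> row_idx (q + 1) i \<subseteq> (\<lambda>j. (i, j)) ` ({1..min i (q + 1)} - {l})"
      using l by (auto simp: row_idx_def)
    then have "card (?J \<inter> row_idx (q + 1) i) \<le> card ((\<lambda>j. (i, j)) ` ({1..min i (q + 1)} - {l}))"
      by (intro card_mono) auto
    also have "\<dots> = min i (q + 1) - 1" using l(1) by (simp add: card_image inj_on_def)
    finally show ?thesis .
  qed
  moreover have "?J \<subseteq> idx (p + 1) (q + 1)" by (auto simp: reduced_zeros_def)
  ultimately show ?thesis
    using packing_instance_facts by (simp add: partitioning_instance_def)
qed

abbreviation "Pack \<equiv> packing_codes p q I0 I1"
abbreviation "Part \<equiv> partitioning_codes (p + 1) (q + 1) (reduced_zeros p q I0 I1) {}"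

lemma Pack_empty_if_conflict:
  assumes "conflict p I1"
  shows "Pack = {}"
proof -
  from assms obtain i where "1 < card {l. (i, l) \<in> I1}" by (auto simp: conflict_def)
  then have "\<not> (\<forall>a\<in>{l. (i, l) \<in> I1}. \<forall>b\<in>{l. (i, l) \<in> I1}. a = b)"
    using card_le_Suc0_iff_eq[OF finite_row[of i]] by simp
  then obtain a b where ab: "(i, a) \<in> I1" "(i, b) \<in> I1" "a \<noteq> b" by blast
  have "\<not> matching I0 I1 c" for c
  proof
    assume "matching I0 I1 c"
    then have "c i = a" "c i = b" using ab by (auto simp: matching_def)
    then show False using ab(3) by simp
  qed
  then show ?thesis by (simp add: packing_codes_def)
qed

text \<open>\<open>p + 1\<close> and \<open>q + 1\<close> are at least 3, so all blocked cells
  exist. A value of at least 3 in row 3 needs an earlier value of at least 2, yet rows 1 and 2 both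
  have value 1.\<close>

lemma Part_empty_if_conflict:
  assumes "conflict p I1"
  shows "Part = {}"
proof (rule equals0I)
  fix c assume c: "c \<in> Part"
  then have g: "c \<in> growth (p + 1) (q + 1)" and pos: "\<And>i. i \<in> {1..p + 1} \<Longrightarrow> 1 \<le> c i"
    and J: "\<And>i j. (i, j) \<in> reduced_zeros p q I0 I1 \<Longrightarrow> c i \<noteq> j"
    by (auto simp: partitioning_codes_def packing_codes_def matching_def)
  have pq: "2 \<le> q" "2 \<le> p" using packing_instance_facts by auto
  have "c 1 = 1" "c 2 \<le> 2" "1 \<le> c 2" "1 \<le> c 3"
    using growth_le_index[OF g] pos pq by (auto intro: le_antisym)
  moreover have "c 2 \<noteq> 2" "c 3 \<noteq> 1" "c 3 \<noteq> 2"
    using assms pq by (auto intro!: J simp: reduced_zeros_def idx_def)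
  ultimately have v: "c 1 = 1" "c 2 = 1" "3 \<le> c 3" by auto
  have "c 3 \<le> 1 \<or> (\<exists>k\<in>{1..<3}. Suc (c k) = c 3)" using g pq by (auto simp: growth_def)
  then obtain k where "k \<in> {1..<3}" "Suc (c k) = c 3" using v by auto
  moreover from this have "k = 1 \<or> k = 2" by auto
  ultimately show False using v by auto
qed

text \<open>Rows and values move up by one, so a zero row gets value 1. The new first row supplies
  the predecessor of a shifted value 2, whose original 1 needed none.\<close>

lemma Pack_to_Part:
  assumes nc: "\<not> conflict p I1" and c: "c \<in> Pack"
  defines "c' \<equiv> \<lambda>i. if i \<le> 1 then 1 else Suc (c (i - 1))"
  shows "c' \<in> Part"
proof -
  have g: "c \<in> growth p q" and I0: "\<And>i j. (i, j) \<in> I0 \<Longrightarrow> c i \<noteq> j" and I1: "\<And>i j. (i, j) \<in> I1 \<Longrightarrow> c i = j"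
    using c by (auto simp: packing_codes_def matching_def)
  have c'_Suc: "c' (Suc i) = Suc (c i)" if "1 \<le> i" for i using that by (simp add: c'_def)
  have "c' i \<le> q + 1 \<and> (c' i \<le> 1 \<or> (\<exists>k\<in>{1..<i}. Suc (c' k) = c' i))" if i: "i \<in> {1..p + 1}" for i
  proof (cases "i \<le> 1")
    case False
    then obtain i' where i': "i = Suc i'" "i' \<in> {1..p}" using i by (cases i) auto
    then have gi: "c i' \<le> q" "c i' \<le> 1 \<or> (\<exists>k\<in>{1..<i'}. Suc (c k) = c i')"
      using g by (auto simp: growth_def)
    consider "c i' = 0" | "c i' = 1" | k where "k \<in> {1..<i'}" "Suc (c k) = c i'"
      using gi(2) by fastforce
    then have "c' i \<le> 1 \<or> (\<exists>k\<in>{1..<i}. Suc (c' k) = c' i)"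
    proof cases
      case 2
      \<comment> \<open>The predecessor is the new first row.\<close>
      then show ?thesis using i' by (intro disjI2 bexI[of _ 1]) (auto simp: c'_def)
    next
      case 3
      then show ?thesis using i' c'_Suc[of k] c'_Suc[of i']
        by (intro disjI2 bexI[of _ "Suc k"]) auto
    qed (use i' in \<open>auto simp: c'_def\<close>)
    then show ?thesis using gi(1) i' c'_Suc[of i'] by simp
  qed (simp add: c'_def)
  then have "c' \<in> growth (p + 1) (q + 1)" by (simp add: growth_def)
  moreover have "c' i \<noteq> j" if ij: "(i, j) \<in> reduced_zeros p q I0 I1" for i j
  proof -
    have z: "shifted_zero I0 I1 i j" "(i, j) \<in> idx (p + 1) (q + 1)"
      using ij nc by (auto simp: reduced_zeros_def)
    show ?thesis
    proof (cases "single I1 (i - 1)")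
      case True
      then obtain l where l: "l \<in> {1..min (i - 1) q}" "\<And>l'. (i - 1, l') \<in> I1 \<longleftrightarrow> l' = l"
        using single_obtain by blast
      then have "c (i - 1) = l" using I1 by auto
      then have "c' i = Suc l" using l(1) by (auto simp: c'_def)
      moreover have "j - 1 \<noteq> l" using z True l(2) by (simp add: shifted_zero_def)
      ultimately show ?thesis by auto
    next
      case False
      then have m: "(i - 1, j - 1) \<in> I0" using z by (simp add: shifted_zero_def)
      \<comment> \<open>\<open>I0\<close> contains no pair with a zero index, so the truncated
        subtractions can be undone.\<close>
      then have "1 \<le> i - 1" "1 \<le> j - 1" using not_in_sets(1) by (metis One_nat_def Suc_leI gr0I)+
      then show ?thesis using I0[OF m] by (auto simp: c'_def)
    qed
  qed
  moreover have "1 \<le> c' i" for i by (simp add: c'_def)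
  ultimately show ?thesis by (auto simp: partitioning_codes_def packing_codes_def matching_def)
qed

lemma Part_to_Pack:
  assumes nc: "\<not> conflict p I1" and c': "c' \<in> Part"
  defines "c \<equiv> \<lambda>i. c' (Suc i) - 1"
  shows "c \<in> Pack"
proof -
  have g: "c' \<in> growth (p + 1) (q + 1)" and pos: "\<And>i. i \<in> {1..p + 1} \<Longrightarrow> 1 \<le> c' i"
    and J: "\<And>i j. (i, j) \<in> reduced_zeros p q I0 I1 \<Longrightarrow> c' i \<noteq> j"
    using c' by (auto simp: partitioning_codes_def packing_codes_def matching_def)
  have le: "c' i \<le> i" "c' i \<le> q + 1" if "i \<in> {1..p + 1}" for i
    using growth_le_index[OF g that] g that by (auto simp: growth_def)
  have Suc_c: "c' (Suc i) = Suc (c i)" if "i \<in> {1..p}" for i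
    using pos[of "Suc i"] that by (simp add: c_def)
  have c1: "c' 1 = 1" using le(1)[of 1] pos[of 1] by simp
  have "c i \<le> q \<and> (c i \<le> 1 \<or> (\<exists>k\<in>{1..<i}. Suc (c k) = c i))" if i: "i \<in> {1..p}" for i
  proof (cases "c i \<le> 1")
    case True
    then show ?thesis using packing_instance_facts by simp
  next
    case False
    then have "\<not> c' (Suc i) \<le> 1" using Suc_c[OF i] by simp
    then obtain k where k: "k \<in> {1..<Suc i}" "Suc (c' k) = c' (Suc i)" using g i by (auto simp: growth_def)
    \<comment> \<open>\<open>c i > 1\<close> means a shifted value of at least 3, whose predecessor
      exceeds the value 1 of the first row; the predecessor thus stems from an original row.\<close>
    then have "k \<noteq> 1" using c1 Suc_c[OF i] False by auto
    then obtain k' where k': "k = Suc k'" "k' \<in> {1..<i}" using k(1) by (cases k) auto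
    then have "Suc (c k') = c i" using k(2) Suc_c[OF i] Suc_c[of k'] i by auto
    moreover have "c i \<le> q" using le(2)[of "Suc i"] Suc_c[OF i] i by simp
    ultimately show ?thesis using k' by blast
  qed
  then have "c \<in> growth p q" by (simp add: growth_def)
  \<comment> \<open>For \<open>c i = 0\<close> this speaks of the slack cell and shows that a row
    with a single entry fixed to 1 is no zero row.\<close>
  moreover have zero: "\<not> shifted_zero I0 I1 (Suc i) (Suc (c i))" if i: "i \<in> {1..p}" for i
  proof
    assume "shifted_zero I0 I1 (Suc i) (Suc (c i))"
    moreover have "(Suc i, Suc (c i)) \<in> idx (p + 1) (q + 1)"
      using le[of "Suc i"] Suc_c[OF i] i by (simp add: idx_def)
    ultimately have "(Suc i, Suc (c i)) \<in> reduced_zeros p q I0 I1" using nc by (simp add: reduced_zeros_def)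
    then show False using J Suc_c[OF i] by blast
  qed
  have "c i \<noteq> j" if ij: "(i, j) \<in> I0" for i j
  proof
    assume eq: "c i = j"
    have i: "i \<in> {1..p}" using ij packing_instance_facts by (auto simp: idx_def)
    have "(i, j) \<notin> I1" using ij packing_instance_facts by blast
    then show False using zero[OF i] ij eq by (simp add: shifted_zero_def split: if_splits)
  qed
  moreover have "c i = j" if ij: "(i, j) \<in> I1" for i j
  proof -
    have i: "i \<in> {1..p}" using ij packing_instance_facts by (auto simp: idx_def)
    have "card {l. (i, l) \<in> I1} \<noteq> 0" using ij finite_row by auto
    moreover have "\<not> 1 < card {l. (i, l) \<in> I1}" using nc i by (auto simp: conflict_def)
    ultimately have s: "single I1 i" by (simp add: single_def)
    then have "(i, c i) \<in> I1" using zero[OF i] by (simp add: shifted_zero_def)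
    then show ?thesis using s ij single_obtain by metis
  qed
  ultimately show ?thesis by (auto simp: packing_codes_def matching_def)
qed

lemma reduction_values: "(\<exists>c\<in>Pack. c i = j) \<longleftrightarrow> (\<exists>c\<in>Part. c (Suc i) = Suc j)" if "i \<in> {1..p}"
proof (cases "conflict p I1")
  case False
  show ?thesis
  proof
    assume "\<exists>c\<in>Pack. c i = j"
    then obtain c where "c \<in> Pack" "c i = j" by blast
    then show "\<exists>c\<in>Part. c (Suc i) = Suc j"
      using that by (intro bexI[OF _ Pack_to_Part[OF False]]) auto
  next
    assume "\<exists>c\<in>Part. c (Suc i) = Suc j"
    then obtain c where "c \<in> Part" "c (Suc i) = Suc j" by blast
    then show "\<exists>c\<in>Pack. c i = j"
      by (intro bexI[OF _ Part_to_Pack[OF False]]) auto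
  qed
next
  case True
  show ?thesis unfolding Pack_empty_if_conflict[OF True] Part_empty_if_conflict[OF True] by simp
qed

lemma reduction_empty: "Pack = {} \<longleftrightarrow> Part = {}"
  using Pack_to_Part Part_to_Pack Pack_empty_if_conflict Part_empty_if_conflict by (metis equals0I ex_in_conv)

text \<open>A value is forced iff no other value is attained, so \<open>reduction_values\<close>
  suffices; this reading also covers infeasible instances.\<close>

lemma reduction_forced:
  assumes "i \<in> {1..p}"
  shows "(\<forall>c\<in>Pack. c i = j) \<longleftrightarrow> (\<forall>c\<in>Part. c (Suc i) = Suc j)"
proof -
  have "(\<forall>c\<in>Pack. c i = j) \<longleftrightarrow> (\<forall>l. (\<exists>c\<in>Pack. c i = l) \<longrightarrow> l = j)" by blast
  also have "\<dots> \<longleftrightarrow> (\<forall>l. (\<exists>c\<in>Part. c (Suc i) = Suc l) \<longrightarrow> l = j)"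
    by (simp only: reduction_values[OF assms])
  also have "\<dots> \<longleftrightarrow> (\<forall>c\<in>Part. c (Suc i) = Suc j)"
  proof -
    \<comment> \<open>Codes in \<open>Part\<close> have no zero rows, so every value is a successor
      and quantifying over \<open>Suc l\<close> loses nothing.\<close>
    have "\<exists>l. c (Suc i) = Suc l" if "c \<in> Part" for c
    proof -
      have "1 \<le> c (Suc i)" using that assms by (auto simp: partitioning_codes_def)
      then show ?thesis by (cases "c (Suc i)") auto
    qed
    then show ?thesis by (metis nat.inject)
  qed
  finally show ?thesis .
qed

end

section \<open>The reduction programs\<close>

definition count_entry :: com where
  "count_entry = Read ''v'' ''I1'' ''i'' ''j'' ;; Cond (Eq ''v'' ''one'') (Incr ''n'') Skip"

definition shift_entry :: com where
  "shift_entry =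
     Copy ''j1'' ''j'' ;; Incr ''j1'' ;;
     Cond (Eq ''n'' ''one'')
       (Read ''v'' ''I1'' ''i'' ''j'' ;; Cond (Eq ''v'' ''one'') (Const ''w'' 0) (Const ''w'' 1))
       (Read ''w'' ''I0'' ''i'' ''j'') ;;
     Write ''I0'' ''i1'' ''j1'' ''w'' ;;
     Write ''I1'' ''i1'' ''j1'' ''z''"

definition slack_entry :: com where
  "slack_entry =
     Cond (Eq ''n'' ''one'') (Write ''I0'' ''i1'' ''one'' ''one'') (Write ''I0'' ''i1'' ''one'' ''z'') ;;
     Write ''I1'' ''i1'' ''one'' ''z'' ;;
     Cond (Less ''one'' ''n'') (Const ''bad'' 1) Skip"

definition shift_row :: com where
  "shift_row =
     (Copy ''i1'' ''i'' ;; Incr ''i1'' ;; row_length ;; Const ''n'' 0) ;;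
     for_up ''j'' ''l'' count_entry ;;
     slack_entry ;;
     for_up ''j'' ''l'' shift_entry"

text \<open>\<open>i\<close> and \<open>j\<close> hold 2 and 3 and serve both as row and as column
  numbers.\<close>

definition block_rows :: com where
  "block_rows =
     Const ''i'' 2 ;; Const ''j'' 3 ;;
     Write ''I0'' ''i'' ''one'' ''z'' ;; Write ''I0'' ''i'' ''i'' ''one'' ;;
     Write ''I0'' ''j'' ''one'' ''one'' ;; Write ''I0'' ''j'' ''i'' ''one'' ;; Write ''I0'' ''j'' ''j'' ''z''"

text \<open>Row \<open>i\<close> is written to row \<open>i + 1\<close> of the same arrays, so the
  rows are treated from the last to the first; row 1 has no source and is set afterwards. Blocking
  comes last because it overwrites shifted data.\<close>

definition packing_to_partitioning :: com where
  "packing_to_partitioning =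
     (Const ''z'' 0 ;; Const ''one'' 1 ;; Const ''bad'' 0 ;; Copy ''i'' ''p'') ;;
     for_down ''i'' ''z'' shift_row ;;
     (Write ''I0'' ''one'' ''one'' ''z'' ;; Write ''I1'' ''one'' ''one'' ''z'' ;; Incr ''p'' ;; Incr ''q'' ;;
      Cond (Eq ''bad'' ''one'') block_rows Skip)"

definition unshift_entry :: com where
  "unshift_entry =
     Copy ''j1'' ''j'' ;; Incr ''j1'' ;;
     Read ''v'' ''I0'' ''i1'' ''j1'' ;; Write ''I0'' ''i'' ''j'' ''v'' ;;
     Read ''v'' ''I1'' ''i1'' ''j1'' ;; Write ''I1'' ''i'' ''j'' ''v''"

definition unshift_row :: com where
  "unshift_row =
     (Copy ''i1'' ''i'' ;; Incr ''i1'' ;; row_length) ;;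
     for_up ''j'' ''l'' unshift_entry"

text \<open>Row \<open>i\<close> is overwritten from row \<open>i + 1\<close>, so this loop must
  ascend. \<open>p\<close> and \<open>q\<close> are decremented first, since they bound the
  loops.\<close>

definition unshift_rows :: com where
  "unshift_rows = (Decr ''p'' ;; Decr ''q'') ;; for_up ''i'' ''p'' unshift_row"

text \<open>If the face is empty, nothing is known about the registers \<open>p\<close> and \<open>q\<close>.\<close>

definition partitioning_to_packing :: com where
  "partitioning_to_packing = Const ''one'' 1 ;; Cond (Eq ''empty'' ''one'') Skip unshift_rows"

section \<open>Loops within a row of the reduction programs\<close>

lemma count_loop:
  assumes s: "reg s ''i'' = i" "reg s ''l'' = n" "reg s ''one'' = 1" "reg s ''n'' = 0"
    and inp: "\<And>j. j \<in> {1..n} \<Longrightarrow> arr s ''I1'' i j = of_bool ((i, j) \<in> I1)"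
  shows "halts_within (for_up ''j'' ''l'' count_entry) s (2 + n * 6)
    (\<lambda>t. reg t ''n'' = card {j \<in> {1..n}. (i, j) \<in> I1} \<and> arr t = arr s \<and>
      (\<forall>x. x \<notin> {''j'', ''v'', ''n''} \<longrightarrow> reg t x = reg s x))"
proof -
  define S where "S j \<longleftrightarrow> 1 \<le> j \<and> (i, j) \<in> I1" for j
  define cnt where "cnt k = card {j. S j \<and> j \<le> k}" for k
  have start: "cnt 0 = 0" by (auto simp: cnt_def S_def)
  have cnt_Suc: "cnt (Suc k) = cnt k + of_bool (S (Suc k))" for k
    unfolding cnt_def by (rule card_le_Suc)
  have total: "card {j \<in> {1..n}. (i, j) \<in> I1} = cnt n"
    unfolding cnt_def by (rule arg_cong[of _ _ card]) (auto simp: S_def)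
  let ?P = "\<lambda>k (u :: store). reg u ''j'' = k \<and> reg u ''n'' = cnt k \<and> arr u = arr s \<and>
      (\<forall>x. x \<notin> {''j'', ''v'', ''n''} \<longrightarrow> reg u x = reg s x)"
  show ?thesis
    unfolding total
  proof (rule halts_for_up[where P = ?P and n = n and m = 4])
    show "?P 0 (set_reg ''j'' 0 s)" using s start by simp
  next
    fix k u assume k: "k < n" and u: "?P k u"
    have a: "arr s ''I1'' i (Suc k) = of_bool (S (Suc k))" using inp k by (simp add: S_def)
    show "halts_within count_entry (set_reg ''j'' (Suc k) u) 4 (?P (Suc k))"
    proof (rule halts_wp)
      show "wp count_entry (?P (Suc k)) (set_reg ''j'' (Suc k) u)"
        using u s a by (simp add: count_entry_def cnt_Suc)
    qed (simp add: count_entry_def)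
  qed (use s in auto)
qed

text \<open>Column 1 of the target row is listed as preserved because the slack cell has been
  written there before.\<close>

lemma shift_loop:
  assumes s: "reg s ''i'' = i" "reg s ''i1'' = Suc i" "reg s ''l'' = n" "reg s ''z'' = 0" "reg s ''one'' = 1"
    and inp: "\<And>j. j \<in> {1..n} \<Longrightarrow> arr s ''I0'' i j = of_bool ((i, j) \<in> I0)"
      "\<And>j. j \<in> {1..n} \<Longrightarrow> arr s ''I1'' i j = of_bool ((i, j) \<in> I1)"
  shows "halts_within (for_up ''j'' ''l'' shift_entry) s (2 + n * 12)
    (\<lambda>t. (\<forall>j\<in>{1..n}. arr t ''I0'' (Suc i) (Suc j) =
            of_bool (if reg s ''n'' = 1 then (i, j) \<notin> I1 else (i, j) \<in> I0) \<and>
          arr t ''I1'' (Suc i) (Suc j) = 0) \<and>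
      (\<forall>x. x \<notin> {''j'', ''j1'', ''v'', ''w''} \<longrightarrow> reg t x = reg s x) \<and>
      (\<forall>i'. i' \<noteq> Suc i \<longrightarrow> arr t ''I0'' i' = arr s ''I0'' i' \<and> arr t ''I1'' i' = arr s ''I1'' i') \<and>
      arr t ''I0'' (Suc i) 1 = arr s ''I0'' (Suc i) 1 \<and> arr t ''I1'' (Suc i) 1 = arr s ''I1'' (Suc i) 1)"
proof -
  define S where "S j \<longleftrightarrow> (if reg s ''n'' = 1 then (i, j) \<notin> I1 else (i, j) \<in> I0)" for j
  let ?P = "\<lambda>k (u :: store). reg u ''j'' = k \<and>
      (\<forall>j\<in>{1..k}. arr u ''I0'' (Suc i) (Suc j) = of_bool (S j) \<and> arr u ''I1'' (Suc i) (Suc j) = 0) \<and>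
      (\<forall>x. x \<notin> {''j'', ''j1'', ''v'', ''w''} \<longrightarrow> reg u x = reg s x) \<and>
      (\<forall>i'. i' \<noteq> Suc i \<longrightarrow> arr u ''I0'' i' = arr s ''I0'' i' \<and> arr u ''I1'' i' = arr s ''I1'' i') \<and>
      arr u ''I0'' (Suc i) 1 = arr s ''I0'' (Suc i) 1 \<and> arr u ''I1'' (Suc i) 1 = arr s ''I1'' (Suc i) 1"
  show ?thesis
    unfolding S_def[symmetric]
  proof (rule halts_for_up[where P = ?P and n = n and m = 10])
    fix k u assume k: "k < n" and u: "?P k u"
    have vals: "reg u ''i'' = i" "reg u ''i1'' = Suc i" "reg u ''z'' = 0" "reg u ''one'' = 1"
      "reg u ''n'' = reg s ''n''"
      "arr u ''I0'' i (Suc k) = of_bool ((i, Suc k) \<in> I0)" "arr u ''I1'' i (Suc k) = of_bool ((i, Suc k) \<in> I1)"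
      using u s inp k by simp_all
    let ?U = "\<lambda>t :: store. reg t ''j'' = Suc k \<and>
      arr t ''I0'' (Suc i) (Suc (Suc k)) = of_bool (S (Suc k)) \<and> arr t ''I1'' (Suc i) (Suc (Suc k)) = 0 \<and>
      (\<forall>x. x \<notin> {''j'', ''j1'', ''v'', ''w''} \<longrightarrow> reg t x = reg u x) \<and>
      (\<forall>i'. i' \<noteq> Suc i \<longrightarrow> arr t ''I0'' i' = arr u ''I0'' i' \<and> arr t ''I1'' i' = arr u ''I1'' i') \<and>
      (\<forall>j. j \<noteq> Suc (Suc k) \<longrightarrow> arr t ''I0'' (Suc i) j = arr u ''I0'' (Suc i) j \<and>
        arr t ''I1'' (Suc i) j = arr u ''I1'' (Suc i) j)"
    show "halts_within shift_entry (set_reg ''j'' (Suc k) u) 10 (?P (Suc k))"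
    proof (rule halts_mono[OF halts_wp order_refl])
      show "wp shift_entry ?U (set_reg ''j'' (Suc k) u)"
        unfolding shift_entry_def by (auto simp: vals S_def)
      fix t :: store assume t: "?U t"
      have "arr t ''I0'' (Suc i) (Suc j) = of_bool (S j) \<and> arr t ''I1'' (Suc i) (Suc j) = 0"
        if "j \<in> {1..Suc k}" for j
      proof (cases "j = Suc k")
        case False
        then have "j \<in> {1..k}" "Suc j \<noteq> Suc (Suc k)" using that by auto
        then show ?thesis using t u by metis
      qed (use t in simp)
      moreover have "reg t x = reg s x" if "x \<notin> {''j'', ''j1'', ''v'', ''w''}" for x
        using t u that by metis
      ultimately show "?P (Suc k) t" using t u by simp
    qed (simp add: shift_entry_def)
  qed (use s in auto)
qed

lemma unshift_loop:
  assumes s: "reg s ''i'' = i" "reg s ''i1'' = Suc i" "reg s ''l'' = n"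
  shows "halts_within (for_up ''j'' ''l'' unshift_entry) s (2 + n * 8)
    (\<lambda>t. (\<forall>j\<in>{1..n}. arr t ''I0'' i j = arr s ''I0'' (Suc i) (Suc j) \<and>
          arr t ''I1'' i j = arr s ''I1'' (Suc i) (Suc j)) \<and>
      (\<forall>x. x \<notin> {''j'', ''j1'', ''v''} \<longrightarrow> reg t x = reg s x) \<and>
      (\<forall>i'. i' \<noteq> i \<longrightarrow> arr t ''I0'' i' = arr s ''I0'' i' \<and> arr t ''I1'' i' = arr s ''I1'' i'))"
proof -
  let ?P = "\<lambda>k (u :: store). reg u ''j'' = k \<and>
      (\<forall>j\<in>{1..k}. arr u ''I0'' i j = arr s ''I0'' (Suc i) (Suc j) \<and>
          arr u ''I1'' i j = arr s ''I1'' (Suc i) (Suc j)) \<and>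
      (\<forall>x. x \<notin> {''j'', ''j1'', ''v''} \<longrightarrow> reg u x = reg s x) \<and>
      (\<forall>i'. i' \<noteq> i \<longrightarrow> arr u ''I0'' i' = arr s ''I0'' i' \<and> arr u ''I1'' i' = arr s ''I1'' i')"
  show ?thesis
  proof (rule halts_for_up[where P = ?P and n = n and m = 6])
    fix k u assume k: "k < n" and u: "?P k u"
    have vals: "reg u ''i'' = i" "reg u ''i1'' = Suc i"
      "arr u ''I0'' (Suc i) = arr s ''I0'' (Suc i)" "arr u ''I1'' (Suc i) = arr s ''I1'' (Suc i)"
      using u s by simp_all
    let ?U = "\<lambda>t :: store. reg t ''j'' = Suc k \<and>
      arr t ''I0'' i (Suc k) = arr s ''I0'' (Suc i) (Suc (Suc k)) \<and>
      arr t ''I1'' i (Suc k) = arr s ''I1'' (Suc i) (Suc (Suc k)) \<and>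
      (\<forall>x. x \<notin> {''j'', ''j1'', ''v''} \<longrightarrow> reg t x = reg u x) \<and>
      (\<forall>i'. i' \<noteq> i \<longrightarrow> arr t ''I0'' i' = arr u ''I0'' i' \<and> arr t ''I1'' i' = arr u ''I1'' i') \<and>
      (\<forall>j. j \<noteq> Suc k \<longrightarrow> arr t ''I0'' i j = arr u ''I0'' i j \<and> arr t ''I1'' i j = arr u ''I1'' i j)"
    show "halts_within unshift_entry (set_reg ''j'' (Suc k) u) 6 (?P (Suc k))"
    proof (rule halts_mono[OF halts_wp order_refl])
      show "wp unshift_entry ?U (set_reg ''j'' (Suc k) u)"
        unfolding unshift_entry_def by (simp add: vals)
      fix t :: store assume t: "?U t"
      have "arr t ''I0'' i j = arr s ''I0'' (Suc i) (Suc j) \<and> arr t ''I1'' i j = arr s ''I1'' (Suc i) (Suc j)"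
        if "j \<in> {1..Suc k}" for j
      proof (cases "j = Suc k")
        case False
        then have "j \<in> {1..k}" using that by auto
        then show ?thesis using t u False by metis
      qed (use t in simp)
      moreover have "reg t x = reg s x" if "x \<notin> {''j'', ''j1'', ''v''}" for x
        using t u that by metis
      ultimately show "?P (Suc k) t" using t u by simp
    qed (simp add: unshift_entry_def)
  qed (use s in auto)
qed

section \<open>Passes over all rows\<close>

lemma unshift_rows_halts:
  assumes s: "reg s ''p'' = Suc p" "reg s ''q'' = Suc q"
  shows "halts_within unshift_rows s (4 + p * (q * 8 + 12))
    (\<lambda>t. reg t ''p'' = p \<and> reg t ''q'' = q \<and> reg t ''empty'' = reg s ''empty'' \<and>
      (\<forall>i\<in>{1..p}. \<forall>j\<in>{1..min i q}. arr t ''I0'' i j = arr s ''I0'' (Suc i) (Suc j) \<and>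
        arr t ''I1'' i j = arr s ''I1'' (Suc i) (Suc j)))"
proof -
  let ?out = "\<lambda>(u :: store) i j. arr u ''I0'' i j = arr s ''I0'' (Suc i) (Suc j) \<and>
        arr u ''I1'' i j = arr s ''I1'' (Suc i) (Suc j)"
  let ?F = "\<lambda>u :: store. reg u ''p'' = p \<and> reg u ''q'' = q \<and> reg u ''empty'' = reg s ''empty''"
  \<comment> \<open>Rows after \<open>k\<close> are untouched, so the source of each step is
    intact.\<close>
  let ?P = "\<lambda>k (u :: store). reg u ''i'' = k \<and> ?F u \<and>
     (\<forall>i'. k < i' \<longrightarrow> arr u ''I0'' i' = arr s ''I0'' i' \<and> arr u ''I1'' i' = arr s ''I1'' i') \<and>
     (\<forall>i\<in>{1..k}. \<forall>j\<in>{1..min i q}. ?out u i j)"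
  show ?thesis
    unfolding unshift_rows_def
  proof (rule halts_Seq)
    show "halts_within (Decr ''p'' ;; Decr ''q'') s 2 (\<lambda>u. ?F u \<and> arr u = arr s)"
      using s by (intro halts_wp) simp_all
    fix u0 :: store assume u0: "?F u0 \<and> arr u0 = arr s"
    show "halts_within (for_up ''i'' ''p'' unshift_row) u0 (2 + p * (q * 8 + 12))
      (\<lambda>t. reg t ''p'' = p \<and> reg t ''q'' = q \<and> reg t ''empty'' = reg s ''empty'' \<and>
        (\<forall>i\<in>{1..p}. \<forall>j\<in>{1..min i q}. ?out t i j))"
    proof (rule halts_for_up[where P = ?P and n = p and m = "10 + q * 8"])
      show "?P 0 (set_reg ''i'' 0 u0)" using u0 by simp
    next
      fix k u assume k: "k < p" and u: "?P k u"
      define i where "i = Suc k"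
      define n where "n = min i q"
      have nq: "n \<le> q" by (simp add: n_def)
      let ?w = "set_reg ''i'' (Suc k) u"
      let ?R = "\<lambda>v :: store. ?F v \<and> reg v ''i'' = i \<and> reg v ''i1'' = Suc i \<and> reg v ''l'' = n \<and> arr v = arr u"
      show "halts_within unshift_row ?w (10 + q * 8) (?P (Suc k))"
        unfolding unshift_row_def
      proof (rule halts_Seq[where R = ?R])
        show "halts_within (Copy ''i1'' ''i'' ;; Incr ''i1'' ;; row_length) ?w 6 ?R"
        proof (rule halts_wp)
          show "wp (Copy ''i1'' ''i'' ;; Incr ''i1'' ;; row_length) ?R ?w"
            using u by (simp add: row_length_def i_def n_def)
        qed (simp add: row_length_def)
        fix v :: store assume v: "?R v"
        have loop: "halts_within (for_up ''j'' ''l'' unshift_entry) v (2 + n * 8)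
          (\<lambda>t. (\<forall>j\<in>{1..n}. arr t ''I0'' i j = arr v ''I0'' (Suc i) (Suc j) \<and>
            arr t ''I1'' i j = arr v ''I1'' (Suc i) (Suc j)) \<and>
          (\<forall>x. x \<notin> {''j'', ''j1'', ''v''} \<longrightarrow> reg t x = reg v x) \<and>
          (\<forall>i'. i' \<noteq> i \<longrightarrow> arr t ''I0'' i' = arr v ''I0'' i' \<and> arr t ''I1'' i' = arr v ''I1'' i'))"
          by (rule unshift_loop) (use v in simp_all)
        show "halts_within (for_up ''j'' ''l'' unshift_entry) v (2 + q * 8) (?P (Suc k))"
        proof (rule halts_mono[OF loop])
          fix t :: store
          assume t: "(\<forall>j\<in>{1..n}. arr t ''I0'' i j = arr v ''I0'' (Suc i) (Suc j) \<and>
            arr t ''I1'' i j = arr v ''I1'' (Suc i) (Suc j)) \<and>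
          (\<forall>x. x \<notin> {''j'', ''j1'', ''v''} \<longrightarrow> reg t x = reg v x) \<and>
          (\<forall>i'. i' \<noteq> i \<longrightarrow> arr t ''I0'' i' = arr v ''I0'' i' \<and> arr t ''I1'' i' = arr v ''I1'' i')"
          have "?out t i' j" if "i' \<in> {1..Suc k}" "j \<in> {1..min i' q}" for i' j
          proof (cases "i' = i")
            case True
            have "arr u ''I0'' (Suc i) = arr s ''I0'' (Suc i)" "arr u ''I1'' (Suc i) = arr s ''I1'' (Suc i)"
              using u by (simp_all add: i_def)
            then show ?thesis using t v that True by (simp add: n_def)
          next
            case False
            then have "i' \<in> {1..k}" using that by (auto simp: i_def)
            then have "?out u i' j" using u that by blast
            then show ?thesis using t v False by simp
          qed
          moreover have "arr t ''I0'' i' = arr s ''I0'' i' \<and> arr t ''I1'' i' = arr s ''I1'' i'"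
            if "Suc k < i'" for i'
          proof -
            have "i' \<noteq> i" "k < i'" using that by (auto simp: i_def)
            then show ?thesis using t v u by simp
          qed
          ultimately show "?P (Suc k) t" using t v by (simp add: i_def)
        qed (use nq in simp)
      qed simp
    qed (use u0 in auto)
  qed simp
qed

lemma packing_to_partitioning_halts:
  assumes inst: "packing_instance p q I0 I1" and inp: "stores_pair p q I0 I1 s"
  shows "halts_within packing_to_partitioning s (30 + p * (q * 18 + 40))
    (stores_pair (p + 1) (q + 1) (reduced_zeros p q I0 I1) {})"
proof -
  let ?Z = "shifted_zero I0 I1"
  let ?bad = "\<lambda>k. \<exists>i\<in>{Suc k..p}. 1 < card {l. (i, l) \<in> I1}"
  let ?out = "\<lambda>(u :: store) i j. arr u ''I0'' i j = of_bool (?Z i j) \<and> arr u ''I1'' i j = 0"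
  let ?F = "\<lambda>u :: store. reg u ''p'' = p \<and> reg u ''q'' = q \<and> reg u ''z'' = 0 \<and> reg u ''one'' = 1"
  \<comment> \<open>Row \<open>k + 1\<close> is in transit: its input has been consumed and its
    output comes with row \<open>k\<close>, so the last two conjuncts leave it out.\<close>
  let ?P = "\<lambda>k (u :: store). k \<le> p \<and> reg u ''i'' = k \<and> ?F u \<and> reg u ''bad'' = of_bool (?bad k) \<and>
     (\<forall>i\<le>k. arr u ''I0'' i = arr s ''I0'' i \<and> arr u ''I1'' i = arr s ''I1'' i) \<and>
     (\<forall>i\<in>{Suc (Suc k)..Suc p}. \<forall>j\<in>{1..min i (Suc q)}. ?out u i j)"
  have pq: "2 \<le> q" "q \<le> p" and I: "I0 \<subseteq> idx p q" "I1 \<subseteq> idx p q"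
    using packing_instance_facts[OF inst] by auto
  have src: "arr s ''I0'' i j = of_bool ((i, j) \<in> I0) \<and> arr s ''I1'' i j = of_bool ((i, j) \<in> I1)"
    if "(i, j) \<in> idx p q" for i j
    using inp that by (auto simp: stores_pair_def)
  show ?thesis
    unfolding packing_to_partitioning_def
  proof (rule halts_Seq)
    show "halts_within (Const ''z'' 0 ;; Const ''one'' 1 ;; Const ''bad'' 0 ;; Copy ''i'' ''p'') s 4 (?P p)"
      using inp by (intro halts_wp) (simp_all add: stores_pair_def)
    fix u0 :: store assume u0: "?P p u0"
    let ?tail = "Write ''I0'' ''one'' ''one'' ''z'' ;; Write ''I1'' ''one'' ''one'' ''z'' ;; Incr ''p'' ;; Incr ''q'' ;;
      Cond (Eq ''bad'' ''one'') block_rows Skip"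
    show "halts_within (for_down ''i'' ''z'' shift_row ;; ?tail) u0 (20 + p * (q * 18 + 40))
      (stores_pair (p + 1) (q + 1) (reduced_zeros p q I0 I1) {})"
    proof (rule halts_Seq)
      show "halts_within (for_down ''i'' ''z'' shift_row) u0 (1 + p * (q * 18 + 40)) (?P 0)"
      proof (rule halts_for_down[where P = ?P and n = p and m = "38 + q * 18"])
        show "?P p u0" by (rule u0)
      next
        fix k u assume k: "k < p" and u: "?P (Suc k) u"
        define i where "i = Suc k"
        define n where "n = min i q"
        define N where "N = card {l. (i, l) \<in> I1}"
        have nq: "n \<le> q" by (simp add: n_def)
        have N_row: "N = card {j \<in> {1..n}. (i, j) \<in> I1}"
          unfolding N_def by (rule arg_cong[of _ _ card]) (use I in \<open>auto simp: n_def idx_def\<close>)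
        have Z: "?Z (Suc i) (Suc j) \<longleftrightarrow> (if N = 1 then (i, j) \<notin> I1 else (i, j) \<in> I0)" for j
          by (simp add: shifted_zero_def single_def N_def)
        have Z1: "?Z (Suc i) 1 \<longleftrightarrow> N = 1"
          using Z[of 0] not_in_sets[OF inst, of i 0] by simp
        have bad: "?bad k \<longleftrightarrow> 1 < N \<or> ?bad (Suc k)"
        proof -
          have "{Suc k..p} = insert i {Suc (Suc k)..p}" using k by (auto simp: i_def)
          then show ?thesis by (simp add: N_def)
        qed
        have row: "arr s ''I0'' i j = of_bool ((i, j) \<in> I0)" "arr s ''I1'' i j = of_bool ((i, j) \<in> I1)"
          if "j \<in> {1..n}" for j
          using src[of i j] that k by (auto simp: idx_def n_def i_def)
        let ?G = "\<lambda>v :: store. ?F v \<and> reg v ''i'' = i \<and> reg v ''i1'' = Suc i \<and> reg v ''l'' = n \<and>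
          (\<forall>i'. i' \<noteq> Suc i \<longrightarrow> arr v ''I0'' i' = arr u ''I0'' i' \<and> arr v ''I1'' i' = arr u ''I1'' i')"
        let ?R1 = "\<lambda>v :: store. ?G v \<and> reg v ''bad'' = of_bool (?bad (Suc k)) \<and> reg v ''n'' = 0"
        let ?R2 = "\<lambda>v :: store. ?G v \<and> reg v ''bad'' = of_bool (?bad (Suc k)) \<and> reg v ''n'' = N"
        let ?R3 = "\<lambda>v :: store. ?G v \<and> reg v ''bad'' = of_bool (?bad k) \<and> reg v ''n'' = N \<and> ?out v (Suc i) 1"
        let ?init = "Copy ''i1'' ''i'' ;; Incr ''i1'' ;; row_length ;; Const ''n'' 0"
        show "halts_within shift_row u (38 + q * 18) (\<lambda>v. reg v ''i'' = Suc k \<and> ?P k (set_reg ''i'' k v))"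
          unfolding shift_row_def
        proof (rule halts_Seq[where R = ?R1])
          show "halts_within ?init u 7 ?R1"
          proof (rule halts_wp)
            show "wp ?init ?R1 u" using u by (simp add: row_length_def i_def n_def)
          qed (simp add: row_length_def)
          fix v1 :: store assume v1: "?R1 v1"
          have ui: "arr u ''I0'' i = arr s ''I0'' i" "arr u ''I1'' i = arr s ''I1'' i"
            using u by (simp_all add: i_def)
          show "halts_within (for_up ''j'' ''l'' count_entry ;; slack_entry ;; for_up ''j'' ''l'' shift_entry)
            v1 (20 + q * 18) (\<lambda>v. reg v ''i'' = Suc k \<and> ?P k (set_reg ''i'' k v))"
          proof (rule halts_Seq[where R = ?R2])
            have loop: "halts_within (for_up ''j'' ''l'' count_entry) v1 (2 + n * 6)
              (\<lambda>t. reg t ''n'' = card {j \<in> {1..n}. (i, j) \<in> I1} \<and> arr t = arr v1 \<and>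
                (\<forall>x. x \<notin> {''j'', ''v'', ''n''} \<longrightarrow> reg t x = reg v1 x))"
              by (rule count_loop) (use v1 ui row in simp_all)
            show "halts_within (for_up ''j'' ''l'' count_entry) v1 (2 + q * 6) ?R2"
              by (rule halts_mono[OF loop]) (use v1 nq N_row in simp_all)
            fix v2 :: store assume v2: "?R2 v2"
            show "halts_within (slack_entry ;; for_up ''j'' ''l'' shift_entry)
              v2 (12 + q * 12) (\<lambda>v. reg v ''i'' = Suc k \<and> ?P k (set_reg ''i'' k v))"
            proof (rule halts_Seq[where R = ?R3])
              show "halts_within slack_entry v2 8 ?R3"
              proof (rule halts_wp)
                show "wp slack_entry ?R3 v2"
                  unfolding slack_entry_def bad Z1 using v2 by simp
              qed (simp add: slack_entry_def)
              fix v3 :: store assume v3: "?R3 v3"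
              let ?t = "\<lambda>t. (\<forall>j\<in>{1..n}. arr t ''I0'' (Suc i) (Suc j) =
                  of_bool (if reg v3 ''n'' = 1 then (i, j) \<notin> I1 else (i, j) \<in> I0) \<and>
                  arr t ''I1'' (Suc i) (Suc j) = 0) \<and>
                (\<forall>x. x \<notin> {''j'', ''j1'', ''v'', ''w''} \<longrightarrow> reg t x = reg v3 x) \<and>
                (\<forall>i'. i' \<noteq> Suc i \<longrightarrow> arr t ''I0'' i' = arr v3 ''I0'' i' \<and> arr t ''I1'' i' = arr v3 ''I1'' i') \<and>
                arr t ''I0'' (Suc i) 1 = arr v3 ''I0'' (Suc i) 1 \<and> arr t ''I1'' (Suc i) 1 = arr v3 ''I1'' (Suc i) 1"
              have loop: "halts_within (for_up ''j'' ''l'' shift_entry) v3 (2 + n * 12) ?t"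
                by (rule shift_loop) (use v3 ui row in simp_all)
              show "halts_within (for_up ''j'' ''l'' shift_entry) v3 (2 + q * 12)
                (\<lambda>v. reg v ''i'' = Suc k \<and> ?P k (set_reg ''i'' k v))"
              proof (rule halts_mono[OF loop])
                fix t :: store assume t: "?t t"
                have "?out t i' j" if i': "i' \<in> {Suc (Suc k)..Suc p}" and j: "j \<in> {1..min i' (Suc q)}" for i' j
                proof (cases "i' = Suc i")
                  case True
                  show ?thesis
                  proof (cases "j = 1")
                    case True
                    have "?out t (Suc i) 1" using t v3 by metis
                    then show ?thesis unfolding True \<open>i' = Suc i\<close> .
                  next
                    case False
                    then obtain j' where j': "j = Suc j'" "j' \<in> {1..n}"
                      using j \<open>i' = Suc i\<close> by (cases j) (auto simp: n_def)
                    have "?out t (Suc i) (Suc j')" using t v3 j'(2) by (simp add: Z)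
                    then show ?thesis unfolding j'(1) \<open>i' = Suc i\<close> .
                  qed
                next
                  case False
                  then have "i' \<in> {Suc (Suc (Suc k))..Suc p}" using i' by (auto simp: i_def)
                  then have "?out u i' j" using u j by blast
                  then show ?thesis using t v3 False by simp
                qed
                moreover have "arr t ''I0'' i' = arr s ''I0'' i' \<and> arr t ''I1'' i' = arr s ''I1'' i'"
                  if "i' \<le> k" for i'
                proof -
                  have "i' \<noteq> Suc i" "i' \<le> Suc k" using that by (auto simp: i_def)
                  then show ?thesis using t v3 u by simp
                qed
                moreover have "?F t \<and> reg t ''i'' = Suc k \<and> reg t ''bad'' = of_bool (?bad k)"
                  using t v3 by (simp add: i_def)
                ultimately show "reg t ''i'' = Suc k \<and> ?P k (set_reg ''i'' k t)" using k by simp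
              qed (use nq in simp)
            qed simp
          qed simp
        qed simp
      qed auto
      fix u1 :: store assume u1: "?P 0 u1"
      have bad: "?bad 0 \<longleftrightarrow> conflict p I1" by (simp add: conflict_def)
      have Z11: "\<not> ?Z 1 1" using not_single_0[OF inst] not_in_sets(1)[OF inst, of 0 0]
        by (simp add: shifted_zero_def)
      have rows: "?out u1 i j" if "i \<in> {2..Suc p}" "j \<in> {1..min i (Suc q)}" for i j
        using u1 that by (simp add: numeral_2_eq_2)
      show "halts_within ?tail u1 14 (stores_pair (p + 1) (q + 1) (reduced_zeros p q I0 I1) {})"
      proof (rule halts_mono[OF halts_wp])
        let ?Q = "\<lambda>t :: store. reg t ''p'' = Suc p \<and> reg t ''q'' = Suc q \<and>
          (\<forall>i j. arr t ''I1'' i j = (if i = 1 \<and> j = 1 then 0 else arr u1 ''I1'' i j)) \<and>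
          (\<forall>i j. arr t ''I0'' i j = (if i = 1 \<and> j = 1 then 0
             else if conflict p I1 \<and> i = 2 \<and> j \<in> {1, 2} then of_bool (j = 2)
             else if conflict p I1 \<and> i = 3 \<and> j \<in> {1, 2, 3} then of_bool (j \<le> 2)
             else arr u1 ''I0'' i j))"
        show "wp ?tail ?Q u1"
          using u1 unfolding bad by (auto simp: block_rows_def)
        show "cost ?tail \<le> 14" by (simp add: block_rows_def)
        fix t :: store assume t: "?Q t"
        have out: "arr t ''I0'' i j = of_bool ((i, j) \<in> reduced_zeros p q I0 I1) \<and> arr t ''I1'' i j = 0"
          if ij: "(i, j) \<in> idx (p + 1) (q + 1)" for i j
        proof (cases "i = 1")
          case True
          then have "j = 1" using ij by (auto simp: idx_def)
          then show ?thesis using t Z11 True by (simp add: reduced_zeros_def)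
        next
          case False
          then have "i \<in> {2..Suc p}" "j \<in> {1..min i (Suc q)}" using ij by (auto simp: idx_def)
          then have o: "?out u1 i j" and j: "1 \<le> j" "j \<le> i" using rows by auto
          \<comment> \<open>Inside the triangle rows 2 and 3 have no further columns, so blocking
            replaces them completely.\<close>
          have "j \<in> {1, 2} \<or> i \<noteq> 2" "j \<in> {1, 2, 3} \<or> i \<noteq> 3" using j by auto
          then show ?thesis using t o ij False by (auto simp: reduced_zeros_def)
        qed
        show "stores_pair (p + 1) (q + 1) (reduced_zeros p q I0 I1) {} t"
          by (rule stores_pairI) (use t out in simp_all)
      qed simp
    qed simp
  qed simp
qed

section \<open>The reduction and its running time\<close>

lemma reduction_correct:
  "reduces_packing_to_partitioning packing_to_partitioning partitioning_to_packing (\<lambda>p q. 200 * (p * q))"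
  unfolding reduces_packing_to_partitioning_def
proof (intro allI impI)
  fix p q I0 I1 s
  assume inst: "packing_instance p q I0 I1" and inp: "stores_pair p q I0 I1 s"
  note facts = packing_instance_facts[OF inst]
  let ?J = "reduced_zeros p q I0 I1"
  have J: "?J \<subseteq> idx (p + 1) (q + 1)" "{} \<subseteq> idx (p + 1) (q + 1)" by (auto simp: reduced_zeros_def)
  define C where "C = packing_codes p q I0 I1"
  define C' where "C' = partitioning_codes (p + 1) (q + 1) ?J {}"
  have "p \<le> p * q" "1 \<le> p * q" using facts by simp_all
  moreover have "30 + p * (q * 18 + 40) = 30 + 40 * p + 18 * (p * q)" "6 + p * (q * 8 + 12) = 6 + 12 * p + 8 * (p * q)"
    by (simp_all add: algebra_simps)
  \<comment> \<open>The sums are at most \<open>(30 + 40 + 18) * (p * q)\<close> and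
    \<open>(6 + 12 + 8) * (p * q)\<close>.\<close>
  ultimately have time: "30 + p * (q * 18 + 40) \<le> 200 * (p * q)" "6 + p * (q * 8 + 12) \<le> 200 * (p * q)"
    by linarith+
  have post: "halts_within partitioning_to_packing t (200 * (p * q))
      (stores_fixing p q (cube_face p q I0 I1) (packing_orbitope p q))"
    if "stores_fixing (p + 1) (q + 1) (cube_face (p + 1) (q + 1) ?J {}) (partitioning_orbitope (p + 1) (q + 1)) t" for t
  proof -
    have t: "stores_result (p + 1) (q + 1) C' t"
      using that unfolding stores_fixing_partitioning[OF J] C'_def .
    let ?t = "set_reg ''one'' 1 t"
    have "halts_within (Cond (Eq ''empty'' ''one'') Skip unshift_rows) ?t (5 + p * (q * 8 + 12)) (stores_result p q C)"
    proof (cases "C' = {}")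
      case True
      then have "C = {}" "reg t ''empty'' = 1"
        using reduction_empty[OF inst] t by (simp_all add: C_def C'_def stores_result_def)
      then show ?thesis
        by (intro halts_Cond[where n = 1] halts_wp) (simp_all add: stores_result_def)
    next
      case False
      then have C: "C \<noteq> {}" using reduction_empty[OF inst] by (simp add: C_def C'_def)
      have st: "reg t ''empty'' = 0"
          "stores_pair (p + 1) (q + 1) {(i, j). \<forall>c\<in>C'. c i \<noteq> j} {(i, j). \<forall>c\<in>C'. c i = j} t"
        using t unfolding stores_result_def if_not_P[OF False] by simp_all
      then have r: "reg ?t ''p'' = Suc p" "reg ?t ''q'' = Suc q" "reg ?t ''empty'' = 0"
        by (simp_all add: stores_pair_def)
      have a: "arr t ''I0'' i j = of_bool (\<forall>c\<in>C'. c i \<noteq> j) \<and> arr t ''I1'' i j = of_bool (\<forall>c\<in>C'. c i = j)"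
        if "(i, j) \<in> idx (p + 1) (q + 1)" for i j
        using bspec[OF st(2)[unfolded stores_pair_def, THEN conjunct2, THEN conjunct2] that] by simp
      have "halts_within unshift_rows ?t (4 + p * (q * 8 + 12)) (stores_result p q C)"
      proof (rule halts_mono[OF unshift_rows_halts[OF r(1,2)] order_refl])
        fix w :: store
        assume w: "reg w ''p'' = p \<and> reg w ''q'' = q \<and> reg w ''empty'' = reg ?t ''empty'' \<and>
          (\<forall>i\<in>{1..p}. \<forall>j\<in>{1..min i q}. arr w ''I0'' i j = arr ?t ''I0'' (Suc i) (Suc j) \<and>
            arr w ''I1'' i j = arr ?t ''I1'' (Suc i) (Suc j))"
        show "stores_result p q C w"
        proof (rule stores_resultI[OF C])
          fix i j assume ij: "(i, j) \<in> idx p q"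
          then have i: "i \<in> {1..p}" and j: "j \<in> {1..min i q}" and S: "(Suc i, Suc j) \<in> idx (p + 1) (q + 1)"
            by (auto simp: idx_def)
          have "(\<forall>c\<in>C. c i \<noteq> j) \<longleftrightarrow> (\<forall>c\<in>C'. c (Suc i) \<noteq> Suc j)"
            using reduction_values[OF inst i, of j] unfolding C_def C'_def by blast
          moreover have "(\<forall>c\<in>C. c i = j) \<longleftrightarrow> (\<forall>c\<in>C'. c (Suc i) = Suc j)"
            using reduction_forced[OF inst i, of j] unfolding C_def C'_def .
          moreover have "arr w ''I0'' i j = arr t ''I0'' (Suc i) (Suc j) \<and> arr w ''I1'' i j = arr t ''I1'' (Suc i) (Suc j)"
            using w i j unfolding arr_set_reg by blast
          ultimately show "arr w ''I0'' i j = of_bool (\<forall>c\<in>C. c i \<noteq> j) \<and> arr w ''I1'' i j = of_bool (\<forall>c\<in>C. c i = j)"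
            using a[OF S] by presburger
        qed (use w r in simp_all)
      qed
      then show ?thesis
        by (intro halts_Cond[where n = "4 + p * (q * 8 + 12)"]) (use r(3) in simp_all)
    qed
    then show ?thesis
      unfolding stores_fixing_packing[OF facts(3,4)] C_def[symmetric] partitioning_to_packing_def
      by (intro halts_Seq[where R = "\<lambda>u. u = ?t" and m = 1]) (use time(2) in \<open>auto intro: halts_wp\<close>)
  qed
  show "\<exists>J0 J1. partitioning_instance (p + 1) (q + 1) J0 J1 \<and>
      halts_within packing_to_partitioning s (200 * (p * q)) (stores_pair (p + 1) (q + 1) J0 J1) \<and>
      (\<forall>t. stores_fixing (p + 1) (q + 1) (cube_face (p + 1) (q + 1) J0 J1)
             (partitioning_orbitope (p + 1) (q + 1)) t \<longrightarrow>
           halts_within partitioning_to_packing t (200 * (p * q))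
             (stores_fixing p q (cube_face p q I0 I1) (packing_orbitope p q)))"
    using reduced_instance[OF inst] halts_mono[OF packing_to_partitioning_halts[OF inst inp] time(1)] post
    by blast
qed

section \<open>Adjusting the time bounds\<close>

lemma reduces_mono:
  assumes red: "reduces_packing_to_partitioning pre post S" and le: "\<And>p q. S p q \<le> T p q"
  shows "reduces_packing_to_partitioning pre post T"
  unfolding reduces_packing_to_partitioning_def
proof (intro allI impI)
  fix p q I0 I1 s
  assume "packing_instance p q I0 I1" "stores_pair p q I0 I1 s"
  with red obtain J0 J1 where J: "partitioning_instance (p + 1) (q + 1) J0 J1"
    and pre: "halts_within pre s (S p q) (stores_pair (p + 1) (q + 1) J0 J1)"
    and post: "\<And>t. stores_fixing (p + 1) (q + 1) (cube_face (p + 1) (q + 1) J0 J1)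
        (partitioning_orbitope (p + 1) (q + 1)) t \<Longrightarrow>
      halts_within post t (S p q) (stores_fixing p q (cube_face p q I0 I1) (packing_orbitope p q))"
    unfolding reduces_packing_to_partitioning_def by blast
  show "\<exists>J0 J1. partitioning_instance (p + 1) (q + 1) J0 J1 \<and>
      halts_within pre s (T p q) (stores_pair (p + 1) (q + 1) J0 J1) \<and>
      (\<forall>t. stores_fixing (p + 1) (q + 1) (cube_face (p + 1) (q + 1) J0 J1)
             (partitioning_orbitope (p + 1) (q + 1)) t \<longrightarrow>
           halts_within post t (T p q) (stores_fixing p q (cube_face p q I0 I1) (packing_orbitope p q)))"
  proof (intro exI conjI allI impI)
    show "partitioning_instance (p + 1) (q + 1) J0 J1" by (rule J)
    show "halts_within pre s (T p q) (stores_pair (p + 1) (q + 1) J0 J1)"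
      using pre le by (rule halts_mono)
    fix t assume "stores_fixing (p + 1) (q + 1) (cube_face (p + 1) (q + 1) J0 J1)
      (partitioning_orbitope (p + 1) (q + 1)) t"
    then show "halts_within post t (T p q) (stores_fixing p q (cube_face p q I0 I1) (packing_orbitope p q))"
      using post le by (blast intro: halts_mono)
  qed
qed

lemma solves_orbitopal_mono:
  assumes sol: "solves_orbitopal_fixing c S" and le: "\<And>p q. S p q \<le> T p q"
  shows "solves_orbitopal_fixing c T"
  unfolding solves_orbitopal_fixing_def
proof (intro allI impI)
  fix p q I0 I1 s
  assume "partitioning_instance p q I0 I1" "stores_pair p q I0 I1 s"
  with sol have "halts_within c s (S p q) (stores_fixing p q (cube_face p q I0 I1) (partitioning_orbitope p q))"
    unfolding solves_orbitopal_fixing_def by blast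
  then show "halts_within c s (T p q) (stores_fixing p q (cube_face p q I0 I1) (partitioning_orbitope p q))"
    using le by (rule halts_mono)
qed

text \<open>Domination is demanded for positive dimensions only: no multiple of \<open>p * q\<close>
  bounds \<open>(p + 1) * (q + 1)\<close> when one of them is 0.\<close>

lemma solves_packing_mono:
  assumes "solves_packing_fixing c S" "\<And>p q. 1 \<le> p \<Longrightarrow> 1 \<le> q \<Longrightarrow> S p q \<le> T p q"
  shows "solves_packing_fixing c T"
  unfolding solves_packing_fixing_def
proof (intro allI impI)
  fix p q I0 I1 s
  assume inst: "packing_instance p q I0 I1" and inp: "stores_pair p q I0 I1 s"
  then have "halts_within c s (S p q) (stores_fixing p q (cube_face p q I0 I1) (packing_orbitope p q))"
    using assms(1) unfolding solves_packing_fixing_def by blast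
  moreover have "S p q \<le> T p q" using packing_instance_facts[OF inst] by (intro assms(2)) auto
  ultimately show "halts_within c s (T p q) (stores_fixing p q (cube_face p q I0 I1) (packing_orbitope p q))"
    by (rule halts_mono)
qed

theorem corollary1:
  shows "\<exists>(pre::com) (solve::com) (post::com) (C::nat).
    reduces_packing_to_partitioning pre post (\<lambda>p q. C * (p * q)) \<and>
    solves_orbitopal_fixing solve (\<lambda>p q. C * (p * q)) \<and>
    solves_packing_fixing (Seq pre (Seq solve post)) (\<lambda>p q. C * (p * q))"
proof (intro exI conjI)
  show "reduces_packing_to_partitioning packing_to_partitioning partitioning_to_packing (\<lambda>p q. 1200 * (p * q))"
    by (rule reduces_mono[OF reduction_correct]) simp
  show "solves_orbitopal_fixing orbitopal_fixing (\<lambda>p q. 1200 * (p * q))"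
    by (rule solves_orbitopal_mono[OF orbitopal_fixing_correct]) simp
  show "solves_packing_fixing (packing_to_partitioning ;; orbitopal_fixing ;; partitioning_to_packing)
      (\<lambda>p q. 1200 * (p * q))"
  proof (rule solves_packing_mono[OF reduction_composes[OF reduction_correct orbitopal_fixing_correct]])
    fix p q :: nat assume "1 \<le> p" "1 \<le> q"
    \<comment> \<open>Enlarging the instance costs a factor 4, so the solver contributes 800 and the
      two reduction programs 200 each.\<close>
    then have "(p + 1) * (q + 1) \<le> (2 * p) * (2 * q)" by (intro mult_le_mono) auto
    then show "200 * ((p + 1) * (q + 1)) + 2 * (200 * (p * q)) \<le> 1200 * (p * q)" by simp
  qed
qed

end
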